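(* For any finite set $\Phi(x;y)$ of $\mathcal{L}_{\mathrm{aff}}$-formulas in $\mathbb{Q}_p$, there is a distal cell decomposition $\mathcal{T}$ for $\Phi$ with $|\mathcal{T}(B)|=O(|B|^{|x|})$ (as $B$ ranges over finite nonempty subsets of $\mathbb{Q}_p^{|y|}$), so $\Phi$ has distal density at most $|x|$.
   Context: $\mathcal{L}_{\mathrm{aff}}=\{0,+,-,\{c\cdot\}_{c\in\mathbb{Q}_p},\mid,\{Q_{m,n}\}_{m,n\in\mathbb{N}\setminus\{0\}}\}$; in $\mathbb{Q}_p$ (with $p$-adic valuation $v$), $c\cdot$ is the unary function of scalar multiplication by $c$, $x\mid y$ means $v(x)\le v(y)$, and $Q_{m,n}(a)$ holds iff $a\in\bigcup_{k\in\mathbb{Z}}p^{km}(1+p^n\mathbb{Z}_p)$. The structure considered is $\mathbb{Q}_p$ in this language; note the language has no constant symbols other than $0$. Let $\mathcal{M}$ be a first-order structure with universe $M$ in a language $\mathcal{L}$. Formulas are $\mathcal{L}$-formulas without parameters. In a partitioned formula $\varphi(x;y)$ the variables are split into finite tuples $x,y$ of lengths $|x|,|y|$; all formulas in a set $\Phi(x;y)$ share the same $x$ and $y$. For $b\in M^{|y|}$ put $\varphi(M^{|x|};b)=\{a\in M^{|x|}:\mathcal{M}\models\varphi(a,b)\}$. For $B\subseteq M^{|y|}$, a set $X\subseteq M^{|x|}$ is crossed by $\Phi(x;B)$ if for some $\varphi\in\Phi$, $b\in B$ both $X\cap\varphi(M^{|x|};b)$ and $X\setminus\varphi(M^{|x|};b)$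 are nonempty. A distal cell decomposition $\mathcal{T}$ for a finite set $\Phi(x;y)$ is given by a finite set $\Psi(x;y_1,\dots,y_k)$ of formulas with $|y_1|=\dots=|y_k|=|y|$ and, for each $\psi\in\Psi$, a formula $\theta_\psi(y;y_1,\dots,y_k)$ such that for each finite nonempty $B\subseteq M^{|y|}$ the following holds. Let $\mathcal{T}(B)$ be the set of all $\Delta=\psi(M^{|x|};b_1,\dots,b_k)$ with $\psi\in\Psi$, $b_1,\dots,b_k\in B$, such that no $b\in B$ satisfies $\theta_\psi(b;b_1,\dots,b_k)$. Then $\bigcup\mathcal{T}(B)=M^{|x|}$ and no element of $\mathcal{T}(B)$ is crossed by $\Phi(x;B)$. $\mathcal{T}$ has exponent $r$ if there is $C$ with $|\mathcal{T}(B)|\le C|B|^r$ for all finite nonempty $B\subseteq M^{|y|}$. The distal density of $\Phi$ is the infimum of all reals $r\ge0$ such that $\Phi$ has a distal cell decomposition of exponent $r$ ($\infty$ if there is none). *)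

theory Defs
  imports
    "HOL-Library.Extended_Real"
    "HOL-Computational_Algebra.Fraction_Field"
    "Berlekamp_Zassenhaus.Finite_Field"
begin

section \<open>First-order formulas and their semantics\<close>

datatype 'f tm = Var nat | Fn 'f "'f tm list"

datatype ('f, 'r) fm =
    Eq "'f tm" "'f tm"
  | Rel 'r "'f tm list"
  | Neg "('f, 'r) fm"
  | Conj "('f, 'r) fm" "('f, 'r) fm"
  | Ex nat "('f, 'r) fm"

record ('f, 'r) language =
  fn_symbols :: "'f set"
  rel_symbols :: "'r set"
  fn_arity :: "'f \<Rightarrow> nat"
  rel_arity :: "'r \<Rightarrow> nat"

text \<open>The universe of a structure is the type \<open>'a\<close>.\<close>

record ('f, 'r, 'a) fo_struct =
  fn_interp :: "'f \<Rightarrow> 'a list \<Rightarrow> 'a"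
  rel_interp :: "'r \<Rightarrow> 'a list \<Rightarrow> bool"

primrec wf_tm :: "('f, 'r) language \<Rightarrow> 'f tm \<Rightarrow> bool" where
  "wf_tm L (Var i) \<longleftrightarrow> True"
| "wf_tm L (Fn f ts) \<longleftrightarrow>
     f \<in> fn_symbols L \<and> length ts = fn_arity L f \<and> list_all (wf_tm L) ts"

primrec wf_fm :: "('f, 'r) language \<Rightarrow> ('f, 'r) fm \<Rightarrow> bool" where
  "wf_fm L (Eq s t) \<longleftrightarrow> wf_tm L s \<and> wf_tm L t"
| "wf_fm L (Rel r ts) \<longleftrightarrow>
     r \<in> rel_symbols L \<and> length ts = rel_arity L r \<and> list_all (wf_tm L) ts"
| "wf_fm L (Neg \<phi>) \<longleftrightarrow> wf_fm L \<phi>"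
| "wf_fm L (Conj \<phi> \<psi>) \<longleftrightarrow> wf_fm L \<phi> \<and> wf_fm L \<psi>"
| "wf_fm L (Ex i \<phi>) \<longleftrightarrow> wf_fm L \<phi>"

primrec vars_tm :: "'f tm \<Rightarrow> nat set" where
  "vars_tm (Var i) = {i}"
| "vars_tm (Fn f ts) = \<Union>(set (map vars_tm ts))"

primrec free_vars :: "('f, 'r) fm \<Rightarrow> nat set" where
  "free_vars (Eq s t) = vars_tm s \<union> vars_tm t"
| "free_vars (Rel r ts) = \<Union>(set (map vars_tm ts))"
| "free_vars (Neg \<phi>) = free_vars \<phi>"
| "free_vars (Conj \<phi> \<psi>) = free_vars \<phi> \<union> free_vars \<psi>"
| "free_vars (Ex i \<phi>) = free_vars \<phi> - {i}"

primrec eval_tm :: "('f, 'r, 'a) fo_struct \<Rightarrow> (nat \<Rightarrow> 'a) \<Rightarrow> 'f tm \<Rightarrow> 'a" where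
  "eval_tm M \<sigma> (Var i) = \<sigma> i"
| "eval_tm M \<sigma> (Fn f ts) = fn_interp M f (map (eval_tm M \<sigma>) ts)"

primrec sat :: "('f, 'r, 'a) fo_struct \<Rightarrow> (nat \<Rightarrow> 'a) \<Rightarrow> ('f, 'r) fm \<Rightarrow> bool" where
  "sat M \<sigma> (Eq s t) \<longleftrightarrow> eval_tm M \<sigma> s = eval_tm M \<sigma> t"
| "sat M \<sigma> (Rel r ts) \<longleftrightarrow> rel_interp M r (map (eval_tm M \<sigma>) ts)"
| "sat M \<sigma> (Neg \<phi>) \<longleftrightarrow> \<not> sat M \<sigma> \<phi>"
| "sat M \<sigma> (Conj \<phi> \<psi>) \<longleftrightarrow> sat M \<sigma> \<phi> \<and> sat M \<sigma> \<psi>"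
| "sat M \<sigma> (Ex i \<phi>) \<longleftrightarrow> (\<exists>u. sat M (\<sigma>(i := u)) \<phi>)"

text \<open>
  A formula in a tuple of \<open>N\<close> variables has its free variables among \<open>0, \<dots>, N - 1\<close>. A partitioned
  formula \<open>\<phi>(x; y)\<close> with \<open>|x| = d\<close> and \<open>|y| = e\<close> is a formula in \<open>d + e\<close> variables, where \<open>x\<close>
  consists of the first \<open>d\<close> ones; it is evaluated at \<open>(a, b)\<close> as at the concatenated list \<open>a @ b\<close>.
  In \<open>holds M \<phi> as\<close>, variables beyond the length of \<open>as\<close> get an unspecified value, which is
  irrelevant for formulas in \<open>length as\<close> variables.
\<close>

definition formula_in :: "('f, 'r) language \<Rightarrow> nat \<Rightarrow> ('f, 'r) fm \<Rightarrow> bool" where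
  "formula_in L N \<phi> \<longleftrightarrow> wf_fm L \<phi> \<and> free_vars \<phi> \<subseteq> {..<N}"

definition holds :: "('f, 'r, 'a) fo_struct \<Rightarrow> ('f, 'r) fm \<Rightarrow> 'a list \<Rightarrow> bool" where
  "holds M \<phi> as \<longleftrightarrow> sat M (\<lambda>i. as ! i) \<phi>"

lemma eval_tm_cong:
  "(\<And>i. i \<in> vars_tm t \<Longrightarrow> \<sigma> i = \<tau> i) \<Longrightarrow> eval_tm M \<sigma> t = eval_tm M \<tau> t"
proof (induction t)
  case (Fn f ts)
  then have "map (eval_tm M \<sigma>) ts = map (eval_tm M \<tau>) ts" by fastforce
  then show ?case by (simp only: eval_tm.simps)
qed simp

lemma sat_cong:
  "(\<And>i. i \<in> free_vars \<phi> \<Longrightarrow> \<sigma> i = \<tau> i) \<Longrightarrow> sat M \<sigma> \<phi> \<longleftrightarrow> sat M \<tau> \<phi>"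
proof (induction \<phi> arbitrary: \<sigma> \<tau>)
  case (Eq s t)
  then show ?case using eval_tm_cong[of s \<sigma> \<tau> M] eval_tm_cong[of t \<sigma> \<tau> M] by simp
next
  case (Rel r ts)
  have "map (eval_tm M \<sigma>) ts = map (eval_tm M \<tau>) ts"
    using Rel by (auto intro!: eval_tm_cong)
  then show ?case by (simp only: sat.simps)
next
  case (Neg \<phi>)
  show ?case using Neg.IH[of \<sigma> \<tau>] Neg.prems by simp
next
  case (Conj \<phi>1 \<phi>2)
  show ?case using Conj.IH[of \<sigma> \<tau>] Conj.prems by simp
next
  case (Ex i \<phi>)
  have "sat M (\<sigma>(i := u)) \<phi> \<longleftrightarrow> sat M (\<tau>(i := u)) \<phi>" for u
    by (rule Ex.IH) (use Ex.prems in auto)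
  then show ?case by simp
qed

section \<open>Distal cell decompositions\<close>

definition tuples :: "nat \<Rightarrow> 'a list set" where
  "tuples n = {a. length a = n}"

definition definable_set ::
  "('f, 'r, 'a) fo_struct \<Rightarrow> nat \<Rightarrow> ('f, 'r) fm \<Rightarrow> 'a list \<Rightarrow> 'a list set" where
  "definable_set M d \<phi> b = {a \<in> tuples d. holds M \<phi> (a @ b)}"

definition crossed ::
  "('f, 'r, 'a) fo_struct \<Rightarrow> nat \<Rightarrow> ('f, 'r) fm set \<Rightarrow> 'a list set \<Rightarrow> 'a list set \<Rightarrow> bool" where
  "crossed M d \<Phi> B X \<longleftrightarrow>
     (\<exists>\<phi>\<in>\<Phi>. \<exists>b\<in>B. X \<inter> definable_set M d \<phi> b \<noteq> {} \<and> X - definable_set M d \<phi> b \<noteq> {})"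

text \<open>
  The data of a distal cell decomposition: the number \<open>k\<close>, the set \<open>\<Psi>(x; y\<^sub>1, \<dots>, y\<^sub>k)\<close>, and the
  formulas \<open>\<theta>\<^sub>\<psi>(y; y\<^sub>1, \<dots>, y\<^sub>k)\<close>, given as a function of \<open>\<psi>\<close> (of which only the values on \<open>\<Psi>\<close> matter).
\<close>

record ('f, 'r) cell_scheme =
  params :: nat
  cell_fms :: "('f, 'r) fm set"
  excl_fm :: "('f, 'r) fm \<Rightarrow> ('f, 'r) fm"

definition cells ::
  "('f, 'r, 'a) fo_struct \<Rightarrow> nat \<Rightarrow> ('f, 'r) cell_scheme \<Rightarrow> 'a list set \<Rightarrow> 'a list set set" where
  "cells M d T B =
     {definable_set M d \<psi> (concat bs) | \<psi> bs.
        \<psi> \<in> cell_fms T \<and> length bs = params T \<and> set bs \<subseteq> B \<and>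
        \<not> (\<exists>b\<in>B. holds M (excl_fm T \<psi>) (b @ concat bs))}"

definition distal_cell_decomposition ::
  "('f, 'r) language \<Rightarrow> ('f, 'r, 'a) fo_struct \<Rightarrow> nat \<Rightarrow> nat \<Rightarrow>
   ('f, 'r) fm set \<Rightarrow> ('f, 'r) cell_scheme \<Rightarrow> bool" where
  "distal_cell_decomposition L M d e \<Phi> T \<longleftrightarrow>
     finite (cell_fms T) \<and>
     (\<forall>\<psi>\<in>cell_fms T. formula_in L (d + params T * e) \<psi> \<and>
        formula_in L (e + params T * e) (excl_fm T \<psi>)) \<and>
     (\<forall>B. B \<subseteq> tuples e \<and> finite B \<and> B \<noteq> {} \<longrightarrow>
        \<Union>(cells M d T B) = tuples d \<and>
        (\<forall>\<Delta>\<in>cells M d T B. \<not> crossed M d \<Phi> B \<Delta>))"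

text \<open>The sets \<open>cells M d T B\<close> are finite for finite \<open>B\<close>, so \<open>card\<close> is the true cardinality.\<close>

lemma finite_cells:
  assumes "finite (cell_fms T)" "finite B"
  shows "finite (cells M d T B)"
proof -
  let ?bs = "{bs. set bs \<subseteq> B \<and> length bs = params T}"
  have "cells M d T B \<subseteq> (\<lambda>(\<psi>, bs). definable_set M d \<psi> (concat bs)) ` (cell_fms T \<times> ?bs)"
    unfolding cells_def by auto
  moreover have "finite (cell_fms T \<times> ?bs)"
    using assms finite_lists_length_eq by blast
  ultimately show ?thesis by (meson finite_imageI finite_subset)
qed

definition has_exponent ::
  "('f, 'r, 'a) fo_struct \<Rightarrow> nat \<Rightarrow> nat \<Rightarrow> ('f, 'r) cell_scheme \<Rightarrow> real \<Rightarrow> bool" where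
  "has_exponent M d e T r \<longleftrightarrow>
     (\<exists>C::real. \<forall>B. B \<subseteq> tuples e \<and> finite B \<and> B \<noteq> {} \<longrightarrow>
        real (card (cells M d T B)) \<le> C * real (card B) powr r)"

definition distal_density ::
  "('f, 'r) language \<Rightarrow> ('f, 'r, 'a) fo_struct \<Rightarrow> nat \<Rightarrow> nat \<Rightarrow> ('f, 'r) fm set \<Rightarrow> ereal" where
  "distal_density L M d e \<Phi> =
     Inf {ereal r | r. r \<ge> 0 \<and>
       (\<exists>T. distal_cell_decomposition L M d e \<Phi> T \<and> has_exponent M d e T r)}"

section \<open>The $p$-adic numbers\<close>

text \<open>
  The prime \<open>p\<close> is \<open>CARD('p)\<close> for a type \<open>'p\<close> of class \<open>prime_card\<close>. The ring of \<open>p\<close>-adic integers is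
  the inverse limit of the rings \<open>\<int>/p\<^sup>n\<int>\<close>: an element is a sequence of integers \<open>a n\<close> in
  \<open>{0..<p ^ n}\<close> with \<open>a n\<close> congruent to \<open>a (Suc n)\<close> modulo \<open>p ^ n\<close>. The field of \<open>p\<close>-adic numbers is its
  field of fractions.
\<close>

typedef (overloaded) 'p padic_int = "{a :: nat \<Rightarrow> int. \<forall>n. a n = a (Suc n) mod int CARD('p) ^ n}"
  morphisms residue Abs_padic_int
  by (intro exI[of _ "\<lambda>_. 0"]) simp

setup_lifting type_definition_padic_int

lemma mod_mod_power_Suc: "(a::int) mod p ^ Suc n mod p ^ n = a mod p ^ n"
  by (simp add: mod_mod_cancel)

lemma coherent_add:
  fixes p :: int
  assumes "\<And>n. a n = a (Suc n) mod p ^ n" "\<And>n. b n = b (Suc n) mod p ^ n"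
  shows "(a n + b n) mod p ^ n = (a (Suc n) + b (Suc n)) mod p ^ Suc n mod p ^ n"
  unfolding mod_mod_power_Suc
  by (subst assms(1), subst assms(2), rule mod_add_eq)

lemma coherent_minus:
  fixes p :: int
  assumes "\<And>n. a n = a (Suc n) mod p ^ n"
  shows "(- a n) mod p ^ n = (- a (Suc n)) mod p ^ Suc n mod p ^ n"
  unfolding mod_mod_power_Suc
  by (subst assms(1), rule mod_minus_eq)

lemma coherent_diff:
  fixes p :: int
  assumes "\<And>n. a n = a (Suc n) mod p ^ n" "\<And>n. b n = b (Suc n) mod p ^ n"
  shows "(a n - b n) mod p ^ n = (a (Suc n) - b (Suc n)) mod p ^ Suc n mod p ^ n"
  unfolding mod_mod_power_Suc
  by (subst assms(1), subst assms(2), rule mod_diff_eq)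

lemma coherent_mult:
  fixes p :: int
  assumes "\<And>n. a n = a (Suc n) mod p ^ n" "\<And>n. b n = b (Suc n) mod p ^ n"
  shows "(a n * b n) mod p ^ n = (a (Suc n) * b (Suc n)) mod p ^ Suc n mod p ^ n"
  unfolding mod_mod_power_Suc
  by (subst assms(1), subst assms(2), rule mod_mult_eq)

instantiation padic_int :: (prime_card) comm_ring_1
begin

lift_definition zero_padic_int :: "'a padic_int" is "\<lambda>_. 0" by simp

lift_definition one_padic_int :: "'a padic_int" is "\<lambda>n. 1 mod int CARD('a) ^ n"
  by (simp only: mod_mod_power_Suc simp_thms)

lift_definition plus_padic_int :: "'a padic_int \<Rightarrow> 'a padic_int \<Rightarrow> 'a padic_int"
  is "\<lambda>a b n. (a n + b n) mod int CARD('a) ^ n"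
  by (rule coherent_add)

lift_definition uminus_padic_int :: "'a padic_int \<Rightarrow> 'a padic_int"
  is "\<lambda>a n. (- a n) mod int CARD('a) ^ n"
  by (rule coherent_minus)

lift_definition minus_padic_int :: "'a padic_int \<Rightarrow> 'a padic_int \<Rightarrow> 'a padic_int"
  is "\<lambda>a b n. (a n - b n) mod int CARD('a) ^ n"
  by (rule coherent_diff)

lift_definition times_padic_int :: "'a padic_int \<Rightarrow> 'a padic_int \<Rightarrow> 'a padic_int"
  is "\<lambda>a b n. (a n * b n) mod int CARD('a) ^ n"
  by (rule coherent_mult)

lemma padic_int_eqI: "(\<And>n. residue a n = residue b n) \<Longrightarrow> a = b"
  for a b :: "'a padic_int"
  by (simp add: residue_inject[symmetric] fun_eq_iff)

lemma residue_Suc_mod: "residue a (Suc n) mod int CARD('a) ^ n = residue a n"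
  for a :: "'a padic_int"
  using residue[of a] by (metis (mono_tags, lifting) mem_Collect_eq)

lemma residue_mod_self [simp]: "residue a n mod int CARD('a) ^ n = residue a n"
  for a :: "'a padic_int"
  by (metis mod_mod_trivial residue_Suc_mod)

lemmas residue_simps =
  zero_padic_int.rep_eq one_padic_int.rep_eq plus_padic_int.rep_eq
  uminus_padic_int.rep_eq minus_padic_int.rep_eq times_padic_int.rep_eq

instance
proof
  fix a b c :: "'a padic_int"
  show "a * b * c = a * (b * c)"
    by (rule padic_int_eqI) (simp add: residue_simps mod_mult_left_eq mod_mult_right_eq mult.assoc)
  show "a * b = b * a"
    by (rule padic_int_eqI) (simp add: residue_simps mult.commute)
  show "1 * a = a"
    by (rule padic_int_eqI) (simp add: residue_simps mod_mult_left_eq)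
  show "a + b + c = a + (b + c)"
    by (rule padic_int_eqI) (simp add: residue_simps mod_add_left_eq mod_add_right_eq add.assoc)
  show "a + b = b + a"
    by (rule padic_int_eqI) (simp add: residue_simps add.commute)
  show "0 + a = a"
    by (rule padic_int_eqI) (simp add: residue_simps)
  show "- a + a = 0"
    by (rule padic_int_eqI) (simp add: residue_simps mod_add_left_eq)
  show "a - b = a + - b"
    by (rule padic_int_eqI) (simp add: residue_simps mod_add_right_eq)
  show "(a + b) * c = a * c + b * c"
    by (rule padic_int_eqI) (simp add: residue_simps mod_mult_left_eq mod_add_eq distrib_right)
  have "(1::int) mod int CARD('a) ^ 1 = 1"
    using prime_gt_1_nat[OF prime_card[where 'a='a]] by simp
  then have "residue (0 :: 'a padic_int) 1 \<noteq> residue (1 :: 'a padic_int) 1"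
    by (simp add: residue_simps)
  then show "0 \<noteq> (1 :: 'a padic_int)"
    by metis
qed

end

lemma residue_mod:
  "m \<le> n \<Longrightarrow> residue (a :: 'p::prime_card padic_int) n mod int CARD('p) ^ m = residue a m"
proof (induction n rule: dec_induct)
  case base
  show ?case by simp
next
  case (step n)
  have "residue a (Suc n) mod int CARD('p) ^ m =
        residue a (Suc n) mod int CARD('p) ^ n mod int CARD('p) ^ m"
    using step by (simp add: mod_mod_cancel le_imp_power_dvd)
  then show ?case using step by (simp add: residue_Suc_mod)
qed

instance padic_int :: (prime_card) idom
proof
  fix a b :: "'a padic_int"
  let ?p = "int CARD('a)"
  assume "a \<noteq> 0" "b \<noteq> 0"
  then obtain i j where ij: "residue a i \<noteq> 0" "residue b j \<noteq> 0"
    by (metis padic_int_eqI zero_padic_int.rep_eq)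
  let ?x = "residue a (i + j)" and ?y = "residue b (i + j)"
  have nd: "\<not> ?p ^ i dvd ?x" "\<not> ?p ^ j dvd ?y"
    using ij residue_mod[of i "i + j" a] residue_mod[of j "i + j" b] by auto
  have "\<not> ?p ^ (i + j) dvd ?x * ?y"
  proof
    assume "?p ^ (i + j) dvd ?x * ?y"
    then obtain k l where kl: "k + l = i + j" "?p ^ k dvd ?x" "?p ^ l dvd ?y"
      using prime_elem_power_dvd_prod[of ?p "i + j" ?x ?y] prime_card_int[where 'a='a] by auto
    then have "i \<le> k \<or> j \<le> l" by linarith
    then show False using kl nd power_le_dvd by blast
  qed
  then have "residue (a * b) (i + j) \<noteq> 0"
    by (simp add: residue_simps dvd_eq_mod_eq_0)
  then show "a * b \<noteq> 0"
    by (metis zero_padic_int.rep_eq)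
qed

type_synonym 'p padic = "'p padic_int fract"

definition Zp :: "'p::prime_card padic set" where
  "Zp = range (\<lambda>a. Fract a 1)"

definition prime_elt :: "'p::prime_card padic" where
  "prime_elt = of_nat CARD('p)"

definition pval :: "'p::prime_card padic \<Rightarrow> ereal" where
  "pval x = (if x = 0 then \<infinity>
     else ereal (of_int (GREATEST k. \<exists>z\<in>Zp. x = prime_elt powi k * z)))"

lemma residue_zero [simp]: "residue a 0 = 0" for a :: "'p::prime_card padic_int"
  using residue_mod_self[of a 0] by simp

lemma residue_power_prime:
  "residue (of_nat CARD('p) ^ k * a) n = int CARD('p) ^ k * residue a n mod int CARD('p) ^ n"
  for a :: "'p::prime_card padic_int"
proof -
  have of_nat: "residue (of_nat m :: 'p padic_int) n = int m mod int CARD('p) ^ n" for m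
    by (induction m) (simp_all add: residue_simps mod_add_right_eq mod_add_left_eq mod_add_eq)
  show ?thesis
  proof (induction k)
    case (Suc k)
    have "of_nat CARD('p) ^ Suc k * a = of_nat CARD('p) * (of_nat CARD('p) ^ k * a)"
      by simp
    then have "residue (of_nat CARD('p) ^ Suc k * a) n =
        int CARD('p) * residue (of_nat CARD('p) ^ k * a) n mod int CARD('p) ^ n"
      by (simp only: times_padic_int.rep_eq of_nat mod_mult_left_eq)
    also have "\<dots> = int CARD('p) * (int CARD('p) ^ k * residue a n) mod int CARD('p) ^ n"
      unfolding Suc by (rule mod_mult_right_eq)
    finally show ?case by (simp only: power_Suc mult.assoc)
  qed simp
qed

lemma power_prime_dvd_iff:
  "of_nat CARD('p) ^ k dvd a \<longleftrightarrow> residue a k = 0" for a :: "'p::prime_card padic_int"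
proof
  assume "of_nat CARD('p) ^ k dvd a"
  then obtain c where "a = of_nat CARD('p) ^ k * c" by (rule dvdE)
  then show "residue a k = 0" by (simp only: residue_power_prime) simp
next
  let ?p = "int CARD('p)"
  have p0: "?p > 0" using prime_gt_0_nat[OF prime_card[where 'a='p]] by simp
  assume 0: "residue a k = 0"
  define f where "f n = residue a (k + n) div ?p ^ k" for n
  have div: "?p ^ k * f n = residue a (k + n)" for n
  proof -
    have "?p ^ k dvd residue a (k + n)"
      using residue_mod[of k "k + n" a] 0 by (simp only: le_add1 dvd_eq_mod_eq_0 simp_thms)
    then show ?thesis unfolding f_def by (rule dvd_mult_div_cancel)
  qed
  have coh: "f n = f (Suc n) mod ?p ^ n" for n
  proof -
    have "?p ^ k * (f (Suc n) mod ?p ^ n) = ?p ^ k * f (Suc n) mod ?p ^ (k + n)"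
      by (simp add: power_add)
    also have "\<dots> = ?p ^ k * f n"
      using residue_mod[of "k + n" "k + Suc n" a] by (simp add: div)
    finally show ?thesis using p0 by simp
  qed
  have f: "residue (Abs_padic_int f :: 'p padic_int) = f"
    by (intro Abs_padic_int_inverse CollectI allI coh)
  have "a = of_nat CARD('p) ^ k * (Abs_padic_int f :: 'p padic_int)"
  proof (rule padic_int_eqI)
    fix n
    have "?p ^ k * f n mod ?p ^ n = residue a n"
      using residue_mod[of n "k + n" a] by (simp add: div)
    then show "residue a n = residue (of_nat CARD('p) ^ k * (Abs_padic_int f :: 'p padic_int)) n"
      by (simp only: residue_power_prime f)
  qed
  then show "of_nat CARD('p) ^ k dvd a" by (rule dvdI)
qed

lemma Fract_power: "Fract (a ^ n) 1 = Fract a 1 ^ n" for a :: "'a::idom"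
proof (induction n)
  case (Suc n)
  have "Fract (a ^ Suc n) 1 = Fract a 1 * Fract (a ^ n) 1" by simp
  then show ?case unfolding Suc by simp
qed (simp add: One_fract_def)

lemma prime_elt_conv: "prime_elt = Fract (of_nat CARD('p)) (1 :: 'p::prime_card padic_int)"
  by (simp add: prime_elt_def of_nat_fract)

lemma prime_elt_nonzero: "(prime_elt :: 'p::prime_card padic) \<noteq> 0"
proof -
  have p: "CARD('p) > 1" using prime_gt_1_nat[OF prime_card[where 'a='p]] by simp
  have "residue (of_nat CARD('p) ^ 1 * 1 :: 'p padic_int) 2 = int CARD('p) mod int CARD('p) ^ 2"
    unfolding residue_power_prime by (simp add: residue_simps mod_mult_right_eq)
  also have "\<dots> = int CARD('p)"
    using p by (intro mod_pos_pos_trivial) (simp_all add: power2_eq_square)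
  finally have "(of_nat CARD('p) :: 'p padic_int) \<noteq> 0"
    using p by (auto simp: residue_simps)
  then show ?thesis by (simp add: prime_elt_conv Zero_fract_def eq_fract)
qed

text \<open>
  The number \<open>GREATEST k\<close> in the definition of \<open>pval\<close> exists:
  the valuation of \<open>p ^ k\<close> times a \<open>p\<close>-adic integer not divisible by \<open>p\<close> is \<open>k\<close>.
\<close>

lemma pval_power_times_unit:
  fixes u :: "'p::prime_card padic_int"
  assumes u: "\<not> of_nat CARD('p) dvd u"
  shows "pval (prime_elt powi k * Fract u 1) = ereal (of_int k)"
proof -
  let ?x = "prime_elt powi k * Fract u 1" and ?q = "prime_elt :: 'p padic"
  have "u \<noteq> 0" using u by auto
  then have "Fract u 1 \<noteq> 0" by (simp add: Zero_fract_def eq_fract)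
  then have x0: "?x \<noteq> 0" by (simp add: prime_elt_nonzero)
  have "(GREATEST l. \<exists>z\<in>Zp. ?x = prime_elt powi l * z) = k"
  proof (rule Greatest_equality)
    show "\<exists>z\<in>Zp. ?x = prime_elt powi k * z" by (auto simp: Zp_def)
  next
    fix l assume "\<exists>z\<in>Zp. ?x = prime_elt powi l * z"
    then obtain a where a: "?x = ?q powi l * Fract a 1" by (auto simp: Zp_def)
    show "l \<le> k"
    proof (rule ccontr)
      assume "\<not> l \<le> k"
      then obtain n where n: "l = k + int (Suc n)"
        using zless_iff_Suc_zadd[of k l] by auto
      have "?q powi l = ?q powi k * ?q ^ Suc n"
        unfolding n by (subst power_int_add) (use prime_elt_nonzero in \<open>auto simp flip: power_int_of_nat\<close>)
      with a have "Fract u 1 = ?q ^ Suc n * Fract a 1"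
        using prime_elt_nonzero[where 'p='p] by (simp add: mult.assoc)
      then have "u = of_nat CARD('p) ^ Suc n * a"
        by (simp add: prime_elt_conv eq_fract del: power_Suc flip: Fract_power)
      then show False using u by simp
    qed
  qed
  then show ?thesis using x0 by (simp add: pval_def)
qed

lemma padic_int_decomp:
  fixes a :: "'p::prime_card padic_int"
  assumes "a \<noteq> 0"
  obtains n u where "a = of_nat CARD('p) ^ n * u" "\<not> of_nat CARD('p) dvd u"
proof -
  obtain m where "residue a m \<noteq> 0"
    using assms by (metis padic_int_eqI zero_padic_int.rep_eq)
  then have ex: "\<exists>m. \<not> of_nat CARD('p) ^ m dvd a" using power_prime_dvd_iff by blast
  define m where "m = (LEAST m. \<not> of_nat CARD('p) ^ m dvd a)"
  have m: "\<not> of_nat CARD('p) ^ m dvd a" unfolding m_def using ex by (rule LeastI_ex)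
  then obtain n where n: "m = Suc n" by (cases m) auto
  have "of_nat CARD('p) ^ n dvd a"
    using not_less_Least[of n "\<lambda>m. \<not> of_nat CARD('p) ^ m dvd a"] n unfolding m_def by simp
  then obtain u where u: "a = of_nat CARD('p) ^ n * u" by (rule dvdE)
  have "\<not> of_nat CARD('p) dvd u"
    using m unfolding n u by (metis dvd_refl mult_dvd_mono power_Suc2)
  with u show ?thesis using that by blast
qed

lemma padic_int_unit:
  fixes u :: "'p::prime_card padic_int"
  assumes "\<not> of_nat CARD('p) dvd u"
  obtains w where "u * w = 1"
proof -
  let ?p = "int CARD('p)"
  have 1: "residue u 1 \<noteq> 0" using assms power_prime_dvd_iff[of 1 u] by simp
  have "coprime (residue u n) (?p ^ n)" for n
  proof (cases "n = 0")
    case False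
    then have "residue u n mod ?p = residue u 1" using residue_mod[of 1 n u] by simp
    then have "\<not> ?p dvd residue u n" using 1 by auto
    then have "coprime ?p (residue u n)" by (rule prime_imp_coprime[OF prime_card_int])
    then show ?thesis by (simp add: coprime_commute)
  qed simp
  then have "\<forall>n. \<exists>x. [residue u n * x = 1] (mod ?p ^ n)"
    using cong_solve_coprime_int by blast
  then obtain g where g: "[residue u n * g n = 1] (mod ?p ^ n)" for n by metis
  define f where "f n = g n mod ?p ^ n" for n
  have coh: "f n = f (Suc n) mod ?p ^ n" for n
  proof -
    have "[residue u (Suc n) * g (Suc n) = 1] (mod ?p ^ n)"
      using g[of "Suc n"] by (rule cong_dvd_modulus) (simp add: le_imp_power_dvd)
    moreover have "[residue u (Suc n) = residue u n] (mod ?p ^ n)"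
      by (simp add: cong_def residue_Suc_mod)
    ultimately have "[residue u n * g (Suc n) = 1] (mod ?p ^ n)"
      using cong_trans[OF cong_scalar_right[OF cong_sym]] by blast
    then have 1: "[g n * (residue u n * g (Suc n)) = g n * 1] (mod ?p ^ n)"
      by (rule cong_scalar_left)
    have 2: "[(residue u n * g n) * g (Suc n) = 1 * g (Suc n)] (mod ?p ^ n)"
      using g by (rule cong_scalar_right)
    have "(residue u n * g n) * g (Suc n) = g n * (residue u n * g (Suc n))" by (simp only: ac_simps)
    with 1 2 have "[1 * g (Suc n) = g n * 1] (mod ?p ^ n)"
      by (simp only:) (rule cong_trans[OF cong_sym])
    then have "[g (Suc n) = g n] (mod ?p ^ n)" by simp
    then have "g (Suc n) mod ?p ^ n = g n mod ?p ^ n" by (simp only: cong_def)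
    then show ?thesis unfolding f_def mod_mod_power_Suc by (rule sym)
  qed
  have f: "residue (Abs_padic_int f :: 'p padic_int) = f"
    by (intro Abs_padic_int_inverse CollectI allI coh)
  have "u * (Abs_padic_int f :: 'p padic_int) = 1"
  proof (rule padic_int_eqI)
    fix n
    show "residue (u * (Abs_padic_int f :: 'p padic_int)) n = residue (1 :: 'p padic_int) n"
      unfolding residue_simps f f_def using g[of n] by (simp add: cong_def mod_mult_right_eq)
  qed
  then show ?thesis by (rule that)
qed

lemma padic_decomp:
  fixes x :: "'p::prime_card padic"
  assumes "x \<noteq> 0"
  obtains k u where "x = prime_elt powi k * Fract u 1" "\<not> of_nat CARD('p) dvd u"
proof -
  let ?q = "of_nat CARD('p) :: 'p padic_int"
  obtain a b where x: "x = Fract a b" and b: "b \<noteq> 0" by (cases x)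
  have a: "a \<noteq> 0" using assms x b by (auto simp: Zero_fract_def eq_fract)
  obtain n u where n: "a = ?q ^ n * u" "\<not> ?q dvd u" using a by (rule padic_int_decomp)
  obtain m v where m: "b = ?q ^ m * v" "\<not> ?q dvd v" using b by (rule padic_int_decomp)
  obtain w where w: "v * w = 1" using m(2) by (rule padic_int_unit)
  have "a * ?q ^ m = ?q ^ n * u * (v * w) * ?q ^ m" unfolding n w by simp
  then have eq: "a * ?q ^ m * (1 * 1) = ?q ^ n * (u * w) * (b * 1)"
    unfolding m by (simp only: ac_simps mult_1)
  have "x * prime_elt ^ m = Fract (a * ?q ^ m) (b * 1)"
    unfolding x prime_elt_conv Fract_power[symmetric] by (rule mult_fract)
  also have "\<dots> = Fract (?q ^ n * (u * w)) (1 * 1)"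
    using eq b by (simp add: eq_fract)
  also have "\<dots> = prime_elt ^ n * Fract (u * w) 1"
    unfolding prime_elt_conv Fract_power[symmetric] by (rule mult_fract[symmetric])
  finally have eq': "x * prime_elt ^ m = prime_elt ^ n * Fract (u * w) 1" .
  have "prime_elt powi (int n - int m) * Fract (u * w) 1 = prime_elt ^ n * Fract (u * w) 1 / prime_elt ^ m"
    using prime_elt_nonzero[where 'p='p] by (simp add: power_int_diff)
  then have "x = prime_elt powi (int n - int m) * Fract (u * w) 1"
    using prime_elt_nonzero[where 'p='p] unfolding eq'[symmetric] by simp
  moreover have "\<not> ?q dvd u * w"
  proof
    assume "?q dvd u * w"
    then have "?q dvd u * w * v" by (rule dvd_mult2)
    moreover have "u * w * v = u" using w by (simp add: mult.assoc mult.commute[of w v])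
    ultimately show False using n(2) by simp
  qed
  ultimately show ?thesis by (rule that)
qed

section \<open>The affine language\<close>

datatype 'k aff_fn = Zero_sym | Plus_sym | Minus_sym | Scalar_sym 'k

datatype aff_rel = Div_sym | Q_sym nat nat

definition aff_language :: "('p::prime_card padic aff_fn, aff_rel) language" where
  "aff_language = \<lparr>
     fn_symbols = UNIV,
     rel_symbols = {Div_sym} \<union> {Q_sym m n | m n. m \<noteq> 0 \<and> n \<noteq> 0},
     fn_arity = (\<lambda>f. case f of Zero_sym \<Rightarrow> 0 | Plus_sym \<Rightarrow> 2 | Minus_sym \<Rightarrow> 1 | Scalar_sym c \<Rightarrow> 1),
     rel_arity = (\<lambda>r. case r of Div_sym \<Rightarrow> 2 | Q_sym m n \<Rightarrow> 1)\<rparr>"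

definition Qset :: "nat \<Rightarrow> nat \<Rightarrow> 'p::prime_card padic set" where
  "Qset m n = (\<Union>k::int. {prime_elt powi (k * int m) * (1 + prime_elt ^ n * z) | z. z \<in> Zp})"

definition padic_struct :: "('p padic aff_fn, aff_rel, 'p::prime_card padic) fo_struct" where
  "padic_struct = \<lparr>
     fn_interp = (\<lambda>f as. case f of
         Zero_sym \<Rightarrow> 0
       | Plus_sym \<Rightarrow> as ! 0 + as ! 1
       | Minus_sym \<Rightarrow> - (as ! 0)
       | Scalar_sym c \<Rightarrow> c * as ! 0),
     rel_interp = (\<lambda>r as. case r of
         Div_sym \<Rightarrow> pval (as ! 0) \<le> pval (as ! 1)
       | Q_sym m n \<Rightarrow> as ! 0 \<in> Qset m n)\<rparr>"

end

theory Submission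
  imports Defs "HOL-Library.Function_Algebras"
begin

text \<open>
  Quantifier elimination: the truth of a formula depends only on the comparisons between the
  valuations of finitely many linear forms and on the cosets of the values of these forms.
  To eliminate a variable \<open>t\<close>, write \<open>t = c + u\<close> where \<open>c\<close> is the nearest root of one of the forms in
  \<open>t\<close>; then \<open>u\<close> can be replaced by \<open>l * h\<close> with \<open>l\<close> from a finite set of constants and \<open>h\<close> a form
  without \<open>t\<close>.

  Types: let \<open>T\<close> be the finite set of centers \<open>c\<^sub>j(b)\<close>, \<open>b \<in> B\<close>. If \<open>t\<^sub>i \<in> T\<close> is nearest to \<open>p\<^sub>i(x)\<close>, then
  \<open>\<bar>p\<^sub>i(x) - s\<bar> = max \<bar>p\<^sub>i(x) - t\<^sub>i\<bar> \<bar>t\<^sub>i - s\<bar>\<close> for all \<open>s \<in> T\<close>. So the type of \<open>x\<close> over \<open>B\<close> is determined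
  by the cosets of \<open>p\<^sub>i(x) - t\<^sub>i\<close> and by cuts in finite linear orders, and each cut is given by its two
  neighbours. Hence each type is cut out by a bounded number of atoms with parameters in \<open>B\<close>,
  and the cells are the realizations of the types.

  Counting: by the tree structure of \<open>T\<close>, a type is given, up to finitely many possibilities, by
  \<open>O(\<bar>B\<bar>)\<close> comparisons \<open>\<bar>f(x)\<bar> \<le> \<bar>g(x)\<bar>\<close> of affine functions. Multiplying the dominant functions of all
  comparisons gives one polynomial of degree \<open>O(\<bar>B\<bar>)\<close> for each type, and by the ultrametric
  inequality these polynomials are linearly independent. So there are \<open>O(\<bar>B\<bar>\<^sup>d)\<close> types.
\<close>

section \<open>The $p$-adic absolute value\<close>

text \<open>An exclusion formula sees a single new parameter at a time, whereas
  \<open>loc_atom\<close> has two, so it cannot test all atoms over B directly. This is why a cell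
  is also rejected when nearest centers are missing from its own parameters: once they are present,
  the atoms with one parameter in the cell and one in B, together with those whose two parameters
  coincide, determine all others. The scales k with |k| \<le> n serve as follows: if x - t is at
  least 2^n times larger or smaller than t - s, then x - s lies in the coset of the dominant term;
  in between, finitely many tests pin down the ratio of the absolute values. Testing x against all
  pairs of centers would take about |B|^2 comparisons and give only exponent 2d; hence the reduction
  to linearly many pairs. Quantifier elimination is needed only in the form that truth depends on
  finitely many data. The exclusion formulas may keep their quantifiers.\<close>

lemma not_prime_dvd_mult:
  fixes u v :: "'p::prime_card padic_int"
  assumes "\<not> of_nat CARD('p) dvd u" "\<not> of_nat CARD('p) dvd v"
  shows "\<not> of_nat CARD('p) dvd u * v"
proof
  assume "of_nat CARD('p) dvd u * v"
  moreover obtain w where "v * w = 1" using assms(2) by (rule padic_int_unit)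
  ultimately have "of_nat CARD('p) dvd u * (v * w)" "v * w = 1"
    by (metis dvd_mult2 mult.assoc)+
  then show False using assms(1) by simp
qed

text \<open>The base 2 instead of p makes the nonzero values the powers of 2 for every p; only the
  order and the multiplicativity of the valuation matter. Sending 0 to 0 keeps all comparisons
  inside the reals.\<close>

definition pabs :: "'p::prime_card padic \<Rightarrow> real" where
  "pabs x = (if x = 0 then 0 else 2 powr (- real_of_ereal (pval x)))"

lemma pabs_0 [simp]: "pabs 0 = 0"
  by (simp add: pabs_def)

lemma pabs_eq_0_iff [simp]: "pabs x = 0 \<longleftrightarrow> x = 0"
  by (simp add: pabs_def)

lemma pabs_nonneg [simp]: "0 \<le> pabs x"
  by (simp add: pabs_def)

lemma pabs_pos_iff [simp]: "0 < pabs x \<longleftrightarrow> x \<noteq> 0"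
  by (simp add: pabs_def)

lemma pabs_not_neg [simp]: "\<not> pabs x < 0"
  by (simp add: not_less)

lemma pabs_le_0_iff [simp]: "pabs x \<le> 0 \<longleftrightarrow> x = 0"
  by (metis antisym pabs_eq_0_iff pabs_nonneg order_refl)

lemma Fract_unit_nonzero:
  fixes u :: "'p::prime_card padic_int"
  assumes "\<not> of_nat CARD('p) dvd u"
  shows "Fract u 1 \<noteq> 0"
  using assms by (auto simp: Zero_fract_def eq_fract)

lemma pabs_unit_form:
  fixes u :: "'p::prime_card padic_int"
  assumes "\<not> of_nat CARD('p) dvd u"
  shows "pabs (prime_elt powi k * Fract u 1) = 2 powi (- k)"
  using pval_power_times_unit[OF assms, of k] Fract_unit_nonzero[OF assms] prime_elt_nonzero[where 'p='p]
  by (simp add: pabs_def powr_real_of_int' flip: of_int_minus)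

lemma pabs_mult [simp]: "pabs (x * y) = pabs x * pabs (y :: 'p::prime_card padic)"
proof (cases "x = 0 \<or> y = 0")
  case False
  then obtain k u l v where x: "x = prime_elt powi k * Fract u 1" "\<not> of_nat CARD('p) dvd u"
    and y: "y = prime_elt powi l * Fract v 1" "\<not> of_nat CARD('p) dvd v"
    by (metis padic_decomp)
  have xy: "x * y = prime_elt powi (k + l) * Fract (u * v) 1"
    unfolding x y using prime_elt_nonzero[where 'p='p] by (simp add: power_int_add ac_simps)
  show ?thesis
    unfolding xy unfolding x y pabs_unit_form[OF x(2)] pabs_unit_form[OF y(2)]
      pabs_unit_form[OF not_prime_dvd_mult[OF x(2) y(2)]]
    by (simp add: power_int_add[symmetric])
qed auto

lemma pabs_1 [simp]: "pabs (1 :: 'p::prime_card padic) = 1"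
  using pabs_mult[of "1 :: 'p padic" 1] by simp

lemma pabs_divide [simp]: "pabs (x / y) = pabs x / pabs (y :: 'p::prime_card padic)"
proof (cases "y = 0")
  case False
  then show ?thesis using pabs_mult[of "x / y" y] by (simp add: field_simps)
qed simp

lemma pabs_minus [simp]: "pabs (- x) = pabs (x :: 'p::prime_card padic)"
proof -
  have "pabs (- 1 :: 'p padic) * pabs (- 1 :: 'p padic) = 1"
    by (simp flip: pabs_mult)
  then have "pabs (- 1 :: 'p padic) = 1"
    by (metis pabs_nonneg real_sqrt_abs2 abs_of_nonneg real_sqrt_one)
  then show ?thesis using pabs_mult[of "-1" x] by simp
qed

lemma pabs_minus_commute: "pabs (x - y) = pabs (y - x)"
  by (metis minus_diff_eq pabs_minus)

lemma pabs_prime_elt [simp]: "pabs (prime_elt :: 'p::prime_card padic) = 1 / 2"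
proof -
  have 1: "\<not> of_nat CARD('p) dvd (1 :: 'p padic_int)"
    using power_prime_dvd_iff[of 1 "1 :: 'p padic_int"] prime_gt_1_nat[OF prime_card[where 'a='p]]
    by (simp add: residue_simps)
  show ?thesis using pabs_unit_form[OF 1, of 1] by (simp add: power_int_minus flip: One_fract_def)
qed

lemma pabs_power_int: "pabs (x powi k) = pabs (x :: 'p::prime_card padic) powi k"
proof -
  have nat: "pabs (x ^ n) = pabs x ^ n" for n by (induction n) auto
  show ?thesis
    by (cases k rule: int_cases3)
      (auto simp: power_int_minus nat field_simps power_one_over power_int_def inverse_eq_divide)
qed

lemma pabs_prime_elt_powi [simp]:
  "pabs (prime_elt powi k :: 'p::prime_card padic) = 2 powi (- k)"
  by (simp add: pabs_power_int power_int_minus power_int_divide_distrib field_simps)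

lemma pabs_power_of_two:
  fixes x :: "'p::prime_card padic"
  assumes "x \<noteq> 0"
  obtains k where "pabs x = 2 powi k"
  using padic_decomp[OF assms] pabs_unit_form by metis

lemma pabs_Fract_le_1: "pabs (Fract a 1 :: 'p::prime_card padic) \<le> 1"
proof (cases "a = 0")
  case False
  then obtain n u where a: "a = of_nat CARD('p) ^ n * u" "\<not> of_nat CARD('p) dvd u"
    by (rule padic_int_decomp)
  have "Fract a 1 = prime_elt powi int n * Fract u 1"
    unfolding a prime_elt_conv by (simp flip: Fract_power)
  then show ?thesis by (simp only: pabs_unit_form[OF a(2)]) (simp add: power_int_minus field_simps)
qed (simp add: Zero_fract_def[symmetric])

lemma Zp_iff: "z \<in> Zp \<longleftrightarrow> pabs z \<le> 1" for z :: "'p::prime_card padic"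
proof
  assume "pabs z \<le> 1"
  show "z \<in> Zp"
  proof (cases "z = 0")
    case False
    then obtain k u where z: "z = prime_elt powi k * Fract u 1" "\<not> of_nat CARD('p) dvd u"
      by (rule padic_decomp)
    have "(2::real) powi (- k) \<le> 1"
      using \<open>pabs z \<le> 1\<close> unfolding z(1) pabs_unit_form[OF z(2)] .
    then have "k \<ge> 0"
      by (metis linorder_not_le neg_0_less_iff_less one_less_numeral_iff one_less_power_int semiring_norm(76))
    then obtain n where "k = int n" using nonneg_int_cases by blast
    then have "z = Fract (of_nat CARD('p) ^ n * u) 1"
      unfolding z prime_elt_conv by (simp flip: Fract_power)
    then show ?thesis by (simp add: Zp_def)
  qed (simp add: Zp_def Zero_fract_def)
qed (auto simp: Zp_def pabs_Fract_le_1)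

text \<open>After division by the larger summand, the claim is that 1 + a is a p-adic integer
  whenever a is.\<close>

lemma pabs_add_le_max: "pabs (x + y) \<le> max (pabs x) (pabs y)" for x y :: "'p::prime_card padic"
proof -
  have *: "pabs (x + y) \<le> pabs x" if "pabs y \<le> pabs x" for x y :: "'p padic"
  proof (cases "x = 0")
    case False
    then have "y / x \<in> Zp" using that by (simp add: Zp_iff field_simps)
    then obtain a where a: "y / x = Fract a 1" by (auto simp: Zp_def)
    have "x + y = x * (1 + y / x)" using False by (simp add: field_simps)
    also have "1 + y / x = Fract (1 + a) 1" by (simp add: a One_fract_def)
    finally have "pabs (x + y) = pabs x * pabs (Fract (1 + a) 1 :: 'p padic)" by simp
    then show ?thesis using pabs_Fract_le_1[of "1 + a"] mult_left_mono by fastforce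
  qed (use that in auto)
  show ?thesis
    using *[of x y] *[of y x] by (cases "pabs y \<le> pabs x") (auto simp: add.commute)
qed

lemma pabs_diff_le_max: "pabs (x - y) \<le> max (pabs x) (pabs y)" for x y :: "'p::prime_card padic"
  using pabs_add_le_max[of x "- y"] by simp

lemma pabs_add_eq:
  fixes x y :: "'p::prime_card padic"
  assumes "pabs y < pabs x"
  shows "pabs (x + y) = pabs x" "pabs (y + x) = pabs x"
    and "pabs (x - y) = pabs x" "pabs (y - x) = pabs x"
proof -
  have *: "pabs (x + y) = pabs x" if "pabs y < pabs x" for x y :: "'p padic"
    using pabs_add_le_max[of x y] pabs_diff_le_max[of "x + y" y] that by auto
  show "pabs (x + y) = pabs x" "pabs (y + x) = pabs x" "pabs (x - y) = pabs x"
    using *[of y x] *[of "- y" x] assms by (auto simp: add.commute)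
  then show "pabs (y - x) = pabs x" by (simp add: pabs_minus_commute)
qed

lemma pabs_triangle: "pabs (x - z) \<le> max (pabs (x - y)) (pabs (y - z))"
  for x y z :: "'p::prime_card padic"
proof -
  have "x - z = (x - y) + (y - z)" by simp
  show ?thesis unfolding \<open>x - z = (x - y) + (y - z)\<close> by (rule pabs_add_le_max)
qed

lemma pval_le_iff: "pval x \<le> pval y \<longleftrightarrow> pabs y \<le> pabs x" for x y :: "'p::prime_card padic"
  by (auto simp: pabs_def pval_def)

section \<open>Cosets\<close>

text \<open>For nonzero \<open>x\<close> this says that y / x lies in 1 + p^n Zp, and for
  \<open>x = 0\<close> it forces \<open>y = 0\<close>.\<close>

definition near :: "nat \<Rightarrow> 'p::prime_card padic \<Rightarrow> 'p padic \<Rightarrow> bool" where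
  "near n x y \<longleftrightarrow> 2 ^ n * pabs (x - y) \<le> pabs x"

lemma near_pabs:
  assumes "near n x y" "n \<ge> 1"
  shows "pabs x = pabs y"
proof (cases "x = y")
  case False
  have "2 * pabs (x - y) \<le> 2 ^ n * pabs (x - y)"
    using self_le_power[of "2::real" n] assms(2) by (intro mult_right_mono) auto
  also have "\<dots> \<le> pabs x" using assms(1) by (simp add: near_def)
  finally have "pabs (x - y) < pabs x" using False
    by (smt (verit) pabs_pos_iff right_minus_eq)
  then have "pabs (x - (x - y)) = pabs x" by (intro pabs_add_eq)
  then show ?thesis by simp
qed simp

lemma near_refl [simp]: "near n x x"
  by (simp add: near_def)

lemma near_sym: "near n x y \<Longrightarrow> n \<ge> 1 \<Longrightarrow> near n y x"
  using near_pabs[of n x y] by (simp add: near_def pabs_minus_commute)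

lemma near_trans:
  assumes "near n x y" "near n y z" "n \<ge> 1"
  shows "near n x z"
proof -
  have "2 ^ n * pabs (x - z) \<le> 2 ^ n * max (pabs (x - y)) (pabs (y - z))"
    by (intro mult_left_mono pabs_triangle) simp
  also have "\<dots> \<le> pabs x"
    using assms near_pabs[of n x y] by (auto simp: near_def max_def)
  finally show ?thesis by (simp add: near_def)
qed

lemma near_mult:
  assumes "near n x y"
  shows "near n (c * x) (c * y)"
proof -
  have "2 ^ n * pabs (c * x - c * y) = pabs c * (2 ^ n * pabs (x - y))"
    by (simp flip: right_diff_distrib)
  also have "\<dots> \<le> pabs c * pabs x"
    using assms by (intro mult_left_mono) (auto simp: near_def)
  finally show ?thesis by (simp add: near_def)
qed

text \<open>For \<open>n \<ge> 1\<close>, \<open>cosim m n x y\<close> says that \<open>x\<close> and \<open>y\<close> are both zero or have the same nonzero coset modulo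
  the group \<open>Qset m n\<close>.\<close>

definition cosim :: "nat \<Rightarrow> nat \<Rightarrow> 'p::prime_card padic \<Rightarrow> 'p padic \<Rightarrow> bool" where
  "cosim m n x y \<longleftrightarrow> (\<exists>k. near n x (prime_elt powi (k * int m) * y))"

lemma near_cosim: "near n x y \<Longrightarrow> cosim m n x y"
  unfolding cosim_def by (rule exI[of _ 0]) simp

lemma cosim_refl [simp]: "cosim m n x x"
  by (simp add: near_cosim)

lemma cosim_sym:
  assumes "cosim m n x y" "n \<ge> 1"
  shows "cosim m n y x"
proof -
  obtain k where "near n x (prime_elt powi (k * int m) * y)"
    using assms(1) by (auto simp: cosim_def)
  then have "near n (prime_elt powi (- k * int m) * (prime_elt powi (k * int m) * y))
     (prime_elt powi (- k * int m) * x)"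
    using near_sym[OF _ assms(2)] near_mult by blast
  then show ?thesis unfolding cosim_def
    by (intro exI[of _ "- k"]) (simp add: power_int_minus prime_elt_nonzero flip: mult.assoc)
qed

lemma cosim_trans:
  assumes "cosim m n x y" "cosim m n y z" "n \<ge> 1"
  shows "cosim m n x z"
proof -
  obtain k l where "near n x (prime_elt powi (k * int m) * y)"
    and l: "near n y (prime_elt powi (l * int m) * z)"
    using assms by (auto simp: cosim_def)
  moreover have "near n (prime_elt powi (k * int m) * y)
     (prime_elt powi (k * int m) * (prime_elt powi (l * int m) * z))"
    by (intro near_mult l)
  ultimately have "near n x (prime_elt powi (k * int m) * (prime_elt powi (l * int m) * z))"
    using near_trans assms(3) by blast
  then show ?thesis unfolding cosim_def
    by (intro exI[of _ "k + l"])
      (simp add: prime_elt_nonzero power_int_add distrib_right mult.assoc)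
qed

lemma cosim_0:
  assumes "cosim m n x y" "n \<ge> 1"
  shows "x = 0 \<longleftrightarrow> y = 0"
proof -
  obtain k where "near n x (prime_elt powi (k * int m) * y)"
    using assms(1) by (auto simp: cosim_def)
  from near_pabs[OF this assms(2)] have "pabs x = 0 \<longleftrightarrow> pabs y = 0" by simp
  then show ?thesis by simp
qed

lemma cosim_mult: "cosim m n x y \<Longrightarrow> cosim m n (c * x) (c * y)"
  unfolding cosim_def by (metis mult.left_commute near_mult)

text \<open>The scalar p^(km) relating two nonzero elements changes the absolute value by the factor
  2^(-km), so equal absolute values and \<open>m \<ge> 1\<close> leave only k = 0.\<close>

lemma cosim_near:
  assumes "cosim m n x y" "pabs x = pabs y" "n \<ge> 1" "m \<ge> 1"
  shows "near n x y"
proof (cases "x = 0")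
  case True
  then show ?thesis using cosim_0[OF assms(1,3)] by simp
next
  case False
  obtain k where k: "near n x (prime_elt powi (k * int m) * y)"
    using assms(1) by (auto simp: cosim_def)
  from near_pabs[OF this assms(3)] assms(2) False
  have "(2::real) powi (- (k * int m)) = 1"
    using cosim_0[OF assms(1,3)] by auto
  then have "k * int m = 0"
    using power_int_strict_increasing[of 0 "k * int m" "2::real"]
      power_int_strict_increasing[of "k * int m" 0 "2::real"]
    by (cases "k * int m" "0::int" rule: linorder_cases) (auto simp: power_int_minus)
  then show ?thesis using k by auto
qed

lemma cosim_mono:
  assumes "cosim m n x y" "m' dvd m" "n' \<le> n"
  shows "cosim m' n' x y"
proof -
  obtain k where k: "near n x (prime_elt powi (k * int m) * y)"
    using assms(1) by (auto simp: cosim_def)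
  obtain r where "m = m' * r" using assms(2) by blast
  then have "k * int m = (k * int r) * int m'" by simp
  moreover have "near n' x (prime_elt powi (k * int m) * y)"
    unfolding near_def
    by (rule order_trans[OF _ k[unfolded near_def]]) (use assms(3) in \<open>auto intro!: mult_right_mono power_increasing\<close>)
  ultimately show ?thesis unfolding cosim_def by metis
qed

lemma Qset_iff: "n \<ge> 1 \<Longrightarrow> x \<in> Qset m n \<longleftrightarrow> cosim m n x 1" for x :: "'p::prime_card padic"
proof -
  assume n: "n \<ge> 1"
  have "(\<exists>z\<in>Zp. x = q * (1 + prime_elt ^ n * z)) \<longleftrightarrow> near n x q" if "q \<noteq> 0" for q :: "'p padic"
  proof
    assume "\<exists>z\<in>Zp. x = q * (1 + prime_elt ^ n * z)"
    then obtain z where z: "pabs z \<le> 1" "x = q * (1 + prime_elt ^ n * z)" by (auto simp: Zp_iff)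
    then have "2 ^ n * pabs (q - x) = pabs q * pabs z"
      using pabs_prime_elt_powi[of "int n", where 'p='p]
      by (simp add: algebra_simps power_int_minus del: pabs_prime_elt_powi)
    then have "near n q x" using z(1) by (simp add: near_def mult_left_le)
    then show "near n x q" using n near_sym by blast
  next
    assume "near n x q"
    then have "near n q x" using n near_sym by blast
    then have le: "2 ^ n * pabs (q - x) \<le> pabs q" by (simp add: near_def)
    have "x / q - 1 = (x - q) / q" using that by (simp add: field_simps)
    then have "pabs ((x / q - 1) / prime_elt ^ n) = pabs (x - q) / pabs q / pabs (prime_elt ^ n :: 'p padic)"
      by simp
    also have "pabs (prime_elt ^ n :: 'p padic) = 1 / 2 ^ n"
      using pabs_prime_elt_powi[of "int n", where 'p='p]
      by (simp add: power_int_minus divide_inverse del: pabs_prime_elt_powi)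
    also have "pabs (x - q) / pabs q / (1 / 2 ^ n) = 2 ^ n * pabs (q - x) / pabs q"
      by (simp add: pabs_minus_commute[of q])
    also have "\<dots> \<le> 1"
      using le that by (simp add: divide_le_eq)
    finally have "pabs ((x / q - 1) / prime_elt ^ n) \<le> 1" .
    moreover have "x = q * (1 + prime_elt ^ n * ((x / q - 1) / prime_elt ^ n))"
      using that prime_elt_nonzero[where 'p='p] by simp
    ultimately show "\<exists>z\<in>Zp. x = q * (1 + prime_elt ^ n * z)" using Zp_iff by blast
  qed
  then have "(\<exists>k. \<exists>z\<in>Zp. x = prime_elt powi (k * int m) * (1 + prime_elt ^ n * z))
     \<longleftrightarrow> (\<exists>k. near n x (prime_elt powi (k * int m)))"
    using prime_elt_nonzero[where 'p='p] by simp
  then show ?thesis unfolding Qset_def cosim_def by auto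
qed

text \<open>Nonzero absolute values are powers of 2, so none lies strictly between
  \<open>2 powi k * pabs h\<close> and \<open>2 powi (k + 1) * pabs h\<close>.\<close>

lemma pabs_discrete:
  fixes u h :: "'p::prime_card padic"
  assumes "pabs u < 2 powi (k + 1) * pabs h"
  shows "pabs u \<le> 2 powi k * pabs h"
proof (cases "u = 0")
  case False
  then have h: "h \<noteq> 0" using assms by auto
  obtain i j where ij: "pabs u = 2 powi i" "pabs h = 2 powi j"
    using pabs_power_of_two False h by metis
  with assms have "(2::real) powi i < 2 powi (k + 1 + j)" by (simp add: power_int_add)
  then have "i < k + 1 + j"
    by (meson not_le one_le_numeral power_int_increasing)
  then have "(2::real) powi i \<le> 2 powi (k + j)" by (intro power_int_increasing) auto
  then show ?thesis by (simp add: ij power_int_add)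
qed (use assms in auto)

lemma pabs_ratio:
  fixes u h :: "'p::prime_card padic"
  assumes "u \<noteq> 0" "h \<noteq> 0"
  obtains k where "pabs u = 2 powi k * pabs h"
proof -
  obtain i j where ij: "pabs u = 2 powi i" "pabs h = 2 powi j"
    using pabs_power_of_two assms by metis
  then have "pabs u = 2 powi (i - j) * pabs h" by (simp add: power_int_diff)
  then show ?thesis by (rule that)
qed

lemma two_powi_le_iff [simp]: "(2::real) powi k \<le> 2 powi l \<longleftrightarrow> k \<le> l"
  by (meson linorder_not_le one_less_numeral_iff power_int_increasing one_le_numeral
      power_int_strict_increasing semiring_norm(76))

lemma two_powi_less_iff [simp]: "(2::real) powi k < 2 powi l \<longleftrightarrow> k < l"
  by (meson linorder_not_le two_powi_le_iff)

text \<open>The core computation: \<open>u\<close> and \<open>u'\<close> are the displacements of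
  two points from a center, and \<open>h\<close> is that of another center. If \<open>u\<close> is
  tiny or huge compared with \<open>h\<close>, then \<open>u - h\<close> is near \<open>- h\<close>
  or \<open>u\<close>. In between, the thresholds force \<open>pabs u = pabs u'\<close>, so
  \<open>u\<close> and \<open>u'\<close> are even near, and \<open>nearest\<close> prevents a loss
  of precision by cancellation in \<open>u - h\<close>.\<close>

lemma cosim_translate:
  fixes u u' h :: "'p::prime_card padic"
  assumes n: "n \<ge> 1" and m: "m \<ge> 1"
    and cs: "cosim m n u u'"
    and thr: "\<And>k. \<bar>k\<bar> \<le> int n \<Longrightarrow> 2 powi k * pabs h \<le> pabs u \<longleftrightarrow> 2 powi k * pabs h \<le> pabs u'"
    and nearest: "pabs u \<le> pabs (u - h)"
  shows "pabs (u - h) = max (pabs u) (pabs h) \<and> pabs (u' - h) = max (pabs u') (pabs h) \<and>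
    cosim m n (u - h) (u' - h)"
proof (cases "h = 0 \<or> u = 0")
  case True
  then show ?thesis using cs cosim_0[OF cs n] by auto
next
  case False
  then have nz: "h \<noteq> 0" "u \<noteq> 0" "u' \<noteq> 0" using cosim_0[OF cs n] by auto
  have two_n: "(1::real) < 2 ^ n" using n by simp
  have small: "near n (- h) (v - h) \<and> pabs (v - h) = max (pabs v) (pabs h)"
    if "2 ^ n * pabs v \<le> pabs h" for v :: "'p padic"
  proof -
    have "near n (- h) (v - h)" using that by (simp add: near_def)
    moreover from near_pabs[OF this n] have "pabs (v - h) = pabs h" by simp
    moreover have "1 * pabs v \<le> 2 ^ n * pabs v" by (intro mult_right_mono) auto
    ultimately show ?thesis using that by simp
  qed
  have large: "near n v (v - h) \<and> pabs (v - h) = max (pabs v) (pabs h)"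
    if "2 ^ n * pabs h \<le> pabs v" for v :: "'p padic"
  proof -
    have "near n v (v - h)" using that by (simp add: near_def)
    moreover from near_pabs[OF this n] have "pabs (v - h) = pabs v" by simp
    moreover have "1 * pabs h \<le> 2 ^ n * pabs h" by (intro mult_right_mono) auto
    ultimately show ?thesis using that by simp
  qed
  consider "pabs u < 2 powi (1 - int n) * pabs h" | "2 ^ n * pabs h \<le> pabs u"
    | "2 powi (1 - int n) * pabs h \<le> pabs u" "pabs u < 2 ^ n * pabs h" by linarith
  then show ?thesis
  proof cases
    case 1
    \<comment> \<open>Discreteness turns the strict bound with exponent 1 - n into the factor 2^n
      that \<open>small\<close> asks for.\<close>
    have "2 ^ n * pabs v \<le> pabs h" if "pabs v < 2 powi (1 - int n) * pabs h" for v :: "'p padic"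
      using pabs_discrete[of v "- int n" h] that by (simp add: power_int_minus field_simps)
    moreover have "pabs u' < 2 powi (1 - int n) * pabs h"
      using 1 thr[of "1 - int n"] n by simp
    ultimately have *: "near n (- h) (v - h) \<and> pabs (v - h) = max (pabs v) (pabs h)"
      if "v \<in> {u, u'}" for v using 1 small that by blast
    then have "near n (- h) (u - h)" "near n (- h) (u' - h)" by blast+
    then have "near n (u - h) (u' - h)" using near_trans[OF near_sym _ n] n by simp
    then show ?thesis using * near_cosim[of n "u - h" "u' - h" m] by simp
  next
    case 2
    then have "2 ^ n * pabs h \<le> pabs u'" using thr[of "int n"] by simp
    then have *: "near n v (v - h) \<and> pabs (v - h) = max (pabs v) (pabs h)"
      if "v \<in> {u, u'}" for v using 2 large that by blast
    then have "near n u (u - h)" "near n u' (u' - h)" by blast+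
    then have "cosim m n (u - h) u" "cosim m n u' (u' - h)"
      using cosim_sym[OF near_cosim n] near_cosim by blast+
    then have "cosim m n (u - h) (u' - h)" using cosim_trans[OF _ cosim_trans[OF cs _ n] n] by simp
    then show ?thesis using * by simp
  next
    case 3
    obtain k where k: "pabs u = 2 powi k * pabs h" using pabs_ratio nz by metis
    have "(2::real) powi (1 - int n) \<le> 2 powi k" "(2::real) powi k < 2 powi int n"
      using 3 nz unfolding k by simp_all
    then have kn: "1 - int n \<le> k" "k < int n" unfolding two_powi_le_iff two_powi_less_iff .
    \<comment> \<open>Since 1 - n \<le> k < n, both k and k + 1 are allowed thresholds; together
      they leave \<open>2 powi k * pabs h\<close> as the only possible value of
      \<open>pabs u'\<close>.\<close>
    have "2 powi k * pabs h \<le> pabs u'" using thr[of k] kn k by simp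
    moreover have "\<not> 2 powi (k + 1) * pabs h \<le> pabs u'"
      using thr[of "k + 1"] kn k nz by simp
    then have "pabs u' \<le> 2 powi k * pabs h" using pabs_discrete[of u' k h] by simp
    ultimately have eq: "pabs u = pabs u'" using k by simp
    have "near n u u'" using cosim_near[OF cs eq n m] .
    then have nr: "near n (u - h) (u' - h)" using nearest by (simp add: near_def)
    moreover have "pabs (u - h) = max (pabs u) (pabs h)"
      using nearest pabs_diff_le_max[of u h] pabs_add_eq(3)[of u h] pabs_add_eq(4)[of u h] by linarith
    moreover have "pabs (u' - h) = pabs (u - h)" using near_pabs[OF nr n] by simp
    ultimately show ?thesis using eq near_cosim by simp
  qed
qed

lemma residue_of_nat: "residue (of_nat k :: 'p::prime_card padic_int) n = int k mod int CARD('p) ^ n"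
  by (induction k) (simp_all add: residue_simps mod_add_right_eq mod_add_left_eq mod_add_eq)

text \<open>For x = p^k u with a unit u, the residue of u modulo p^n is an integer near u. As
  \<open>K\<close> bounds k, finitely many products p^k a suffice.\<close>

lemma near_representatives:
  assumes "n \<ge> 1"
  shows "\<exists>\<Lambda> :: 'p::prime_card padic set. finite \<Lambda> \<and>
    (\<forall>x. 2 powi (- int K) \<le> pabs x \<and> pabs x \<le> 2 powi int K \<longrightarrow> (\<exists>l\<in>\<Lambda>. near n x l))"
proof -
  let ?\<Lambda> = "(\<lambda>(k, a). prime_elt powi k * of_nat a :: 'p padic) ` ({- int K..int K} \<times> {..CARD('p) ^ n})"
  have "\<exists>l\<in>?\<Lambda>. near n x l" if x: "2 powi (- int K) \<le> pabs x" "pabs x \<le> 2 powi int K" for x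
  proof -
    have "(0::real) < 2 powi (- int K)" by (intro zero_less_power_int) simp
    with x(1) have "0 < pabs x" by linarith
    then have "x \<noteq> 0" by simp
    then obtain k u where u: "x = prime_elt powi k * Fract u 1" "\<not> of_nat CARD('p) dvd u"
      by (rule padic_decomp)
    define a where "a = nat (residue u n)"
    have p0: "int CARD('p) ^ n > 0" using prime_gt_0_nat[OF prime_card[where 'a='p]] by simp
    have r: "0 \<le> residue u n" "residue u n < int CARD('p) ^ n"
      using residue_mod_self[of u n] p0 by (metis pos_mod_sign, metis pos_mod_bound)
    have "int a = residue u n" using r by (simp add: a_def)
    then have "residue (u - of_nat a) n = 0"
      by (simp only: residue_simps residue_of_nat) simp
    then obtain c where c: "u - of_nat a = of_nat CARD('p) ^ n * c"
      using power_prime_dvd_iff[of n "u - of_nat a"] by (auto elim: dvdE)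
    have "Fract u 1 - of_nat a = Fract (u - of_nat a) 1"
      by (simp add: of_nat_fract)
    also have "\<dots> = prime_elt powi int n * Fract c 1"
      unfolding c prime_elt_conv by (simp flip: Fract_power)
    finally have "2 ^ n * pabs (Fract u 1 - of_nat a :: 'p padic) = pabs (Fract c 1 :: 'p padic)"
      by (simp only: pabs_mult pabs_prime_elt_powi) (simp add: power_int_minus)
    also have "\<dots> \<le> 1" by (rule pabs_Fract_le_1)
    also have "\<dots> = pabs (Fract u 1 :: 'p padic)" using pabs_unit_form[OF u(2), of 0] by simp
    finally have "near n (Fract u 1 :: 'p padic) (of_nat a)" by (simp add: near_def)
    then have "near n x (prime_elt powi k * of_nat a)" unfolding u(1) by (rule near_mult)
    moreover have "pabs x = 2 powi (- k)" unfolding u(1) by (rule pabs_unit_form[OF u(2)])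
    then have "- int K \<le> - k" "- k \<le> int K" using x by (simp_all only: two_powi_le_iff)
    then have "k \<in> {- int K..int K}" by simp
    moreover have "a \<le> CARD('p) ^ n"
      using r by (simp add: a_def nat_le_iff)
    ultimately show ?thesis by force
  qed
  then show ?thesis by (intro exI[of _ ?\<Lambda>]) auto
qed

lemma cosim_prime_elt_powi: "n \<ge> 1 \<Longrightarrow> cosim m n (prime_elt powi (q * int m) * x) x"
  unfolding cosim_def by (intro exI[of _ q]) simp

lemma coset_representatives:
  assumes "n \<ge> 1" "m \<ge> 1"
  shows "\<exists>\<Lambda> :: 'p::prime_card padic set. finite \<Lambda> \<and> (\<forall>x. \<exists>l\<in>\<Lambda>. cosim m n x l)"
proof -
  obtain \<Lambda> :: "'p padic set" where \<Lambda>: "finite \<Lambda>"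
    "\<And>x. 2 powi (- int m) \<le> pabs x \<Longrightarrow> pabs x \<le> 2 powi int m \<Longrightarrow> \<exists>l\<in>\<Lambda>. near n x l"
    using near_representatives[OF assms(1), of m] by blast
  have "\<exists>l\<in>insert 0 \<Lambda>. cosim m n x l" for x :: "'p padic"
  proof (cases "x = 0")
    case False
    then obtain k where k: "pabs x = 2 powi k" by (rule pabs_power_of_two)
    \<comment> \<open>Multiplication by p^(qm) stays in the coset and moves the exponent of the
      absolute value from k to k mod m, so representatives of bounded size suffice.\<close>
    define q where "q = k div int m"
    let ?y = "prime_elt powi (q * int m) * x"
    have "pabs ?y = 2 powi (k mod int m)"
      unfolding q_def by (simp add: k flip: power_int_add minus_div_mult_eq_mod)
    moreover have "- int m \<le> k mod int m" "k mod int m \<le> int m"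
      using assms(2) pos_mod_bound[of "int m" k] pos_mod_sign[of "int m" k] by linarith+
    ultimately obtain l where "l \<in> \<Lambda>" "near n ?y l"
      using \<Lambda>(2)[of ?y] by (auto simp only: two_powi_le_iff)
    then show ?thesis
      using cosim_trans[OF cosim_sym[OF cosim_prime_elt_powi] near_cosim] assms(1) by blast
  qed auto
  then show ?thesis using \<Lambda>(1) by (intro exI[of _ "insert 0 \<Lambda>"]) auto
qed

section \<open>Cuts in finite linear orders\<close>

lemma ex_arg_max:
  fixes \<beta> :: "'b \<Rightarrow> real"
  assumes "finite A" "A \<noteq> {}"
  obtains b where "b \<in> A" "\<And>a. a \<in> A \<Longrightarrow> \<beta> a \<le> \<beta> b"
proof -
  have "Max (\<beta> ` A) \<in> \<beta> ` A" using assms by simp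
  then obtain b where b: "b \<in> A" "Max (\<beta> ` A) = \<beta> b" by auto
  have "\<beta> a \<le> \<beta> b" if "a \<in> A" for a
    using Max_ge[OF finite_imageI[OF assms(1)] imageI[OF that]] b(2) by metis
  with b(1) show ?thesis by (rule that)
qed

lemma ex_arg_min:
  fixes \<beta> :: "'b \<Rightarrow> real"
  assumes "finite A" "A \<noteq> {}"
  obtains b where "b \<in> A" "\<And>a. a \<in> A \<Longrightarrow> \<beta> b \<le> \<beta> a"
proof -
  obtain b where "b \<in> A" "\<And>a. a \<in> A \<Longrightarrow> - \<beta> a \<le> - \<beta> b"
    using ex_arg_max[OF assms, of "\<lambda>a. - \<beta> a"] by blast
  then show ?thesis by (intro that[of b]) auto
qed

lemma thresholds_le:
  fixes \<beta> :: "'b \<Rightarrow> real"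
  assumes "finite B"
  shows "\<exists>S\<subseteq>B. card S \<le> 2 \<and>
    (\<forall>\<gamma>. (\<forall>b\<in>S. \<beta> b \<le> \<gamma> \<longleftrightarrow> \<beta> b \<le> \<gamma>0) \<longrightarrow> (\<forall>b\<in>B. \<beta> b \<le> \<gamma> \<longleftrightarrow> \<beta> b \<le> \<gamma>0))"
proof -
  have lo: "\<exists>S\<subseteq>A. card S \<le> 1 \<and> (\<forall>\<gamma>. (\<forall>b\<in>S. \<beta> b \<le> \<gamma>) \<longrightarrow> (\<forall>b\<in>A. \<beta> b \<le> \<gamma>))"
    if "finite A" for A and \<beta> :: "'b \<Rightarrow> real"
  proof (cases "A = {}")
    case False
    then obtain b where b: "b \<in> A" "\<And>a. a \<in> A \<Longrightarrow> \<beta> a \<le> \<beta> b"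
      using ex_arg_max[OF \<open>finite A\<close> False, of \<beta>] by blast
    then show ?thesis by (intro exI[of _ "{b}"]) (auto intro: order_trans)
  qed auto
  have up: "\<exists>S\<subseteq>A. card S \<le> 1 \<and> (\<forall>\<gamma>. (\<forall>b\<in>S. \<gamma> < \<beta> b) \<longrightarrow> (\<forall>b\<in>A. \<gamma> < \<beta> b))"
    if "finite A" for A and \<beta> :: "'b \<Rightarrow> real"
  proof (cases "A = {}")
    case False
    then obtain b where b: "b \<in> A" "\<And>a. a \<in> A \<Longrightarrow> \<beta> b \<le> \<beta> a"
      using ex_arg_min[OF \<open>finite A\<close> False, of \<beta>] by blast
    then show ?thesis by (intro exI[of _ "{b}"]) (auto intro: order_less_le_trans)
  qed auto
  obtain S1 where S1: "S1 \<subseteq> {b\<in>B. \<beta> b \<le> \<gamma>0}" "card S1 \<le> 1"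
    "\<And>\<gamma>. (\<forall>b\<in>S1. \<beta> b \<le> \<gamma>) \<Longrightarrow> (\<forall>b\<in>{b\<in>B. \<beta> b \<le> \<gamma>0}. \<beta> b \<le> \<gamma>)"
    using lo[of "{b\<in>B. \<beta> b \<le> \<gamma>0}" \<beta>] assms by auto
  obtain S2 where S2: "S2 \<subseteq> {b\<in>B. \<gamma>0 < \<beta> b}" "card S2 \<le> 1"
    "\<And>\<gamma>. (\<forall>b\<in>S2. \<gamma> < \<beta> b) \<Longrightarrow> (\<forall>b\<in>{b\<in>B. \<gamma>0 < \<beta> b}. \<gamma> < \<beta> b)"
    using up[of "{b\<in>B. \<gamma>0 < \<beta> b}" \<beta>] assms by auto
  show ?thesis
  proof (intro exI[of _ "S1 \<union> S2"] conjI allI impI)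
    show "card (S1 \<union> S2) \<le> 2" using card_Un_le[of S1 S2] S1(2) S2(2) by linarith
    fix \<gamma> assume "\<forall>b\<in>S1 \<union> S2. \<beta> b \<le> \<gamma> \<longleftrightarrow> \<beta> b \<le> \<gamma>0"
    then have "\<forall>b\<in>S1. \<beta> b \<le> \<gamma>" "\<forall>b\<in>S2. \<not> \<beta> b \<le> \<gamma>" using S1(1) S2(1) by fastforce+
    then have "\<forall>b\<in>S1. \<beta> b \<le> \<gamma>" "\<forall>b\<in>S2. \<gamma> < \<beta> b" by auto
    from S1(3)[OF this(1)] S2(3)[OF this(2)]
    show "\<forall>b\<in>B. \<beta> b \<le> \<gamma> \<longleftrightarrow> \<beta> b \<le> \<gamma>0" by force
  qed (use S1(1) S2(1) in auto)
qed

lemma thresholds_ge: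
  fixes \<beta> :: "'b \<Rightarrow> real"
  assumes "finite B"
  shows "\<exists>S\<subseteq>B. card S \<le> 2 \<and>
    (\<forall>\<gamma>. (\<forall>b\<in>S. \<gamma> \<le> \<beta> b \<longleftrightarrow> \<gamma>0 \<le> \<beta> b) \<longrightarrow> (\<forall>b\<in>B. \<gamma> \<le> \<beta> b \<longleftrightarrow> \<gamma>0 \<le> \<beta> b))"
proof -
  obtain S where S: "S \<subseteq> B" "card S \<le> 2"
    "\<And>\<gamma>. (\<forall>b\<in>S. - \<beta> b \<le> \<gamma> \<longleftrightarrow> - \<beta> b \<le> - \<gamma>0) \<Longrightarrow> (\<forall>b\<in>B. - \<beta> b \<le> \<gamma> \<longleftrightarrow> - \<beta> b \<le> - \<gamma>0)"
    using thresholds_le[OF assms, of "\<lambda>b. - \<beta> b" "- \<gamma>0"] by blast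
  have "\<forall>b\<in>B. \<gamma> \<le> \<beta> b \<longleftrightarrow> \<gamma>0 \<le> \<beta> b" if "\<forall>b\<in>S. \<gamma> \<le> \<beta> b \<longleftrightarrow> \<gamma>0 \<le> \<beta> b" for \<gamma>
    using S(3)[of "- \<gamma>"] that by simp
  then show ?thesis using S(1,2) by blast
qed

text \<open>Once the cuts of \<open>\<gamma>\<close> among the \<open>\<alpha> b\<close> and of
  \<open>\<gamma>'\<close> among the \<open>\<beta> b\<close> are fixed, \<open>B\<close> falls into
  four classes, on which the comparison reads \<open>\<gamma> \<le> \<gamma>'\<close>,
  \<open>\<gamma> \<le> \<beta> b\<close>, \<open>\<alpha> b \<le> \<gamma>'\<close> or
  \<open>\<alpha> b \<le> \<beta> b\<close>. They need 1, 2, 2 and 0 witnesses, whence 5.\<close>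

lemma thresholds_max:
  fixes \<alpha> \<beta> :: "'b \<Rightarrow> real"
  assumes "finite B"
  defines "P \<equiv> \<lambda>b \<gamma> \<gamma>'. max \<gamma> (\<alpha> b) \<le> max \<gamma>' (\<beta> b)"
  shows "\<exists>S\<subseteq>B. card S \<le> 5 \<and>
    (\<forall>\<gamma> \<gamma>'. (\<forall>b\<in>B. \<alpha> b \<le> \<gamma> \<longleftrightarrow> \<alpha> b \<le> \<gamma>0) \<longrightarrow> (\<forall>b\<in>B. \<beta> b \<le> \<gamma>' \<longleftrightarrow> \<beta> b \<le> \<gamma>0') \<longrightarrow>
      (\<forall>b\<in>S. P b \<gamma> \<gamma>' \<longleftrightarrow> P b \<gamma>0 \<gamma>0') \<longrightarrow> (\<forall>b\<in>B. P b \<gamma> \<gamma>' \<longleftrightarrow> P b \<gamma>0 \<gamma>0'))"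
proof -
  let ?B1 = "{b\<in>B. \<alpha> b \<le> \<gamma>0 \<and> \<beta> b \<le> \<gamma>0'}"
  let ?B2 = "{b\<in>B. \<alpha> b \<le> \<gamma>0 \<and> \<not> \<beta> b \<le> \<gamma>0'}"
  let ?B3 = "{b\<in>B. \<not> \<alpha> b \<le> \<gamma>0 \<and> \<beta> b \<le> \<gamma>0'}"
  have fin: "finite ?B2" "finite ?B3" using assms(1) by simp_all
  obtain S1 where S1: "S1 \<subseteq> ?B1" "card S1 \<le> 1" "?B1 \<noteq> {} \<longrightarrow> S1 \<noteq> {}"
  proof (cases "?B1 = {}")
    case False
    then obtain b where "b \<in> ?B1" by blast
    then show ?thesis by (intro that[of "{b}"]) auto
  qed auto
  obtain S2 where S2: "S2 \<subseteq> ?B2" "card S2 \<le> 2"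
    "\<And>\<gamma>. (\<forall>b\<in>S2. \<gamma> \<le> \<beta> b \<longleftrightarrow> \<gamma>0 \<le> \<beta> b) \<Longrightarrow> (\<forall>b\<in>?B2. \<gamma> \<le> \<beta> b \<longleftrightarrow> \<gamma>0 \<le> \<beta> b)"
    using thresholds_ge[OF fin(1), of \<beta> \<gamma>0] by blast
  obtain S3 where S3: "S3 \<subseteq> ?B3" "card S3 \<le> 2"
    "\<And>\<gamma>. (\<forall>b\<in>S3. \<alpha> b \<le> \<gamma> \<longleftrightarrow> \<alpha> b \<le> \<gamma>0') \<Longrightarrow> (\<forall>b\<in>?B3. \<alpha> b \<le> \<gamma> \<longleftrightarrow> \<alpha> b \<le> \<gamma>0')"
    using thresholds_le[OF fin(2), of \<alpha> \<gamma>0'] by blast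
  show ?thesis
  proof (intro exI[of _ "S1 \<union> S2 \<union> S3"] conjI allI impI)
    show "card (S1 \<union> S2 \<union> S3) \<le> 5"
      using card_Un_le[of S1 S2] card_Un_le[of "S1 \<union> S2" S3] S1(2) S2(2) S3(2) by linarith
  next
    fix \<gamma> \<gamma>'
    assume \<alpha>: "\<forall>b\<in>B. \<alpha> b \<le> \<gamma> \<longleftrightarrow> \<alpha> b \<le> \<gamma>0" and \<beta>: "\<forall>b\<in>B. \<beta> b \<le> \<gamma>' \<longleftrightarrow> \<beta> b \<le> \<gamma>0'"
      and P: "\<forall>b\<in>S1 \<union> S2 \<union> S3. P b \<gamma> \<gamma>' \<longleftrightarrow> P b \<gamma>0 \<gamma>0'"
    have P1: "P b \<gamma> \<gamma>' \<longleftrightarrow> \<gamma> \<le> \<gamma>'" "P b \<gamma>0 \<gamma>0' \<longleftrightarrow> \<gamma>0 \<le> \<gamma>0'" if "b \<in> ?B1" for b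
      using that \<alpha> \<beta> unfolding P_def by (auto simp: max_def)
    have P2: "P b \<gamma> \<gamma>' \<longleftrightarrow> \<gamma> \<le> \<beta> b" "P b \<gamma>0 \<gamma>0' \<longleftrightarrow> \<gamma>0 \<le> \<beta> b" if "b \<in> ?B2" for b
      using that \<alpha> \<beta> unfolding P_def by (auto simp: max_def)
    have P3: "P b \<gamma> \<gamma>' \<longleftrightarrow> \<alpha> b \<le> \<gamma>'" "P b \<gamma>0 \<gamma>0' \<longleftrightarrow> \<alpha> b \<le> \<gamma>0'" if "b \<in> ?B3" for b
      using that \<alpha> \<beta> unfolding P_def by (auto simp: max_def)
    have P4: "P b \<gamma> \<gamma>' \<longleftrightarrow> \<alpha> b \<le> \<beta> b" "P b \<gamma>0 \<gamma>0' \<longleftrightarrow> \<alpha> b \<le> \<beta> b"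
      if "b \<in> B" "\<not> \<alpha> b \<le> \<gamma>0" "\<not> \<beta> b \<le> \<gamma>0'" for b
      using that \<alpha> \<beta> unfolding P_def by (auto simp: max_def)
    have E1: "(\<gamma> \<le> \<gamma>') = (\<gamma>0 \<le> \<gamma>0')" if b: "b \<in> ?B1" for b
    proof -
      have "S1 \<noteq> {}" using S1(3) b by blast
      then obtain b1 where b1: "b1 \<in> S1" by blast
      then have "b1 \<in> ?B1" using S1(1) by blast
      then show ?thesis using P[rule_format, of b1] P1[of b1] b1 by simp
    qed
    have E2: "\<forall>b\<in>?B2. \<gamma> \<le> \<beta> b \<longleftrightarrow> \<gamma>0 \<le> \<beta> b"
    proof (rule S2(3), rule ballI)
      fix b assume b: "b \<in> S2"
      then have "b \<in> ?B2" using S2(1) by blast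
      then show "\<gamma> \<le> \<beta> b \<longleftrightarrow> \<gamma>0 \<le> \<beta> b" using P[rule_format, of b] P2[of b] b by simp
    qed
    have E3: "\<forall>b\<in>?B3. \<alpha> b \<le> \<gamma>' \<longleftrightarrow> \<alpha> b \<le> \<gamma>0'"
    proof (rule S3(3), rule ballI)
      fix b assume b: "b \<in> S3"
      then have "b \<in> ?B3" using S3(1) by blast
      then show "\<alpha> b \<le> \<gamma>' \<longleftrightarrow> \<alpha> b \<le> \<gamma>0'" using P[rule_format, of b] P3[of b] b by simp
    qed
    show "\<forall>b\<in>B. P b \<gamma> \<gamma>' \<longleftrightarrow> P b \<gamma>0 \<gamma>0'"
    proof
      fix b assume b: "b \<in> B"
      then consider "b \<in> ?B1" | "b \<in> ?B2" | "b \<in> ?B3" | "\<not> \<alpha> b \<le> \<gamma>0 \<and> \<not> \<beta> b \<le> \<gamma>0'" by auto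
      then show "P b \<gamma> \<gamma>' \<longleftrightarrow> P b \<gamma>0 \<gamma>0'"
      proof cases
        case 1
        then show ?thesis using E1 P1 by simp
      next
        case 2
        then show ?thesis using E2 P2 by simp
      next
        case 3
        then show ?thesis using E3 P3 by simp
      next
        case 4
        then show ?thesis using P4[OF b] by simp
      qed
    qed
  qed (use S1(1) S2(1) S3(1) in auto)
qed

section \<open>Positions relative to finite sets of centers\<close>

definition loc :: "int \<Rightarrow> 'p::prime_card padic \<Rightarrow> 'p padic \<Rightarrow> 'p padic \<Rightarrow> bool" where
  "loc k t s x \<longleftrightarrow> 2 powi k * pabs (t - s) \<le> pabs (x - t)"

text \<open>The first three claims are \<open>cosim_translate\<close> with \<open>h = s - t\<close>.
  In the last one, a test not already decided by \<open>pabs (t - s)\<close> compares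
  \<open>pabs (x - t)\<close> with 2^k |s - s'|, and the ultrametric inequality rewrites |s - s'| in
  terms of distances from \<open>t\<close>.\<close>

lemma loc_determined:
  fixes x x' :: "'p::prime_card padic"
  assumes n: "n \<ge> 1" and m: "m \<ge> 1" and t: "t \<in> T"
    and nearest: "\<And>s. s \<in> T \<Longrightarrow> pabs (x - t) \<le> pabs (x - s)"
    and cs: "cosim m n (x - t) (x' - t)"
    and thr: "\<And>s k. s \<in> T \<Longrightarrow> \<bar>k\<bar> \<le> int n \<Longrightarrow> loc k t s x \<longleftrightarrow> loc k t s x'"
    and s: "s \<in> T"
  shows "pabs (x - s) = max (pabs (x - t)) (pabs (t - s))"
    and "pabs (x' - s) = max (pabs (x' - t)) (pabs (t - s))"
    and "cosim m n (x - s) (x' - s)"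
    and "s' \<in> T \<Longrightarrow> \<bar>k\<bar> \<le> int n \<Longrightarrow> loc k s s' x \<longleftrightarrow> loc k s s' x'"
proof -
  have st: "pabs (s - t) = pabs (t - s)" by (rule pabs_minus_commute)
  have "pabs (x - t - (s - t)) = max (pabs (x - t)) (pabs (s - t)) \<and>
    pabs (x' - t - (s - t)) = max (pabs (x' - t)) (pabs (s - t)) \<and>
    cosim m n (x - t - (s - t)) (x' - t - (s - t))"
    using thr[OF s] nearest[OF s] by (intro cosim_translate n m cs) (auto simp: loc_def st)
  then show *: "pabs (x - s) = max (pabs (x - t)) (pabs (t - s))"
    "pabs (x' - s) = max (pabs (x' - t)) (pabs (t - s))" and "cosim m n (x - s) (x' - s)"
    by (simp_all add: st)
  assume s': "s' \<in> T" and k: "\<bar>k\<bar> \<le> int n"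
  have eq: "2 powi k * pabs (s - s') \<le> pabs (x - t) \<longleftrightarrow> 2 powi k * pabs (s - s') \<le> pabs (x' - t)"
    if ns: "\<not> 2 powi k * pabs (s - s') \<le> pabs (t - s)"
  proof -
    have st': "pabs (s' - t) = pabs (t - s')" by (rule pabs_minus_commute)
    consider "pabs (t - s) < pabs (t - s')" | "pabs (t - s') < pabs (t - s)"
      | "pabs (t - s') = pabs (t - s)" by linarith
    then show ?thesis
    proof cases
      case 1
      then have "pabs (s - s') = pabs (t - s')"
        using pabs_add_eq(3)[of "t - s" "t - s'"] by simp
      then show ?thesis using thr[OF s' k] by (simp add: loc_def)
    next
      case 2
      then have "pabs (s - s') = pabs (t - s)"
        using pabs_add_eq(4)[of "t - s'" "t - s"] by simp
      then show ?thesis using thr[OF s k] by (simp add: loc_def)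
    next
      case 3
      \<comment> \<open>In this isosceles triangle, |s - s'| is 2^j |t - s| with j \<le> 0. As the
        test is not decided by |t - s|, also 0 < k + j, so the shifted scale k + j is still
        allowed.\<close>
      have "s \<noteq> s'" using ns by auto
      moreover have "s \<noteq> t" using 3 \<open>s \<noteq> s'\<close> by auto
      ultimately obtain j where j: "pabs (s - s') = 2 powi j * pabs (t - s)"
        using pabs_ratio[of "s - s'" "t - s"] by auto
      have "pabs (s - s') \<le> pabs (t - s)"
        using pabs_triangle[of s s' t] 3 st by simp
      then have "(2::real) powi j \<le> 2 powi 0" using j \<open>s \<noteq> t\<close> by simp
      then have "j \<le> 0" unfolding two_powi_le_iff .
      have "(2::real) powi 0 < 2 powi (k + j)"
        using ns j \<open>s \<noteq> t\<close> by (simp add: power_int_add not_le)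
      then have "0 < k + j" unfolding two_powi_less_iff .
      then have "\<bar>k + j\<bar> \<le> int n" using \<open>j \<le> 0\<close> k by linarith
      then show ?thesis using thr[OF s, of "k + j"] by (simp add: loc_def j power_int_add mult.assoc)
    qed
  qed
  show "loc k s s' x \<longleftrightarrow> loc k s s' x'"
    unfolding loc_def * using eq by (auto simp: le_max_iff_disj)
qed

text \<open>If \<open>s\<close> were strictly closer to \<open>x'\<close> than \<open>t\<close>, the
  distance from \<open>t\<close> to \<open>s\<close> would be \<open>pabs (x' - t)\<close>. The two
  tests at scale 0 between \<open>s\<close> and \<open>t\<close> detect this and carry the
  contradiction over to \<open>x\<close>.\<close>

lemma nearest_transfer:
  fixes x x' :: "'p::prime_card padic"
  assumes nearest: "\<And>s. s \<in> T \<Longrightarrow> pabs (x - t) \<le> pabs (x - s)" and "t \<in> T" "s \<in> T"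
    and loc: "\<And>s t. s \<in> T \<Longrightarrow> t \<in> T \<Longrightarrow> loc 0 t s x \<longleftrightarrow> loc 0 t s x'"
  shows "pabs (x' - t) \<le> pabs (x' - s)"
proof (rule ccontr)
  assume "\<not> ?thesis"
  then have less: "pabs (x' - s) < pabs (x' - t)" by simp
  then have eq: "pabs (t - s) = pabs (x' - t)"
    using pabs_add_eq(4)[of "x' - s" "x' - t"] by (simp add: pabs_minus_commute)
  then have "\<not> loc 0 s t x" "loc 0 t s x"
    using loc[OF assms(2,3)] loc[OF assms(3,2)] less pabs_minus_commute[of s t]
    by (simp_all add: loc_def)
  then have "pabs (x - s) < pabs (t - s)" "pabs (t - s) \<le> pabs (x - t)"
    using pabs_minus_commute[of s t] by (simp_all add: loc_def)
  then show False using nearest[OF assms(3)] by simp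
qed

abbreviation same_position where
  "same_position n E x x' \<equiv> \<forall>(t, s)\<in>E. \<forall>k. \<bar>k\<bar> \<le> int n \<longrightarrow> loc k t s x = loc k t s x'"

text \<open>When a new point \<open>r\<close> with nearest neighbour \<open>w\<close> is added to \<open>T\<close>, it suffices to add the pairs
  \<open>(r, w)\<close> and \<open>(w, r)\<close> to \<open>E\<close>.\<close>

lemma loc_linear:
  assumes "finite (T :: 'p::prime_card padic set)"
  shows "\<exists>E. E \<subseteq> T \<times> T \<and> card E \<le> 2 * card T \<and>
    (\<forall>x x'. same_position n E x x' \<longrightarrow> same_position n {(t, s) \<in> T \<times> T. t \<noteq> s} x x')"
  using assms
proof (induction T)
  case (insert r T)
  obtain E where EE: "E \<subseteq> T \<times> T \<and> card E \<le> 2 * card T \<and>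
    (\<forall>x x'. same_position n E x x' \<longrightarrow> same_position n {(t, s) \<in> T \<times> T. t \<noteq> s} x x')"
    using insert.IH by (rule exE)
  note E = EE[THEN conjunct1] EE[THEN conjunct2, THEN conjunct1]
    and E3 = EE[THEN conjunct2, THEN conjunct2, THEN spec, THEN spec, THEN mp]
  show ?case
  proof (cases "T = {}")
    case True
    then show ?thesis by (intro exI[of _ "{}"]) auto
  next
    case False
    obtain w where w: "w \<in> T" "\<And>s. s \<in> T \<Longrightarrow> pabs (r - w) \<le> pabs (r - s)"
      using ex_arg_min[OF insert.hyps(1) False, of "\<lambda>s. pabs (r - s)"] by blast
    \<comment> \<open>\<open>w\<close> is where \<open>r\<close> attaches to the tree of
      \<open>T\<close>. A test involving \<open>r\<close> either becomes one with \<open>w\<close>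
      in place of \<open>r\<close> or, after a shift of the scale, one of the two new tests.\<close>
    define d where "d = pabs (r - w)"
    have rw: "r - w \<noteq> 0" using w(1) insert.hyps(2) by auto
    have d0: "d > 0" unfolding d_def using rw by simp
    have ratio: "\<exists>e. pabs y = 2 powi e * d" if "y \<noteq> 0" for y :: "'p padic"
      unfolding d_def using pabs_ratio[OF that rw] by metis
    let ?E = "insert (r, w) (insert (w, r) E)"
    show ?thesis
    proof (intro exI[of _ ?E] conjI allI impI)
      show "?E \<subseteq> insert r T \<times> insert r T" using E(1) w(1) by auto
      have ins: "card (insert a F) \<le> Suc (card F)" for a and F :: "('p padic \<times> 'p padic) set"
        by (cases "finite F") (simp_all add: card_insert_if)
      have "card ?E \<le> 2 + card E" using ins[of "(r, w)" "insert (w, r) E"] ins[of "(w, r)" E] by linarith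
      then show "card ?E \<le> 2 * card (insert r T)" using E(2) insert.hyps by simp
    next
      fix x x' assume agree: "same_position n ?E x x'"
      have old: "loc k t s x = loc k t s x'" if "t \<in> T" "s \<in> T" "t \<noteq> s" "\<bar>k\<bar> \<le> int n" for t s k
      proof -
        have "same_position n E x x'" using agree by simp
        from E3[OF this] show ?thesis using that by simp
      qed
      have rw: "2 powi k * d \<le> pabs (x - r) \<longleftrightarrow> 2 powi k * d \<le> pabs (x' - r)"
        and wr: "2 powi k * d \<le> pabs (x - w) \<longleftrightarrow> 2 powi k * d \<le> pabs (x' - w)"
        if "\<bar>k\<bar> \<le> int n" for k
      proof -
        have "loc k r w x = loc k r w x'" "loc k w r x = loc k w r x'" using agree that by simp_all
        then show "2 powi k * d \<le> pabs (x - r) \<longleftrightarrow> 2 powi k * d \<le> pabs (x' - r)"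
          "2 powi k * d \<le> pabs (x - w) \<longleftrightarrow> 2 powi k * d \<le> pabs (x' - w)"
          by (simp_all only: loc_def d_def pabs_minus_commute[of w r])
      qed
      \<comment> \<open>An open ball whose radius exceeds the distance of two centers may be
        centered at either of them.\<close>
      have far: "a \<le> pabs (y - t) \<longleftrightarrow> a \<le> pabs (y - t')" if "pabs (t - t') < a" for a y and t t' :: "'p padic"
        using pabs_triangle[of y t t'] pabs_triangle[of y t' t] pabs_minus_commute[of t t'] that
        by linarith
      have 1: "loc k r s x = loc k r s x'" if s: "s \<in> T" and k: "\<bar>k\<bar> \<le> int n" for s k
      proof (cases "pabs (r - s) = d")
        case True
        then show ?thesis using rw[OF k] by (simp add: loc_def)
      next
        case False
        then have gt: "d < pabs (r - s)" using w(2)[OF s] by (simp add: d_def)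
        then have ws: "pabs (w - s) = pabs (r - s)"
          using pabs_add_eq(4)[of "r - w" "r - s"] by (simp add: d_def pabs_minus_commute[of w s])
        show ?thesis
        proof (cases "d < 2 powi k * pabs (r - s)")
          case True
          have "w \<noteq> s" using gt by (auto simp: d_def)
          then have "loc k w s x = loc k w s x'" using old[OF w(1) s _ k] by simp
          then show ?thesis
            using far[of r w "2 powi k * pabs (r - s)"] True by (simp add: loc_def ws d_def)
        next
          case False
          obtain e where e: "pabs (r - s) = 2 powi e * d" using ratio[of "r - s"] insert.hyps(2) s by auto
          \<comment> \<open>Here |r - s| = 2^e d with e > 0 and 2^k |r - s| \<le> d. So k < k + e
            \<le> 0, and the pair (r, w) may be used at scale k + e.\<close>
          have "(2::real) powi 0 < 2 powi e" "(2::real) powi (k + e) \<le> 2 powi 0"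
            using gt e d0 False by (auto simp: power_int_add)
          then have "0 < e" "k + e \<le> 0" unfolding two_powi_le_iff two_powi_less_iff .
          then have "\<bar>k + e\<bar> \<le> int n" using k by linarith
          from rw[OF this] show ?thesis by (simp add: loc_def e power_int_add mult.assoc)
        qed
      qed
      have 2: "loc k s r x = loc k s r x'" if s: "s \<in> T" and k: "\<bar>k\<bar> \<le> int n" for s k
      proof -
        have sr: "pabs (s - r) = pabs (r - s)" by (rule pabs_minus_commute)
        consider "s = w" | "s \<noteq> w" "pabs (s - w) = pabs (s - r)" | "s \<noteq> w" "pabs (s - w) \<noteq> pabs (s - r)"
          by blast
        then show ?thesis
        proof cases
          case 1
          then show ?thesis using agree k by simp
        next
          case 2
          then show ?thesis using old[OF s w(1) _ k] by (simp add: loc_def)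
        next
          case 3
          \<comment> \<open>In the remaining shape, \<open>s\<close> has distance \<open>d\<close>
            from \<open>r\<close> and is closer to \<open>w\<close>. Balls of radius above |s - w|
            can be recentered at \<open>w\<close>; smaller ones are tests of the old pair (s, w), at
            a scale between k and 0.\<close>
          have "d \<le> pabs (r - s)" using w(2)[OF s] by (simp add: d_def)
          moreover have "\<not> d < pabs (r - s)"
            using 3(2) pabs_add_eq(4)[of "r - w" "r - s"] sr by (auto simp: d_def)
          ultimately have ds1: "pabs (r - s) = d" by simp
          have "pabs (s - w) \<le> d"
            using pabs_triangle[of s w r] sr ds1 by (simp add: d_def)
          with ds1 3(2) sr have "pabs (r - s) = d" "pabs (s - w) < d" by simp_all
          note ds = this
          show ?thesis
          proof (cases "pabs (s - w) < 2 powi k * d")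
            case True
            then show ?thesis
              using far[of s w "2 powi k * d" x] far[of s w "2 powi k * d" x'] wr[OF k]
              by (simp add: loc_def sr ds(1))
          next
            case False
            obtain e where e: "pabs (s - w) = 2 powi e * d" using ratio[of "s - w"] 3(1) by auto
            have "(2::real) powi e < 2 powi 0" "(2::real) powi k \<le> 2 powi e"
              using ds e d0 False by auto
            then have "e < 0" "k \<le> e" unfolding two_powi_le_iff two_powi_less_iff .
            then have "\<bar>k - e\<bar> \<le> int n" using k by linarith
            from old[OF s w(1) 3(1) this]
            show ?thesis by (simp add: loc_def e sr ds(1) power_int_diff)
          qed
        qed
      qed
      show "same_position n {(t, s) \<in> insert r T \<times> insert r T. t \<noteq> s} x x'"
      proof (clarify)
        fix t s k assume "t \<in> insert r T" "s \<in> insert r T" "t \<noteq> s" "\<bar>k\<bar> \<le> int n"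
        then show "loc k t s x = loc k t s x'" using 1 2 old by (cases "t = r"; cases "s = r") simp_all
      qed
    qed
  qed
qed auto

section \<open>Counting comparison patterns\<close>

lemma pabs_discrete_half: "pabs u < pabs h \<Longrightarrow> 2 * pabs u \<le> pabs h" for u h :: "'p::prime_card padic"
  using pabs_discrete[of u "-1" h] by (simp add: power_int_minus)

lemma pabs_sum_less:
  fixes f :: "'a \<Rightarrow> 'p::prime_card padic"
  assumes "0 < c" "\<And>a. a \<in> A \<Longrightarrow> pabs (f a) < c"
  shows "pabs (sum f A) < c"
  using assms
proof (induction A rule: infinite_finite_induct)
  case (insert a A)
  have "pabs (f a + sum f A) \<le> max (pabs (f a)) (pabs (sum f A))" by (rule pabs_add_le_max)
  also have "\<dots> < c" using insert by simp
  finally show ?case using insert.hyps by simp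
qed auto

lemma prod_strict_mono:
  fixes f g :: "'a \<Rightarrow> real"
  assumes "finite A" "\<And>a. a \<in> A \<Longrightarrow> 0 \<le> f a \<and> f a \<le> g a \<and> 0 < g a" "b \<in> A" "f b < g b"
  shows "prod f A < prod g A"
proof -
  have "prod f A = f b * prod f (A - {b})" "prod g A = g b * prod g (A - {b})"
    using assms(1,3) by (auto intro: prod.remove)
  moreover have "f b * prod f (A - {b}) \<le> f b * prod g (A - {b})"
    using assms(2,3) by (intro mult_left_mono prod_mono) auto
  moreover have "f b * prod g (A - {b}) < g b * prod g (A - {b})"
    using assms(2,4) by (intro mult_strict_right_mono prod_pos) auto
  ultimately show ?thesis by linarith
qed

section \<open>Polynomial functions of bounded degree\<close>

definition fscale :: "'k::field \<Rightarrow> ('x \<Rightarrow> 'k) \<Rightarrow> 'x \<Rightarrow> 'k" where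
  "fscale c f = (\<lambda>x. c * f x)"

interpretation fun_space: vector_space fscale
  by unfold_locales (simp_all add: fscale_def fun_eq_iff distrib_left distrib_right mult.assoc)

lemma sum_fun_apply: "sum f A x = (\<Sum>a\<in>A. f a x)"
  by (induction A rule: infinite_finite_induct) auto

definition affine_fun :: "nat \<Rightarrow> ((nat \<Rightarrow> 'k::field) \<Rightarrow> 'k) \<Rightarrow> bool" where
  "affine_fun d f \<longleftrightarrow> (\<exists>c c0. \<forall>a. f a = c0 + (\<Sum>l<d. c l * a l))"

text \<open>The degree is bounded in each variable separately, which gives the clean count (D +
  1)^d.\<close>

definition monomials :: "nat \<Rightarrow> nat \<Rightarrow> ((nat \<Rightarrow> 'k::field) \<Rightarrow> 'k) set" where
  "monomials d D = (\<lambda>e a. \<Prod>l<d. a l ^ e l) ` (PiE {..<d} (\<lambda>_. {..D}))"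

lemma finite_monomials [simp]: "finite (monomials d D)"
  unfolding monomials_def by (intro finite_imageI finite_PiE) auto

lemma card_monomials_le: "card (monomials d D) \<le> (D + 1) ^ d"
proof -
  have "card (monomials d D) \<le> card (PiE {..<d} (\<lambda>_. {..D}))"
    unfolding monomials_def by (intro card_image_le finite_PiE) auto
  then show ?thesis by (simp add: card_PiE)
qed

lemma monomials_mono: "D \<le> D' \<Longrightarrow> monomials d D \<subseteq> monomials d D'"
  unfolding monomials_def by (intro image_mono PiE_mono) auto

lemma span_monomials_mult_coord:
  fixes f :: "(nat \<Rightarrow> 'k::field) \<Rightarrow> 'k"
  assumes "f \<in> fun_space.span (monomials d D)" "l < d"
  shows "(\<lambda>a. a l * f a) \<in> fun_space.span (monomials d (D + 1))"
proof -
  have "fun_space.subspace {f. (\<lambda>a :: nat \<Rightarrow> 'k. a l * f a) \<in> fun_space.span (monomials d (D + 1))}"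
    unfolding fun_space.subspace_def
  proof (safe, goal_cases)
    case 1
    show ?case using fun_space.span_zero by (simp add: zero_fun_def)
  next
    case (2 f g)
    from fun_space.span_add[OF this] show ?case by (simp add: plus_fun_def distrib_left)
  next
    case (3 c f)
    from fun_space.span_scale[OF this] show ?case by (simp add: fscale_def mult.left_commute)
  qed
  moreover have "(\<lambda>a. a l * f a) \<in> fun_space.span (monomials d (D + 1))"
    if "f \<in> monomials d D" for f :: "(nat \<Rightarrow> 'k) \<Rightarrow> 'k"
  proof -
  from that obtain e where e: "e \<in> PiE {..<d} (\<lambda>_. {..D})" "f = (\<lambda>a. \<Prod>l<d. a l ^ e l)"
    by (auto simp: monomials_def)
  have "a l * f a = (\<Prod>i<d. a i ^ (e(l := e l + 1)) i)" for a
  proof -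
    have "f a = a l ^ e l * (\<Prod>i\<in>{..<d} - {l}. a i ^ e i)"
      unfolding e(2) using assms(2) by (intro prod.remove) auto
    moreover have "(\<Prod>i<d. a i ^ (e(l := e l + 1)) i) =
        a l ^ (e l + 1) * (\<Prod>i\<in>{..<d} - {l}. a i ^ (e(l := e l + 1)) i)"
      using assms(2) by (subst prod.remove[of _ l]) auto
    moreover have "(\<Prod>i\<in>{..<d} - {l}. a i ^ (e(l := e l + 1)) i) = (\<Prod>i\<in>{..<d} - {l}. a i ^ e i)"
      by (intro prod.cong) auto
    ultimately show ?thesis by simp
  qed
  then have "(\<lambda>a. a l * f a) = (\<lambda>a. \<Prod>i<d. a i ^ (e(l := e l + 1)) i)" by (rule ext)
  moreover have "e(l := e l + 1) \<in> PiE {..<d} (\<lambda>_. {..D + 1})"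
    using e(1) assms(2) by (auto simp: PiE_iff extensional_def intro: le_SucI)
  ultimately show ?thesis
    by (intro fun_space.span_base) (simp only: monomials_def, rule image_eqI[OF refl])
  qed
  ultimately show ?thesis
    using fun_space.span_induct[OF assms(1), of "\<lambda>f. (\<lambda>a. a l * f a) \<in> fun_space.span (monomials d (D + 1))"]
    by blast
qed

lemma span_monomials_mult_affine:
  assumes "f \<in> fun_space.span (monomials d D)" "affine_fun d g"
  shows "(\<lambda>a. g a * f a) \<in> fun_space.span (monomials d (D + 1))"
proof -
  obtain c c0 where g: "\<And>a. g a = c0 + (\<Sum>l<d. c l * a l)"
    using assms(2) by (auto simp: affine_fun_def)
  have "(\<lambda>a. g a * f a) = fscale c0 f + (\<Sum>l<d. fscale (c l) (\<lambda>a. a l * f a))"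
    by (simp add: fun_eq_iff g sum_fun_apply fscale_def distrib_right sum_distrib_right mult.assoc)
  moreover have "f \<in> fun_space.span (monomials d (D + 1))"
    using assms(1) fun_space.span_mono[OF monomials_mono[of D "D + 1"]] by auto
  ultimately show ?thesis
    using span_monomials_mult_coord[OF assms(1)]
    by (auto intro!: fun_space.span_add fun_space.span_scale fun_space.span_sum)
qed

lemma span_monomials_prod_affine:
  assumes "finite \<Omega>" "\<And>\<omega>. \<omega> \<in> \<Omega> \<Longrightarrow> affine_fun d (q \<omega>)"
  shows "(\<lambda>a. \<Prod>\<omega>\<in>\<Omega>. q \<omega> a) \<in> fun_space.span (monomials d (card \<Omega>))"
  using assms
proof (induction \<Omega>)
  case empty
  have "(\<lambda>a. 1) \<in> monomials d 0"
    unfolding monomials_def by (rule image_eqI[of _ _ "\<lambda>l\<in>{..<d}. 0"]) auto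
  then show ?case by (auto intro: fun_space.span_base)
next
  case (insert \<omega> \<Omega>)
  then show ?case using span_monomials_mult_affine[of "\<lambda>a. \<Prod>\<omega>\<in>\<Omega>. q \<omega> a"] by simp
qed

lemma affine_fun_const: "affine_fun d (\<lambda>_. c)"
  unfolding affine_fun_def by (rule exI[of _ "\<lambda>_. 0"], rule exI[of _ c]) simp

text \<open>
  Polynomial method: to each point of \<open>R\<close>, attach the product over \<open>\<Omega>\<close> of the larger one of
  \<open>f \<omega>\<close> and \<open>g \<omega>\<close> at this point. Weights in the comparison break the ties, and the constant \<open>1\<close> with
  a tiny weight takes over where both functions vanish. The weighted product attached to a point is
  then the unique largest one at this point, so by the ultrametric inequality these products are
  linearly independent.
\<close>

theorem card_comparison_patterns:
  fixes f g :: "'w \<Rightarrow> (nat \<Rightarrow> 'p::prime_card padic) \<Rightarrow> 'p padic"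
  assumes R: "finite R" and \<Omega>: "finite \<Omega>"
    and aff: "\<And>\<omega>. \<omega> \<in> \<Omega> \<Longrightarrow> affine_fun d (f \<omega>) \<and> affine_fun d (g \<omega>)"
    and distinct: "\<And>a a'. a \<in> R \<Longrightarrow> a' \<in> R \<Longrightarrow> a \<noteq> a' \<Longrightarrow>
      \<exists>\<omega>\<in>\<Omega>. (pabs (f \<omega> a) \<le> pabs (g \<omega> a)) \<noteq> (pabs (f \<omega> a') \<le> pabs (g \<omega> a'))"
  shows "card R \<le> (card \<Omega> + 1) ^ d"
proof -
  define V where "V = {v. v > 0 \<and> v \<in> (\<lambda>(h, \<omega>, a). pabs (h \<omega> a)) ` ({f, g} \<times> \<Omega> \<times> R)}"
  have "finite V" unfolding V_def using R \<Omega> by auto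
  then obtain \<epsilon> :: real where \<epsilon>: "\<epsilon> > 0" "\<And>v. v \<in> V \<Longrightarrow> \<epsilon> < v"
  proof (cases "V = {}")
    case True
    then show ?thesis using that[of 1] by simp
  next
    case False
    then have "Min V \<in> V" using \<open>finite V\<close> by simp
    then have "Min V > 0" by (simp add: V_def)
    moreover have "Min V / 2 < v" if "v \<in> V" for v
      using Min_le[OF \<open>finite V\<close> that] \<open>Min V > 0\<close> by linarith
    ultimately show ?thesis using that[of "Min V / 2"] by simp
  qed
  have \<epsilon>f: "\<epsilon> < pabs (f \<omega> a)" if "\<omega> \<in> \<Omega>" "a \<in> R" "f \<omega> a \<noteq> 0" for \<omega> a
    using that by (intro \<epsilon>(2)) (auto simp: V_def intro!: image_eqI[of _ _ "(f, \<omega>, a)"])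
  have \<epsilon>g: "\<epsilon> < pabs (g \<omega> a)" if "\<omega> \<in> \<Omega>" "a \<in> R" "g \<omega> a \<noteq> 0" for \<omega> a
    using that by (intro \<epsilon>(2)) (auto simp: V_def intro!: image_eqI[of _ _ "(g, \<omega>, a)"])
  define q :: "'w \<Rightarrow> nat \<Rightarrow> (nat \<Rightarrow> 'p padic) \<Rightarrow> 'p padic"
    where "q \<omega> i = (if i = 0 then g \<omega> else if i = 1 then f \<omega> else (\<lambda>_. 1))" for \<omega> i
  \<comment> \<open>The weight of \<open>g \<omega>\<close> must exceed 1 to win ties, and stay
    below 2 to lose when \<open>pabs (g \<omega> a) < pabs (f \<omega> a)\<close>, where
    discreteness leaves a factor of 2. Hence 3/2.\<close>
  define w :: "nat \<Rightarrow> real" where "w i = (if i = 0 then 3/2 else if i = 1 then 1 else \<epsilon>)" for i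
  define win :: "(nat \<Rightarrow> 'p padic) \<Rightarrow> 'w \<Rightarrow> nat" where "win a \<omega> =
     (if g \<omega> a \<noteq> 0 \<and> pabs (f \<omega> a) \<le> pabs (g \<omega> a) then 0 else if f \<omega> a \<noteq> 0 then 1 else 2)" for a \<omega>
  have w0: "w i > 0" for i using \<epsilon>(1) by (simp add: w_def)
  have win3: "win a \<omega> < 3" for a \<omega> by (simp add: win_def)
  have strict: "w i * pabs (q \<omega> i a) < w (win a \<omega>) * pabs (q \<omega> (win a \<omega>) a)"
    if "a \<in> R" "\<omega> \<in> \<Omega>" "i < 3" "i \<noteq> win a \<omega>" for a \<omega> i
  proof -
    have i: "i = 0 \<or> i = 1 \<or> i = 2" using that(3) by auto
    consider "g \<omega> a \<noteq> 0" "pabs (f \<omega> a) \<le> pabs (g \<omega> a)"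
      | "f \<omega> a \<noteq> 0" "pabs (g \<omega> a) < pabs (f \<omega> a)" | "f \<omega> a = 0" "g \<omega> a = 0"
      by (metis linorder_not_le pabs_0 pabs_nonneg pabs_pos_iff)
    then show ?thesis
    proof cases
      case 1
      then have [simp]: "win a \<omega> = 0" by (simp add: win_def)
      have "pabs (f \<omega> a) < 3/2 * pabs (g \<omega> a)" "\<epsilon> < 3/2 * pabs (g \<omega> a)"
        using 1 \<epsilon>g[OF that(2,1) 1(1)] \<epsilon>(1) by auto
      then show ?thesis using i that(4) by (auto simp: w_def q_def)
    next
      case 2
      then have [simp]: "win a \<omega> = 1" by (simp add: win_def)
      have "3/2 * pabs (g \<omega> a) < pabs (f \<omega> a)"
        using pabs_discrete_half[OF 2(2)] pabs_pos_iff[of "f \<omega> a"] 2(1) by linarith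
      moreover have "\<epsilon> < pabs (f \<omega> a)" using \<epsilon>f that 2 by blast
      ultimately show ?thesis using i that(4) by (auto simp: w_def q_def)
    next
      case 3
      then have [simp]: "win a \<omega> = 2" by (simp add: win_def)
      show ?thesis using i that(4) 3 \<epsilon>(1) by (auto simp: w_def q_def)
    qed
  qed
  have pos: "0 < w (win a \<omega>) * pabs (q \<omega> (win a \<omega>) a)" if "a \<in> R" "\<omega> \<in> \<Omega>" for a \<omega>
  proof -
    have "\<exists>i<3. i \<noteq> win a \<omega>" by (cases "win a \<omega> = 0") (auto intro: exI[of _ 1] exI[of _ 0])
    then obtain i where "i < 3" "i \<noteq> win a \<omega>" by blast
    from strict[OF that this] show ?thesis
      using mult_nonneg_nonneg[OF less_imp_le[OF w0[of i]] pabs_nonneg[of "q \<omega> i a"]] by linarith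
  qed
  define P where "P a = (\<lambda>x. \<Prod>\<omega>\<in>\<Omega>. q \<omega> (win a \<omega>) x)" for a
  define W where "W a = (\<Prod>\<omega>\<in>\<Omega>. w (win a \<omega>))" for a
  have W0: "W a > 0" for a unfolding W_def using w0 by (intro prod_pos) auto
  have WP: "W a * pabs (P a x) = (\<Prod>\<omega>\<in>\<Omega>. w (win a \<omega>) * pabs (q \<omega> (win a \<omega>) x))" for a x
  proof -
    have "pabs (\<Prod>\<omega>\<in>\<Omega>. q \<omega> (win a \<omega>) x) = (\<Prod>\<omega>\<in>\<Omega>. pabs (q \<omega> (win a \<omega>) x))"
      using \<Omega> by (induction \<Omega>) auto
    then show ?thesis by (simp add: P_def W_def prod.distrib)
  qed
  have dominant: "W a' * pabs (P a' a) < W a * pabs (P a a)"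
    if "a \<in> R" "a' \<in> R" "a \<noteq> a'" for a a'
  proof -
    obtain \<omega> where \<omega>: "\<omega> \<in> \<Omega>" "(pabs (f \<omega> a) \<le> pabs (g \<omega> a)) \<noteq> (pabs (f \<omega> a') \<le> pabs (g \<omega> a'))"
      using distinct[of a a'] \<open>a \<in> R\<close> \<open>a' \<in> R\<close> \<open>a \<noteq> a'\<close> by blast
    \<comment> \<open>The winners 0 and 2 both mean that the comparison holds, so different outcomes
      force different winners.\<close>
    have win1: "pabs (f \<omega> x) \<le> pabs (g \<omega> x) \<longleftrightarrow> win x \<omega> \<noteq> 1" for x by (auto simp: win_def)
    have "win a' \<omega> \<noteq> win a \<omega>" using \<omega>(2) unfolding win1[of a] win1[of a'] by metis
    then have lt: "w (win a' \<omega>) * pabs (q \<omega> (win a' \<omega>) a) < w (win a \<omega>) * pabs (q \<omega> (win a \<omega>) a)"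
      using strict \<open>a \<in> R\<close> \<omega>(1) win3 by blast
    have le: "w (win a' \<omega>) * pabs (q \<omega> (win a' \<omega>) a) \<le> w (win a \<omega>) * pabs (q \<omega> (win a \<omega>) a)"
      if "\<omega> \<in> \<Omega>" for \<omega>
      using strict[of a \<omega> "win a' \<omega>"] that \<open>a \<in> R\<close> win3 by (cases "win a' \<omega> = win a \<omega>") auto
    show ?thesis unfolding WP
      using le pos[OF \<open>a \<in> R\<close>] lt \<omega>(1) w0 \<Omega>
      by (intro prod_strict_mono[of _ _ _ \<omega>]) (simp_all add: less_imp_le)
  qed
  have PR: "pabs (P a a) > 0" if "a \<in> R" for a
  proof -
    have "0 < W a * pabs (P a a)" unfolding WP using pos that by (intro prod_pos) auto
    then show ?thesis using W0[of a] by (simp add: zero_less_mult_iff)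
  qed
  have inj: "inj_on P R"
  proof (rule inj_onI, rule ccontr)
    fix a a' assume a: "a \<in> R" "a' \<in> R" "P a = P a'" "a \<noteq> a'"
    have "W a' * pabs (P a a) < W a * pabs (P a a)" using dominant[OF a(1,2,4)] a(3) by simp
    then have "W a' < W a" using PR[OF a(1)] by (simp only: mult_less_cancel_right_pos)
    have "W a * pabs (P a' a') < W a' * pabs (P a' a')" using dominant[OF a(2,1)] a(3,4) by simp
    then have "W a < W a'" using PR[OF a(2)] by (simp only: mult_less_cancel_right_pos)
    with \<open>W a' < W a\<close> show False by simp
  qed
  have indep: "fun_space.independent (P ` R)"
  proof -
    have zero: "u v = 0" if sum0: "(\<Sum>v\<in>P ` R. fscale (u v) v) = 0" and v: "v \<in> P ` R" for u v
    proof -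
    define \<alpha> where "\<alpha> a = u (P a)" for a
    have sum: "(\<Sum>a\<in>R. \<alpha> a * P a x) = 0" for x
    proof -
      have "(\<Sum>a\<in>R. \<alpha> a * P a x) = (\<Sum>v\<in>P ` R. fscale (u v) v) x"
        unfolding sum_fun_apply \<alpha>_def fscale_def by (simp add: sum.reindex[OF inj])
      then show ?thesis by (simp add: sum0)
    qed
    have "R \<noteq> {}" using v by auto
    \<comment> \<open>With the weighted coefficient maximal at \<open>a0\<close>, the term of
      \<open>a0\<close> strictly dominates the others when the relation is evaluated at the point
      \<open>a0\<close>, so it cannot be cancelled.\<close>
    then obtain a0 where a0: "a0 \<in> R" "\<And>a. a \<in> R \<Longrightarrow> pabs (\<alpha> a) / W a \<le> pabs (\<alpha> a0) / W a0"
      using ex_arg_max[OF R, of "\<lambda>a. pabs (\<alpha> a) / W a"] by blast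
    have "\<alpha> a0 = 0"
    proof (rule ccontr)
      assume nz: "\<alpha> a0 \<noteq> 0"
      let ?c = "pabs (\<alpha> a0 * P a0 a0)"
      have c0: "?c > 0" using nz PR[OF a0(1)] by simp
      have small: "pabs (\<alpha> a * P a a0) < ?c" if a: "a \<in> R - {a0}" for a
      proof -
        have "pabs (\<alpha> a * P a a0) = pabs (\<alpha> a) / W a * (W a * pabs (P a a0))"
          using W0[of a] by simp
        also have "\<dots> \<le> pabs (\<alpha> a0) / W a0 * (W a * pabs (P a a0))"
          using a0(2) a W0[of a] by (intro mult_right_mono) auto
        also have "\<dots> < pabs (\<alpha> a0) / W a0 * (W a0 * pabs (P a0 a0))"
          using a a0(1) nz W0[of a0] by (intro mult_strict_left_mono dominant) auto
        also have "\<dots> = ?c" using W0[of a0] by simp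
        finally show ?thesis .
      qed
      have "pabs (\<Sum>a\<in>R - {a0}. \<alpha> a * P a a0) < ?c" using c0 small by (rule pabs_sum_less)
      then have "pabs (\<alpha> a0 * P a0 a0 + (\<Sum>a\<in>R - {a0}. \<alpha> a * P a a0)) = ?c" by (rule pabs_add_eq)
      then show False using sum[of a0] c0 by (simp only: sum.remove[OF R a0(1)] pabs_0)
    qed
    then have "\<alpha> a = 0" if "a \<in> R" for a
      using a0(2)[OF that] W0[of a] by (simp add: divide_le_0_iff)
    then show ?thesis using v by (auto simp: \<alpha>_def)
    qed
    have "finite (P ` R)" using R by simp
    then show ?thesis
    proof (subst fun_space.dependent_finite, safe)
      fix u a assume "u (P a) \<noteq> 0" "a \<in> R" "(\<Sum>v\<in>P ` R. fscale (u v) v) = 0"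
      then show False using zero[of u "P a"] by simp
    qed
  qed
  have q_aff: "affine_fun d (q \<omega> i)" if "\<omega> \<in> \<Omega>" for \<omega> i
    using aff[OF that] by (simp add: q_def affine_fun_const)
  have "P a \<in> fun_space.span (monomials d (card \<Omega>))" for a
    unfolding P_def by (rule span_monomials_prod_affine[OF \<Omega> q_aff])
  then have "P ` R \<subseteq> fun_space.span (monomials d (card \<Omega>))" by auto
  then have "card (P ` R) \<le> card (monomials d (card \<Omega>) :: ((nat \<Rightarrow> 'p padic) \<Rightarrow> 'p padic) set)"
    using fun_space.independent_span_bound[OF finite_monomials indep] by blast
  also have "\<dots> \<le> (card \<Omega> + 1) ^ d" by (rule card_monomials_le)
  finally show ?thesis by (simp add: card_image[OF inj])
qed

section \<open>Quantifier elimination\<close>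

text \<open>If \<open>u\<close> is comparable to some \<open>h\<close>, then \<open>l\<close>
  approximates u / h. Otherwise \<open>u\<close> lies in a wide gap, and powers of p^m move it,
  within its coset, to an edge of the gap next to some \<open>h\<close>. The exponent of the ratio
  then lies in a window depending only on \<open>K\<close> and \<open>m\<close>, so one finite
  \<open>\<Lambda>\<close> serves all \<open>H\<close>.\<close>

lemma test_point_existence:
  assumes n: "n \<ge> 1" and m: "m \<ge> 1"
  shows "\<exists>\<Lambda> :: 'p::prime_card padic set. finite \<Lambda> \<and> (\<forall>H u. finite H \<longrightarrow> u \<noteq> 0 \<longrightarrow> (\<exists>h\<in>H. h \<noteq> 0) \<longrightarrow>
    (\<exists>h\<in>H. \<exists>l\<in>\<Lambda>. cosim m n u (l * h) \<and>
      (\<forall>h'\<in>H. \<forall>k. \<bar>k\<bar> \<le> int K \<longrightarrow> (2 powi k * pabs h' \<le> pabs u \<longleftrightarrow> 2 powi k * pabs h' \<le> pabs (l * h)))))"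
proof -
  obtain \<Lambda> :: "'p padic set" where \<Lambda>: "finite \<Lambda>"
    "\<And>x. 2 powi (- int (K + m)) \<le> pabs x \<Longrightarrow> pabs x \<le> 2 powi int (K + m) \<Longrightarrow> \<exists>l\<in>\<Lambda>. near n x l"
    using near_representatives[OF n, of "K + m"] by blast
  have "\<exists>h\<in>H. \<exists>l\<in>\<Lambda>. cosim m n u (l * h) \<and>
      (\<forall>h'\<in>H. \<forall>k. \<bar>k\<bar> \<le> int K \<longrightarrow> (2 powi k * pabs h' \<le> pabs u \<longleftrightarrow> 2 powi k * pabs h' \<le> pabs (l * h)))"
    if H: "finite H" "\<exists>h\<in>H. h \<noteq> 0" and u: "u \<noteq> 0" for H and u :: "'p padic"
  proof -
    have scaled: "\<exists>l\<in>\<Lambda>. cosim m n u (l * h) \<and> pabs (l * h) = 2 powi i * pabs h"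
      if h: "h \<noteq> 0" and eq: "pabs u = 2 powi (q * int m + i) * pabs h" and i: "\<bar>i\<bar> \<le> int (K + m)" for h q i
    proof -
      let ?v = "prime_elt powi (q * int m) * u"
      have v: "pabs ?v = 2 powi i * pabs h"
        by (simp add: eq power_int_add power_int_minus)
      then have "pabs (?v / h) = 2 powi i" using h by simp
      then obtain l where l: "l \<in> \<Lambda>" "near n (?v / h) l"
        using \<Lambda>(2)[of "?v / h"] i unfolding two_powi_le_iff[of "- int (K + m)" i, symmetric]
        by (metis abs_le_D1 abs_le_D2 minus_le_iff two_powi_le_iff)
      have near: "near n ?v (l * h)" using near_mult[OF l(2), of h] h by (simp add: mult.commute)
      have "cosim m n u ?v" using cosim_sym[OF cosim_prime_elt_powi[OF n] n] .
      then have "cosim m n u (l * h)" using cosim_trans near_cosim[OF near] n by blast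
      then show ?thesis using l(1) near_pabs[OF near n] v by auto
    qed
    show ?thesis
    proof (cases "\<exists>h\<in>H. h \<noteq> 0 \<and> 2 powi (- int K) * pabs h \<le> pabs u \<and> pabs u \<le> 2 powi int K * pabs h")
      case True
      then obtain h where h: "h \<in> H" "h \<noteq> 0" "2 powi (- int K) * pabs h \<le> pabs u"
        "pabs u \<le> 2 powi int K * pabs h" by blast
      obtain i where i: "pabs u = 2 powi i * pabs h" using pabs_ratio[OF u h(2)] .
      have "(2::real) powi (- int K) \<le> 2 powi i" "(2::real) powi i \<le> 2 powi int K"
        using h unfolding i by simp_all
      then have "- int K \<le> i" "i \<le> int K" unfolding two_powi_le_iff .
      then have "\<bar>i\<bar> \<le> int (K + m)" by simp
      then obtain l where "l \<in> \<Lambda>" "cosim m n u (l * h)" "pabs (l * h) = pabs u"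
        using scaled[of h 0 i] h(2) i by auto
      then show ?thesis using h(1) by (intro bexI[of _ h] bexI[of _ l]) simp_all
    next
      case False
      then have far: "pabs u < 2 powi (- int K) * pabs h \<or> 2 powi int K * pabs h < pabs u"
        if "h \<in> H" "h \<noteq> 0" for h using that by force
      have pw: "(2::real) powi k \<le> 2 powi int K" "(2::real) powi (- int K) \<le> 2 powi k" if "\<bar>k\<bar> \<le> int K" for k
        using that by (simp_all only: two_powi_le_iff)
      let ?H1 = "{h \<in> H. h \<noteq> 0 \<and> 2 powi int K * pabs h < pabs u}"
      show ?thesis
      proof (cases "?H1 = {}")
        case False
        obtain h where h: "h \<in> ?H1" "\<And>h'. h' \<in> ?H1 \<Longrightarrow> pabs h' \<le> pabs h"
          using ex_arg_max[OF _ False, of pabs] H(1) by auto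
        then have hH: "h \<in> H" "h \<noteq> 0" "2 powi int K * pabs h < pabs u" by auto
        obtain j where j: "pabs u = 2 powi j * pabs h" using pabs_ratio[OF u hH(2)] .
        have "(2::real) powi int K < 2 powi j" using hH unfolding j by simp
        then have "int K < j" unfolding two_powi_less_iff .
        \<comment> \<open>\<open>h\<close> is the largest element below the gap. The exponent i is
          the representative of j modulo m from K + 1 to K + m: just outside the window of
          \<open>h\<close>, and not beyond j because q \<ge> 0.\<close>
        define q where "q = (j - int K - 1) div int m"
        define i where "i = int K + 1 + (j - int K - 1) mod int m"
        have ji: "j = q * int m + i"
          unfolding q_def i_def using div_mult_mod_eq[of "j - int K - 1" "int m"] by linarith
        have q0: "0 \<le> q" unfolding q_def using \<open>int K < j\<close> m by (simp add: pos_imp_zdiv_nonneg_iff)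
        have iK: "int K < i" "i \<le> int (K + m)"
          unfolding i_def using m pos_mod_bound[of "int m" "j - int K - 1"] pos_mod_sign[of "int m" "j - int K - 1"] by linarith+
        have "i \<le> j" using ji q0 by simp
        obtain l where l: "l \<in> \<Lambda>" "cosim m n u (l * h)" "pabs (l * h) = 2 powi i * pabs h"
          using scaled[OF hH(2) j[unfolded ji]] iK by auto
        have le: "pabs (l * h) \<le> pabs u"
          unfolding l(3) j using \<open>i \<le> j\<close> by (intro mult_right_mono) simp_all
        have "(2::real) powi int K < 2 powi i" using iK by (simp only: two_powi_less_iff)
        then have gt: "2 powi int K * pabs h < pabs (l * h)" unfolding l(3) using hH(2) by simp
        have "2 powi k * pabs h' \<le> pabs u \<longleftrightarrow> 2 powi k * pabs h' \<le> pabs (l * h)"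
          if h': "h' \<in> H" and k: "\<bar>k\<bar> \<le> int K" for h' k
        proof -
          consider "h' = 0" | "h' \<in> ?H1" | "h' \<noteq> 0" "pabs u < 2 powi (- int K) * pabs h'"
            using far[OF h'] h' by blast
          then show ?thesis
          proof cases
            case 2
            have "2 powi k * pabs h' \<le> 2 powi int K * pabs h"
              using pw[OF k] h(2)[OF 2] by (intro mult_mono) auto
            then show ?thesis using gt le by linarith
          next
            case 3
            have "2 powi (- int K) * pabs h' \<le> 2 powi k * pabs h'"
              using pw[OF k] by (intro mult_right_mono) simp_all
            then show ?thesis using 3 le by linarith
          qed simp
        qed
        then show ?thesis using hH(1) l by blast
      next
        case True
        then have below: "pabs u < 2 powi (- int K) * pabs h" if "h \<in> H" "h \<noteq> 0" for h
          using far[OF that] that by blast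
        obtain h where h: "h \<in> {h \<in> H. h \<noteq> 0}" "\<And>h'. h' \<in> {h \<in> H. h \<noteq> 0} \<Longrightarrow> pabs h \<le> pabs h'"
          using ex_arg_min[of "{h \<in> H. h \<noteq> 0}" pabs] H by auto
        then have hH: "h \<in> H" "h \<noteq> 0" by auto
        obtain j where j: "pabs u = 2 powi j * pabs h" using pabs_ratio[OF u hH(2)] .
        have "(2::real) powi j < 2 powi (- int K)" using below[OF hH] hH(2) unfolding j by simp
        then have "j < - int K" unfolding two_powi_less_iff .
        \<comment> \<open>The mirror image: \<open>u\<close> lies below all nonzero elements, and i
          is the representative of j modulo m from - K - m to - K - 1.\<close>
        define q where "q = (- j - int K - 1) div int m"
        define i where "i = - (int K + 1 + (- j - int K - 1) mod int m)"
        have "- j = q * int m - i"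
          unfolding q_def i_def using div_mult_mod_eq[of "- j - int K - 1" "int m"] by linarith
        then have ji: "j = - q * int m + i" by simp
        have iK: "i < - int K" "- int (K + m) \<le> i"
          unfolding i_def using m pos_mod_bound[of "int m" "- j - int K - 1"] pos_mod_sign[of "int m" "- j - int K - 1"] by linarith+
        obtain l where l: "l \<in> \<Lambda>" "cosim m n u (l * h)" "pabs (l * h) = 2 powi i * pabs h"
          using scaled[OF hH(2) j[unfolded ji]] iK by auto
        have "(2::real) powi i < 2 powi (- int K)" using iK by (simp only: two_powi_less_iff)
        then have lt: "pabs (l * h) < 2 powi (- int K) * pabs h" unfolding l(3) using hH(2) by simp
        have "2 powi k * pabs h' \<le> pabs u \<longleftrightarrow> 2 powi k * pabs h' \<le> pabs (l * h)"
          if h': "h' \<in> H" and k: "\<bar>k\<bar> \<le> int K" for h' k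
        proof (cases "h' = 0")
          case False
          have "2 powi (- int K) * pabs h' \<le> 2 powi k * pabs h'"
            using pw[OF k] by (intro mult_right_mono) simp_all
          moreover have "2 powi (- int K) * pabs h \<le> 2 powi (- int K) * pabs h'"
            using h(2)[of h'] h' False by (intro mult_left_mono) auto
          ultimately show ?thesis using below[OF h' False] lt by linarith
        qed simp
        then show ?thesis using hH(1) l by blast
      qed
    qed
  qed
  then show ?thesis using \<Lambda>(1) by blast
qed

lemma threshold_less:
  fixes u h :: "'p::prime_card padic"
  assumes "u \<noteq> 0"
  shows "pabs u \<le> 2 powi k * pabs h \<longleftrightarrow> h \<noteq> 0 \<and> \<not> 2 powi (k + 1) * pabs h \<le> pabs u"
proof (cases "h = 0")
  case False
  have "2 powi k * pabs h < 2 powi (k + 1) * pabs h" using False by (simp add: power_int_add)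
  then show ?thesis using False pabs_discrete[of u k h] by linarith
qed (use assms in simp)

text \<open>Expanding the maxima leaves comparisons of \<open>pabs u\<close> with multiples of
  \<open>pabs h1\<close> and \<open>pabs h2\<close>. Upper bounds on \<open>pabs u\<close> are
  tested at the next scale, by \<open>threshold_less\<close>, which is why the bound on
  \<open>e1 - e2\<close> is strict.\<close>

lemma compare_max:
  fixes u u' h1 h2 :: "'p::prime_card padic"
  assumes u: "u \<noteq> 0" "u' \<noteq> 0"
    and thr: "\<And>h k. h \<in> {h1, h2} \<Longrightarrow> \<bar>k\<bar> \<le> int K \<Longrightarrow> 2 powi k * pabs h \<le> pabs u \<longleftrightarrow> 2 powi k * pabs h \<le> pabs u'"
    and A: "A1 = 0 \<or> A1 = 2 powi e1" "A2 = 0 \<or> A2 = 2 powi e2" and e: "\<bar>e1 - e2\<bar> < int K"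
  shows "max (A1 * pabs u) (2 powi e1 * pabs h1) \<le> max (A2 * pabs u) (2 powi e2 * pabs h2) \<longleftrightarrow>
    max (A1 * pabs u') (2 powi e1 * pabs h1) \<le> max (A2 * pabs u') (2 powi e2 * pabs h2)"
proof -
  have pos: "0 < pabs u" "0 < pabs u'" using u by simp_all
  have 1: "A1 * pabs u \<le> A2 * pabs u \<longleftrightarrow> A1 * pabs u' \<le> A2 * pabs u'"
    using pos by (simp only: mult_le_cancel_right_pos)
  have 2: "A1 * pabs u \<le> 2 powi e2 * pabs h2 \<longleftrightarrow> A1 * pabs u' \<le> 2 powi e2 * pabs h2"
    using A(1)
  proof
    assume A1: "A1 = 2 powi e1"
    have "A1 * pabs v \<le> 2 powi e2 * pabs h2 \<longleftrightarrow> pabs v \<le> 2 powi (e2 - e1) * pabs h2" for v :: "'p padic"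
      unfolding A1 by (simp add: power_int_diff field_simps)
    moreover have "\<bar>e2 - e1 + 1\<bar> \<le> int K" using e by linarith
    ultimately show ?thesis using thr[of h2 "e2 - e1 + 1"] by (simp add: threshold_less u)
  qed simp
  have 3: "2 powi e1 * pabs h1 \<le> A2 * pabs u \<longleftrightarrow> 2 powi e1 * pabs h1 \<le> A2 * pabs u'"
    using A(2)
  proof
    assume A2: "A2 = 2 powi e2"
    have "2 powi e1 * pabs h1 \<le> A2 * pabs v \<longleftrightarrow> 2 powi (e1 - e2) * pabs h1 \<le> pabs v" for v :: "'p padic"
      unfolding A2 by (simp add: power_int_diff field_simps)
    moreover have "\<bar>e1 - e2\<bar> \<le> int K" using e by linarith
    ultimately show ?thesis using thr[of h1 "e1 - e2"] by simp
  qed simp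
  show ?thesis
    unfolding max.bounded_iff le_max_iff_disj using 1 2 3 by simp
qed

definition ev :: "nat \<Rightarrow> (nat \<Rightarrow> 'k::comm_ring) \<Rightarrow> (nat \<Rightarrow> 'k) \<Rightarrow> 'k" where
  "ev N f \<sigma> = (\<Sum>l<N. f l * \<sigma> l)"

text \<open>The semantic substitute for having the same quantifier-free type. Vanishing of a form is
  covered as well, since \<open>cosim\<close> preserves it for \<open>n \<ge> 1\<close>.\<close>

definition agree :: "nat \<Rightarrow> (nat \<Rightarrow> 'p::prime_card padic) set \<Rightarrow> nat \<Rightarrow> nat \<Rightarrow>
    (nat \<Rightarrow> 'p padic) \<Rightarrow> (nat \<Rightarrow> 'p padic) \<Rightarrow> bool" where
  "agree N F m n \<sigma> \<sigma>' \<longleftrightarrow>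
     (\<forall>f\<in>F. cosim m n (ev N f \<sigma>) (ev N f \<sigma>')) \<and>
     (\<forall>f\<in>F. \<forall>g\<in>F. pabs (ev N f \<sigma>) \<le> pabs (ev N g \<sigma>) \<longleftrightarrow> pabs (ev N f \<sigma>') \<le> pabs (ev N g \<sigma>'))"

lemma agree_trans:
  assumes "agree N F m n \<sigma> \<tau>" "agree N F m n \<tau> \<upsilon>" "n \<ge> 1"
  shows "agree N F m n \<sigma> \<upsilon>"
  using assms cosim_trans[OF _ _ assms(3)] unfolding agree_def by metis

lemma agree_mono:
  assumes "agree N F m n \<sigma> \<tau>" "F' \<subseteq> F" "m' dvd m" "n' \<le> n"
  shows "agree N F' m' n' \<sigma> \<tau>"
  using assms(1,2) cosim_mono[OF _ assms(3,4)] unfolding agree_def by (meson subsetD)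

lemma agree_sym:
  assumes "agree N F m n \<sigma> \<tau>" "n \<ge> 1"
  shows "agree N F m n \<tau> \<sigma>"
  using assms(1) cosim_sym[OF _ assms(2)] unfolding agree_def by metis

lemma ev_add: "ev N (\<lambda>l. f l + g l) \<sigma> = ev N f \<sigma> + ev N g \<sigma>"
  by (simp add: ev_def distrib_right sum.distrib)

lemma ev_diff: "ev N (\<lambda>l. f l - g l) \<sigma> = ev N f \<sigma> - ev N g \<sigma>"
  by (simp add: ev_def left_diff_distrib sum_subtractf)

lemma ev_scale: "ev N (\<lambda>l. c * f l) \<sigma> = c * ev N f \<sigma>"
  by (simp add: ev_def mult.assoc sum_distrib_left)

lemma ev_upd:
  assumes "i < N"
  shows "ev N f (\<sigma>(i := t)) = ev N (f(i := 0)) \<sigma> + f i * t"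
proof -
  have 1: "ev N f (\<sigma>(i := t)) = f i * t + (\<Sum>l\<in>{..<N} - {i}. f l * \<sigma> l)"
    unfolding ev_def using assms by (subst sum.remove[of _ i]) auto
  have 2: "ev N (f(i := 0)) \<sigma> = (\<Sum>l\<in>{..<N} - {i}. f l * \<sigma> l)"
    unfolding ev_def using assms by (subst sum.remove[of _ i]) auto
  show ?thesis unfolding 1 2 by (rule add.commute)
qed

text \<open>The forth half of a back-and-forth argument. Unless all forms in \<open>H\<close>
  vanish, \<open>t\<close> is matched over \<open>\<sigma>\<close> by the value of some form
  \<open>e\<close> in the finite set \<open>E\<close>. The results of substituting \<open>e\<close>
  belong to \<open>F'\<close>, so the same \<open>e\<close> works over
  \<open>\<sigma>'\<close>.\<close>

lemma agree_elim_variable: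
  fixes F :: "(nat \<Rightarrow> 'p::prime_card padic) set"
  assumes i: "i < N" and F: "finite F" and n: "n \<ge> 1" and m: "m \<ge> 1"
  shows "\<exists>F'. finite F' \<and> (\<forall>\<sigma> \<sigma>'. agree N F' m n \<sigma> \<sigma>' \<longrightarrow>
    (\<forall>t. \<exists>t'. agree N F m n (\<sigma>(i := t)) (\<sigma>'(i := t'))))"
proof -
  have "\<exists>e. pabs (if f i = 0 then 1 else f i) = 2 powi e" for f :: "nat \<Rightarrow> 'p padic"
    using pabs_power_of_two[of "if f i = 0 then 1 else f i"] by (metis zero_neq_one)
  note expo_ex = this
  \<comment> \<open>For a form without the variable the coefficient is replaced by 1, so that one
    formula, a maximum, describes the absolute values of all forms.\<close>
  define expo where "expo f = (SOME e. pabs (if f i = 0 then 1 else f i) = 2 powi e)" for f :: "nat \<Rightarrow> 'p padic"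
  have expo: "pabs (if f i = 0 then 1 else f i) = 2 powi expo f" for f :: "nat \<Rightarrow> 'p padic"
    unfolding expo_def by (rule someI_ex[OF expo_ex])
  obtain D where D: "\<And>f. f \<in> F \<Longrightarrow> \<bar>expo f\<bar> \<le> int D"
  proof
    fix f assume "f \<in> F"
    then have "nat \<bar>expo f\<bar> \<le> Max ((\<lambda>f. nat \<bar>expo f\<bar>) ` F)" using F by (intro Max_ge) auto
    then show "\<bar>expo f\<bar> \<le> int (Max ((\<lambda>f. nat \<bar>expo f\<bar>) ` F))" by linarith
  qed
  \<comment> \<open>\<open>cosim_translate\<close> needs the scales up to n. Coefficients with
    exponents up to \<open>D\<close> shift a comparison of two forms by at most 2D, and the 1 serves
    the strict bound in \<open>compare_max\<close>.\<close>
  define K where "K = n + 2 * D + 1"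
  obtain \<Lambda> :: "'p padic set" where \<Lambda>: "finite \<Lambda> \<and> (\<forall>H u. finite H \<longrightarrow> u \<noteq> 0 \<longrightarrow> (\<exists>h\<in>H. h \<noteq> 0) \<longrightarrow>
    (\<exists>h\<in>H. \<exists>l\<in>\<Lambda>. cosim m n u (l * h) \<and>
      (\<forall>h'\<in>H. \<forall>k. \<bar>k\<bar> \<le> int K \<longrightarrow> (2 powi k * pabs h' \<le> pabs u \<longleftrightarrow> 2 powi k * pabs h' \<le> pabs (l * h)))))"
    using test_point_existence[OF n m, of K] by (rule exE)
  note test = \<Lambda>[THEN conjunct2, rule_format]
  define root where "root f = (\<lambda>l. (- 1 / f i) * (f(i := 0)) l)" for f :: "nat \<Rightarrow> 'p padic"
  \<comment> \<open>The zero form keeps \<open>C\<close> nonempty when the variable occurs in none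
    of the forms.\<close>
  define C where "C = insert (\<lambda>_. 0) (root ` {f \<in> F. f i \<noteq> 0})"
  define H where "H = (\<lambda>(c, c'). (\<lambda>l. c l - c' l)) ` (C \<times> C) \<union> (\<lambda>f. f(i := 0)) ` F"
  define E where "E = C \<union> (\<lambda>(c, x, h). (\<lambda>l. c l + x * h l)) ` (C \<times> \<Lambda> \<times> H)"
  define subst where "subst f e = (\<lambda>l. (f(i := 0)) l + f i * e l)" for f e :: "nat \<Rightarrow> 'p padic"
  define F' where "F' = H \<union> (\<lambda>(f, e). subst f e) ` (F \<times> E)"
  have fin: "finite C" "finite H" "finite E" "finite F'"
    unfolding F'_def E_def H_def C_def using F \<Lambda> by auto
  have upd: "ev N f (\<sigma>(i := t)) = f i * (t - ev N (root f) \<sigma>)" if "f i \<noteq> 0" for f \<sigma> t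
  proof -
    have "ev N (root f) \<sigma> = - 1 / f i * ev N (f(i := 0)) \<sigma>" unfolding root_def ev_scale ..
    then show ?thesis unfolding ev_upd[OF i] using that by (simp add: field_simps)
  qed
  have upd0: "ev N f (\<sigma>(i := t)) = ev N (f(i := 0)) \<sigma>" if "f i = 0" for f \<sigma> t
    unfolding ev_upd[OF i] using that by simp
  have subst: "ev N (subst f e) \<sigma> = ev N f (\<sigma>(i := ev N e \<sigma>))" for f e \<sigma>
    unfolding subst_def ev_upd[OF i] ev_add ev_scale ..
  have "\<exists>t'. agree N F m n (\<sigma>(i := t)) (\<sigma>'(i := t'))" if ag: "agree N F' m n \<sigma> \<sigma>'" for \<sigma> \<sigma>' t
  proof -
    have agE: "agree N F m n (\<sigma>(i := ev N e \<sigma>)) (\<sigma>'(i := ev N e \<sigma>'))" if e: "e \<in> E" for e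
    proof -
      have "subst f e \<in> F'" if "f \<in> F" for f using that e unfolding F'_def by auto
      then show ?thesis using ag unfolding agree_def subst[symmetric] by meson
    qed
    have "C \<noteq> {}" by (simp add: C_def)
    then obtain c where c: "c \<in> C" "\<And>c'. c' \<in> C \<Longrightarrow> pabs (t - ev N c \<sigma>) \<le> pabs (t - ev N c' \<sigma>)"
      using ex_arg_min[OF fin(1), of "\<lambda>c. pabs (t - ev N c \<sigma>)"] by blast
    define u where "u = t - ev N c \<sigma>"
    have rootC: "root f \<in> C" if "f \<in> F" "f i \<noteq> 0" for f using that by (auto simp: C_def)
    have rootH: "(\<lambda>l. root f l - c l) \<in> H" if "f \<in> F" "f i \<noteq> 0" for f
      unfolding H_def by (rule UnI1, rule image_eqI[of _ _ "(root f, c)"]) (use rootC[OF that] c(1) in auto)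
    have restH: "f(i := 0) \<in> H" if "f \<in> F" for f unfolding H_def using that by simp
    consider "u = 0" | "u \<noteq> 0" "\<exists>h\<in>H. ev N h \<sigma> \<noteq> 0" | "u \<noteq> 0" "\<And>h. h \<in> H \<Longrightarrow> ev N h \<sigma> = 0" by blast
    then show ?thesis
    proof cases
      case 1
      then have "t = ev N c \<sigma>" by (simp add: u_def)
      moreover have "c \<in> E" using c(1) by (simp add: E_def)
      ultimately show ?thesis using agE by blast
    next
      case 2
      have "\<exists>h\<in>(\<lambda>h. ev N h \<sigma>) ` H. h \<noteq> 0" using 2(2) by blast
      from test[OF finite_imageI[OF fin(2)] 2(1) this] obtain h x where hx: "h \<in> H" "x \<in> \<Lambda>"
        "cosim m n u (x * ev N h \<sigma>)" and
        thr: "\<And>h' k. h' \<in> H \<Longrightarrow> \<bar>k\<bar> \<le> int K \<Longrightarrow>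
          2 powi k * pabs (ev N h' \<sigma>) \<le> pabs u \<longleftrightarrow> 2 powi k * pabs (ev N h' \<sigma>) \<le> pabs (x * ev N h \<sigma>)"
        by auto
      define u' where "u' = x * ev N h \<sigma>"
      define e where "e = (\<lambda>l. c l + x * h l)"
      have "e \<in> E" unfolding E_def e_def
        by (rule UnI2, rule image_eqI[of _ _ "(c, x, h)"]) (use c(1) hx in auto)
      have eve: "ev N e \<sigma> = ev N c \<sigma> + u'" unfolding e_def ev_add ev_scale u'_def ..
      have u'0: "u' \<noteq> 0" using cosim_0[OF hx(3) n] 2(1) by (simp add: u'_def)
      define hh where "hh f = (if f i = 0 then ev N (f(i := 0)) \<sigma> else ev N (\<lambda>l. root f l - c l) \<sigma>)" for f
      define A where "A f = (if f i = 0 then 0 else pabs (f i))" for f :: "nat \<Rightarrow> 'p padic"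
      have hhH: "2 powi k * pabs (hh f) \<le> pabs u \<longleftrightarrow> 2 powi k * pabs (hh f) \<le> pabs u'"
        if "f \<in> F" "\<bar>k\<bar> \<le> int K" for f k
        using thr[OF rootH[OF that(1)] that(2)] thr[OF restH[OF that(1)] that(2)]
        by (auto simp: hh_def u'_def simp del: pabs_mult)
      have val: "cosim m n (ev N f (\<sigma>(i := t))) (ev N f (\<sigma>(i := ev N e \<sigma>))) \<and>
          pabs (ev N f (\<sigma>(i := t))) = max (A f * pabs u) (2 powi expo f * pabs (hh f)) \<and>
          pabs (ev N f (\<sigma>(i := ev N e \<sigma>))) = max (A f * pabs u') (2 powi expo f * pabs (hh f))"
        if f: "f \<in> F" for f
      proof (cases "f i = 0")
        case True
        have "2 powi expo f = (1::real)" using expo[of f] True by simp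
        then show ?thesis using True by (simp add: upd0 hh_def A_def)
      next
        case False
        have h: "hh f = ev N (root f) \<sigma> - ev N c \<sigma>" using False by (simp add: hh_def ev_diff)
        have tu: "t - ev N (root f) \<sigma> = u - hh f" "ev N e \<sigma> - ev N (root f) \<sigma> = u' - hh f"
          unfolding h eve by (simp_all add: u_def)
        have "\<bar>k\<bar> \<le> int K" if "\<bar>k\<bar> \<le> int n" for k using that by (simp add: K_def)
        then have tr: "pabs (u - hh f) = max (pabs u) (pabs (hh f)) \<and>
            pabs (u' - hh f) = max (pabs u') (pabs (hh f)) \<and> cosim m n (u - hh f) (u' - hh f)"
          using hhH[OF f] c(2)[OF rootC[OF f False]] hx(3)
          by (intro cosim_translate n m) (simp_all add: u'_def u_def h)
        have "A f = 2 powi expo f" "pabs (f i) = 2 powi expo f" using expo[of f] False by (simp_all add: A_def)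
        then show ?thesis
          using tr by (simp add: upd[of f, OF False] tu cosim_mult max_mult_distrib_left)
      qed
      have "agree N F m n (\<sigma>(i := t)) (\<sigma>(i := ev N e \<sigma>))"
        unfolding agree_def
      proof (intro conjI ballI)
        fix f g assume fg: "f \<in> F" "g \<in> F"
        have "\<bar>expo f - expo g\<bar> < int K" using D[OF fg(1)] D[OF fg(2)] by (simp add: K_def)
        moreover have "A f = 0 \<or> A f = 2 powi expo f" for f using expo[of f] by (cases "f i = 0") (simp_all add: A_def)
        ultimately have "max (A f * pabs u) (2 powi expo f * pabs (hh f)) \<le> max (A g * pabs u) (2 powi expo g * pabs (hh g)) \<longleftrightarrow>
          max (A f * pabs u') (2 powi expo f * pabs (hh f)) \<le> max (A g * pabs u') (2 powi expo g * pabs (hh g))"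
          using hhH[OF fg(1)] hhH[OF fg(2)] 2(1) u'0 by (intro compare_max[where K=K]) auto
        then show "pabs (ev N f (\<sigma>(i := t))) \<le> pabs (ev N g (\<sigma>(i := t))) \<longleftrightarrow>
          pabs (ev N f (\<sigma>(i := ev N e \<sigma>))) \<le> pabs (ev N g (\<sigma>(i := ev N e \<sigma>)))"
          using val[OF fg(1)] val[OF fg(2)] by simp
      qed (use val in simp)
      then show ?thesis using agree_trans[OF _ agE[OF \<open>e \<in> E\<close>] n] by blast
    next
      case 3
      \<comment> \<open>All roots coincide at \<open>\<sigma>\<close>, hence also at
        \<open>\<sigma>'\<close>, as \<open>cosim\<close> detects 0. No nonzero form is left to
        scale, but \<open>u\<close> itself can be carried over unchanged.\<close>
      have zero': "ev N h \<sigma>' = 0" if "h \<in> H" for h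
      proof -
        have "cosim m n (ev N h \<sigma>) (ev N h \<sigma>')" using ag that by (auto simp: agree_def F'_def)
        from cosim_0[OF this n] show ?thesis using 3(2)[OF that] by simp
      qed
      have "ev N f (\<sigma>(i := t)) = ev N f (\<sigma>'(i := ev N c \<sigma>' + u))" if f: "f \<in> F" for f
      proof (cases "f i = 0")
        case True
        then show ?thesis using 3(2)[OF restH[OF f]] zero'[OF restH[OF f]] by (simp add: upd0)
      next
        case False
        then show ?thesis
          using 3(2)[OF rootH[OF f False]] zero'[OF rootH[OF f False]]
          by (simp add: upd u_def ev_diff)
      qed
      then have "agree N F m n (\<sigma>(i := t)) (\<sigma>'(i := ev N c \<sigma>' + u))"
        unfolding agree_def by simp
      then show ?thesis by blast
    qed
  qed
  then show ?thesis using fin(4) by blast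
qed

text \<open>Bound variables count too: the assignments compared by \<open>agree N\<close> must have
  room for the variable of every quantifier.\<close>

primrec all_vars :: "('f, 'r) fm \<Rightarrow> nat set" where
  "all_vars (Eq s t) = vars_tm s \<union> vars_tm t"
| "all_vars (Rel r ts) = \<Union>(set (map vars_tm ts))"
| "all_vars (Neg \<phi>) = all_vars \<phi>"
| "all_vars (Conj \<phi> \<psi>) = all_vars \<phi> \<union> all_vars \<psi>"
| "all_vars (Ex i \<phi>) = insert i (all_vars \<phi>)"

lemma finite_vars_tm: "finite (vars_tm t)"
  by (induction t) auto

lemma finite_all_vars: "finite (all_vars \<phi>)"
  by (induction \<phi>) (auto simp: finite_vars_tm)

text \<open>The forms are homogeneous because 0 is the only constant symbol.\<close>

lemma term_linear:
  fixes t :: "'p::prime_card padic aff_fn tm"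
  assumes "wf_tm aff_language t" "vars_tm t \<subseteq> {..<N}"
  shows "\<exists>f. \<forall>\<sigma>. eval_tm padic_struct \<sigma> t = ev N f \<sigma>"
  using assms
proof (induction t)
  case (Var i)
  have "ev N ((\<lambda>_. 0)(i := 1)) \<sigma> = \<sigma> i" for \<sigma> :: "nat \<Rightarrow> 'p padic"
    unfolding ev_def using Var by (subst sum.remove[of _ i]) auto
  then show ?case by (intro exI[of _ "(\<lambda>_. 0)(i := 1)"]) (simp del: fun_upd_apply)
next
  case (Fn g ts)
  have len: "length ts = fn_arity aff_language g" and wf: "list_all (wf_tm aff_language) ts"
    using Fn.prems by simp_all
  have IH: "\<exists>f. \<forall>\<sigma>. eval_tm padic_struct \<sigma> t = ev N f \<sigma>" if "t \<in> set ts" for t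
    using Fn.IH[OF that] Fn.prems that by (auto simp: list_all_iff)
  show ?case
  proof (cases g)
    case Zero_sym
    then show ?thesis by (intro exI[of _ "\<lambda>_. 0"]) (simp add: padic_struct_def ev_def)
  next
    case Plus_sym
    with len obtain s t where ts: "ts = [s, t]"
      by (auto simp: aff_language_def length_Suc_conv numeral_2_eq_2)
    obtain f1 f2 where "\<forall>\<sigma>. eval_tm padic_struct \<sigma> s = ev N f1 \<sigma>" "\<forall>\<sigma>. eval_tm padic_struct \<sigma> t = ev N f2 \<sigma>"
      using IH[of s] IH[of t] ts by auto
    then show ?thesis
      by (intro exI[of _ "\<lambda>l. f1 l + f2 l"]) (simp add: ev_add ts Plus_sym padic_struct_def)
  next
    case Minus_sym
    with len obtain s where ts: "ts = [s]"
      by (auto simp: aff_language_def length_Suc_conv)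
    obtain f1 where "\<forall>\<sigma>. eval_tm padic_struct \<sigma> s = ev N f1 \<sigma>" using IH[of s] ts by auto
    then show ?thesis
      by (intro exI[of _ "\<lambda>l. (- 1) * f1 l"]) (simp only: ev_scale, simp add: ts Minus_sym padic_struct_def)
  next
    case (Scalar_sym c)
    with len obtain s where ts: "ts = [s]"
      by (auto simp: aff_language_def length_Suc_conv)
    obtain f1 where "\<forall>\<sigma>. eval_tm padic_struct \<sigma> s = ev N f1 \<sigma>" using IH[of s] ts by auto
    then show ?thesis
      by (intro exI[of _ "\<lambda>l. c * f1 l"]) (simp add: ev_scale ts Scalar_sym padic_struct_def)
  qed
qed

text \<open>Quantifier elimination in semantic form: no equivalent quantifier-free formula is
  produced, only finitely many forms that decide the truth value.\<close>

theorem sat_determined_by_linear_forms: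
  fixes \<phi> :: "('p::prime_card padic aff_fn, aff_rel) fm"
  assumes "wf_fm aff_language \<phi>" "all_vars \<phi> \<subseteq> {..<N}"
  shows "\<exists>F m n. finite F \<and> m \<ge> 1 \<and> n \<ge> 1 \<and> (\<forall>\<sigma> \<sigma>'. agree N F m n \<sigma> \<sigma>' \<longrightarrow>
    sat padic_struct \<sigma> \<phi> = sat padic_struct \<sigma>' \<phi>)"
  using assms
proof (induction \<phi>)
  case (Eq s t)
  obtain f g where fg: "\<forall>\<sigma>. eval_tm padic_struct \<sigma> s = ev N f \<sigma>" "\<forall>\<sigma>. eval_tm padic_struct \<sigma> t = ev N g \<sigma>"
    using term_linear[of s N] term_linear[of t N] Eq by auto
  have "ev N f \<sigma> = ev N g \<sigma> \<longleftrightarrow> ev N f \<sigma>' = ev N g \<sigma>'" if "agree N {\<lambda>l. f l - g l} 1 1 \<sigma> \<sigma>'" for \<sigma> \<sigma>'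
    using that cosim_0[of 1 1 "ev N f \<sigma> - ev N g \<sigma>" "ev N f \<sigma>' - ev N g \<sigma>'"]
    by (simp add: agree_def ev_diff)
  then show ?case
    by (intro exI[of _ "{\<lambda>l. f l - g l}"] exI[of _ 1]) (simp add: fg)
next
  case (Rel r ts)
  let ?L = "aff_language :: ('p padic aff_fn, aff_rel) language"
  have wf: "length ts = rel_arity ?L r" "r \<in> rel_symbols ?L"
    using Rel.prems(1) by simp_all
  have lin: "\<exists>f. \<forall>\<sigma>. eval_tm padic_struct \<sigma> t = ev N f \<sigma>" if "t \<in> set ts" for t
    using term_linear[of t N] that Rel by (auto simp: list_all_iff)
  show ?case
  proof (cases r)
    case Div_sym
    with wf obtain s t where ts: "ts = [s, t]"
      by (auto simp: aff_language_def length_Suc_conv numeral_2_eq_2)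
    obtain f g where fg: "\<forall>\<sigma>. eval_tm padic_struct \<sigma> s = ev N f \<sigma>" "\<forall>\<sigma>. eval_tm padic_struct \<sigma> t = ev N g \<sigma>"
      using lin[of s] lin[of t] ts by auto
    show ?thesis
      by (intro exI[of _ "{f, g}"] exI[of _ 1])
        (auto simp: agree_def ts Div_sym padic_struct_def[abs_def] pval_le_iff fg[unfolded padic_struct_def])
  next
    case (Q_sym m n)
    with wf have mn: "m \<ge> 1" "n \<ge> 1" by (auto simp: aff_language_def)
    from Q_sym wf obtain s where ts: "ts = [s]"
      by (auto simp: aff_language_def length_Suc_conv)
    obtain f where f: "\<forall>\<sigma>. eval_tm padic_struct \<sigma> s = ev N f \<sigma>" using lin[of s] ts by auto
    have "cosim m n (ev N f \<sigma>) 1 \<longleftrightarrow> cosim m n (ev N f \<sigma>') 1" if "agree N {f} m n \<sigma> \<sigma>'" for \<sigma> \<sigma>'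
    proof -
      have "cosim m n (ev N f \<sigma>) (ev N f \<sigma>')" using that by (simp add: agree_def)
      from cosim_trans[OF this _ mn(2)] cosim_trans[OF cosim_sym[OF this mn(2)] _ mn(2)]
      show ?thesis by metis
    qed
    then show ?thesis using mn
      by (intro exI[of _ "{f}"] exI[of _ m] exI[of _ n])
        (simp add: ts Q_sym padic_struct_def Qset_iff f[unfolded padic_struct_def])
  qed
next
  case (Neg \<phi>)
  then obtain F m n where "finite F" "m \<ge> 1" "n \<ge> 1"
    "\<forall>\<sigma> \<sigma>'. agree N F m n \<sigma> \<sigma>' \<longrightarrow> sat padic_struct \<sigma> \<phi> = sat padic_struct \<sigma>' \<phi>" by auto
  then show ?case by (intro exI[of _ F] exI[of _ m] exI[of _ n]) simp
next
  case (Conj \<phi>1 \<phi>2)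
  then obtain F1 m1 n1 F2 m2 n2 where 1: "finite F1" "m1 \<ge> 1" "n1 \<ge> 1"
    "\<forall>\<sigma> \<sigma>'. agree N F1 m1 n1 \<sigma> \<sigma>' \<longrightarrow> sat padic_struct \<sigma> \<phi>1 = sat padic_struct \<sigma>' \<phi>1"
    and 2: "finite F2" "m2 \<ge> 1" "n2 \<ge> 1"
    "\<forall>\<sigma> \<sigma>'. agree N F2 m2 n2 \<sigma> \<sigma>' \<longrightarrow> sat padic_struct \<sigma> \<phi>2 = sat padic_struct \<sigma>' \<phi>2"
    by auto
  have "sat padic_struct \<sigma> (Conj \<phi>1 \<phi>2) = sat padic_struct \<sigma>' (Conj \<phi>1 \<phi>2)"
    if ag: "agree N (F1 \<union> F2) (m1 * m2) (max n1 n2) \<sigma> \<sigma>'" for \<sigma> \<sigma>'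
  proof -
    have "agree N F1 m1 n1 \<sigma> \<sigma>'" "agree N F2 m2 n2 \<sigma> \<sigma>'" by (auto intro: agree_mono[OF ag])
    then show ?thesis using 1(4) 2(4) by simp
  qed
  then show ?case using 1(1-3) 2(1-3)
    by (intro exI[of _ "F1 \<union> F2"] exI[of _ "m1 * m2"] exI[of _ "max n1 n2"]) simp
next
  case (Ex i \<phi>)
  then obtain F m n where 1: "finite F" "m \<ge> 1" "n \<ge> 1"
    "\<forall>\<sigma> \<sigma>'. agree N F m n \<sigma> \<sigma>' \<longrightarrow> sat padic_struct \<sigma> \<phi> = sat padic_struct \<sigma>' \<phi>" by auto
  have "i < N" using Ex.prems by simp
  from agree_elim_variable[OF this 1(1,3,2)] obtain F' where F': "finite F'"
    "\<forall>\<sigma> \<sigma>'. agree N F' m n \<sigma> \<sigma>' \<longrightarrow> (\<forall>t. \<exists>t'. agree N F m n (\<sigma>(i := t)) (\<sigma>'(i := t')))" by blast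
  \<comment> \<open>One direction suffices, because \<open>agree\<close> is symmetric.\<close>
  have imp: "sat padic_struct \<sigma>' (Ex i \<phi>)"
    if ag: "agree N F' m n \<sigma> \<sigma>'" and st: "sat padic_struct \<sigma> (Ex i \<phi>)" for \<sigma> \<sigma>'
  proof -
    obtain t where t: "sat padic_struct (\<sigma>(i := t)) \<phi>" using st by auto
    obtain t' where "agree N F m n (\<sigma>(i := t)) (\<sigma>'(i := t'))" using F'(2) ag by blast
    then have "sat padic_struct (\<sigma>'(i := t')) \<phi>" using 1(4) t by blast
    then show ?thesis by auto
  qed
  have "sat padic_struct \<sigma> (Ex i \<phi>) = sat padic_struct \<sigma>' (Ex i \<phi>)" if ag: "agree N F' m n \<sigma> \<sigma>'" for \<sigma> \<sigma>'
    using imp[OF ag] imp[OF agree_sym[OF ag 1(3)]] by (rule iffI)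
  then show ?case using F'(1) 1(2,3) by (intro exI[of _ F'] exI[of _ m] exI[of _ n]) simp
qed

section \<open>Types over finite parameter sets\<close>

text \<open>In the application, \<open>I\<close> gives the x-parts and \<open>J\<close> the negated
  y-parts of the linear forms. A form then takes the value \<open>ev d i a - ev e j b\<close>, the
  displacement of a point from a center.\<close>

locale linear_atoms =
  fixes d e m n :: nat and I J :: "(nat \<Rightarrow> 'p::prime_card padic) set" and \<Lambda> :: "'p padic set"
  assumes finite_I: "finite I" and finite_J: "finite J" and J_nonempty: "J \<noteq> {}"
    and finite_\<Lambda>: "finite \<Lambda>" and n: "n \<ge> 1" and m: "m \<ge> 1"
    and reps: "\<And>x. \<exists>l\<in>\<Lambda>. cosim m n x l"
begin

abbreviation gap where
  "gap i a j b \<equiv> pabs (ev d i a - ev e j b)"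

text \<open>All atoms share one type with two parameters, as \<open>loc_atom\<close> requires. Both
  sides of a comparison are taken at the same \<open>b\<close>, since a given formula is evaluated
  at one parameter at a time.\<close>

definition cmp_atom where
  "cmp_atom i j i' j' = (\<lambda>a b b' :: nat \<Rightarrow> 'p padic.
     gap i a j b \<le> gap i' a j' b)"

definition coset_atom where
  "coset_atom i j l = (\<lambda>a b b' :: nat \<Rightarrow> 'p padic. cosim m n (ev d i a - ev e j b) l)"

definition loc_atom where
  "loc_atom i j j' k = (\<lambda>a b b' :: nat \<Rightarrow> 'p padic. loc k (ev e j b) (ev e j' b') (ev d i a))"

definition atoms :: "((nat \<Rightarrow> 'p padic) \<Rightarrow> (nat \<Rightarrow> 'p padic) \<Rightarrow> (nat \<Rightarrow> 'p padic) \<Rightarrow> bool) set" where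
  "atoms = (\<lambda>(i, j, i', j'). cmp_atom i j i' j') ` (I \<times> J \<times> I \<times> J) \<union>
     (\<lambda>(i, j, l). coset_atom i j l) ` (I \<times> J \<times> \<Lambda>) \<union>
     (\<lambda>(i, j, j', k). loc_atom i j j' k) ` (I \<times> J \<times> J \<times> {- int n..int n})"

definition same_type where
  "same_type B a a' \<longleftrightarrow> (\<forall>\<chi>\<in>atoms. \<forall>b\<in>B. \<forall>b'\<in>B. \<chi> a b b' = \<chi> a' b b')"

definition nearest where
  "nearest B i a j b \<longleftrightarrow>
     (\<forall>j'\<in>J. \<forall>b'\<in>B. gap i a j b \<le> gap i a j' b')"

lemma finite_atoms: "finite atoms"
  unfolding atoms_def using finite_I finite_J finite_\<Lambda> by auto

lemma atomsI:
  assumes "i \<in> I" "j \<in> J"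
  shows "i' \<in> I \<Longrightarrow> j' \<in> J \<Longrightarrow> cmp_atom i j i' j' \<in> atoms"
    and "l \<in> \<Lambda> \<Longrightarrow> coset_atom i j l \<in> atoms"
    and "j' \<in> J \<Longrightarrow> \<bar>k\<bar> \<le> int n \<Longrightarrow> loc_atom i j j' k \<in> atoms"
proof -
  assume "i' \<in> I" "j' \<in> J"
  then show "cmp_atom i j i' j' \<in> atoms"
    unfolding atoms_def using assms by (intro UnI1 image_eqI[of _ _ "(i, j, i', j')"]) auto
next
  assume "l \<in> \<Lambda>"
  then show "coset_atom i j l \<in> atoms"
    unfolding atoms_def using assms by (intro UnI1 UnI2 image_eqI[of _ _ "(i, j, l)"]) auto
next
  assume "j' \<in> J" "\<bar>k\<bar> \<le> int n"
  then show "loc_atom i j j' k \<in> atoms"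
    unfolding atoms_def using assms by (intro UnI2 image_eqI[of _ _ "(i, j, j', k)"]) auto
qed

lemma atomsE:
  assumes "\<chi> \<in> atoms"
  obtains (cmp) i j i' j' where "\<chi> = cmp_atom i j i' j'" "i \<in> I" "j \<in> J" "i' \<in> I" "j' \<in> J"
    | (coset) i j l where "\<chi> = coset_atom i j l" "i \<in> I" "j \<in> J" "l \<in> \<Lambda>"
    | (loc) i j j' k where "\<chi> = loc_atom i j j' k" "i \<in> I" "j \<in> J" "j' \<in> J" "\<bar>k\<bar> \<le> int n"
proof -
  from assms consider "\<chi> \<in> (\<lambda>(i, j, i', j'). cmp_atom i j i' j') ` (I \<times> J \<times> I \<times> J)"
    | "\<chi> \<in> (\<lambda>(i, j, l). coset_atom i j l) ` (I \<times> J \<times> \<Lambda>)"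
    | "\<chi> \<in> (\<lambda>(i, j, j', k). loc_atom i j j' k) ` (I \<times> J \<times> J \<times> {- int n..int n})"
    unfolding atoms_def by blast
  then show thesis
  proof cases
    case 1
    then obtain i j i' j' where "\<chi> = cmp_atom i j i' j'" "i \<in> I" "j \<in> J" "i' \<in> I" "j' \<in> J" by auto
    then show ?thesis by (rule that(1))
  next
    case 2
    then obtain i j l where "\<chi> = coset_atom i j l" "i \<in> I" "j \<in> J" "l \<in> \<Lambda>" by auto
    then show ?thesis by (rule that(2))
  next
    case 3
    then obtain i j j' k where "\<chi> = loc_atom i j j' k" "i \<in> I" "j \<in> J" "j' \<in> J" "\<bar>k\<bar> \<le> int n" by auto
    then show ?thesis by (rule that(3))
  qed
qed

lemma ex_nearest:
  assumes "finite B" "B \<noteq> {}"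
  obtains j b where "j \<in> J" "b \<in> B" "nearest B i a j b"
proof -
  have "finite (J \<times> B)" "J \<times> B \<noteq> {}" using assms finite_J J_nonempty by auto
  from ex_arg_min[OF this, of "\<lambda>(j, b). gap i a j b"]
  obtain y where y: "y \<in> J \<times> B" "\<And>y'. y' \<in> J \<times> B \<Longrightarrow> (case y of (j, b) \<Rightarrow> gap i a j b) \<le>
      (case y' of (j, b) \<Rightarrow> gap i a j b)" by blast
  obtain j b where jb: "y = (j, b)" by (cases y)
  have "nearest B i a j b"
    unfolding nearest_def
  proof (intro ballI)
    fix j' b' assume "j' \<in> J" "b' \<in> B"
    then show "gap i a j b \<le> gap i a j' b'"
      using y(2)[of "(j', b')"] jb by simp
  qed
  then show ?thesis using y(1) jb that by blast
qed

definition same_loc where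
  "same_loc B i j b a a' \<longleftrightarrow> cosim m n (ev d i a - ev e j b) (ev d i a' - ev e j b) \<and>
     (\<forall>j'\<in>J. \<forall>b'\<in>B. \<forall>k. \<bar>k\<bar> \<le> int n \<longrightarrow>
        loc k (ev e j b) (ev e j' b') (ev d i a) = loc k (ev e j b) (ev e j' b') (ev d i a'))"

lemma same_locD:
  assumes sl: "same_loc B i j b a a'" and near: "nearest B i a j b" and jb: "j \<in> J" "b \<in> B"
    and jb': "j' \<in> J" "b' \<in> B"
  shows "gap i a j' b' = max (gap i a j b) (pabs (ev e j b - ev e j' b'))"
    and "gap i a' j' b' = max (gap i a' j b) (pabs (ev e j b - ev e j' b'))"
    and "cosim m n (ev d i a - ev e j' b') (ev d i a' - ev e j' b')"
    and "j2 \<in> J \<Longrightarrow> b2 \<in> B \<Longrightarrow> \<bar>k\<bar> \<le> int n \<Longrightarrow>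
      loc k (ev e j' b') (ev e j2 b2) (ev d i a) = loc k (ev e j' b') (ev e j2 b2) (ev d i a')"
proof -
  let ?T = "(\<lambda>(j, b). ev e j b) ` (J \<times> B)"
  have T: "ev e j b \<in> ?T" if "j \<in> J" "b \<in> B" for j b using that by force
  have nr: "gap i a j b \<le> pabs (ev d i a - s)" if "s \<in> ?T" for s
    using near that unfolding nearest_def by auto
  have cs: "cosim m n (ev d i a - ev e j b) (ev d i a' - ev e j b)"
    using sl unfolding same_loc_def by blast
  have thr: "loc k (ev e j b) s (ev d i a) = loc k (ev e j b) s (ev d i a')"
    if "s \<in> ?T" "\<bar>k\<bar> \<le> int n" for s k
    using sl that unfolding same_loc_def by auto
  note * = loc_determined[OF n m T[OF jb] nr cs thr T[OF jb']]
  show "gap i a j' b' = max (gap i a j b) (pabs (ev e j b - ev e j' b'))"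
    "gap i a' j' b' = max (gap i a' j b) (pabs (ev e j b - ev e j' b'))"
    "cosim m n (ev d i a - ev e j' b') (ev d i a' - ev e j' b')"
    using * by blast+
  assume "j2 \<in> J" "b2 \<in> B" "\<bar>k\<bar> \<le> int n"
  then show "loc k (ev e j' b') (ev e j2 b2) (ev d i a) = loc k (ev e j' b') (ev e j2 b2) (ev d i a')"
    using *(4) T by simp
qed

text \<open>\<open>same_loc\<close> at a nearest center settles all coset and location atoms, by
  \<open>loc_determined\<close>. Only the comparisons, which may link two different forms in
  \<open>I\<close>, have to be assumed.\<close>

lemma same_typeI:
  assumes loc: "\<And>i. i \<in> I \<Longrightarrow> \<exists>j\<in>J. \<exists>b\<in>B. nearest B i a j b \<and> same_loc B i j b a a'"
    and cmp: "\<And>i j i' j' b. i \<in> I \<Longrightarrow> j \<in> J \<Longrightarrow> i' \<in> I \<Longrightarrow> j' \<in> J \<Longrightarrow> b \<in> B \<Longrightarrow>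
      cmp_atom i j i' j' a b b = cmp_atom i j i' j' a' b b"
  shows "same_type B a a'"
  unfolding same_type_def
proof (intro ballI)
  fix \<chi> b b' assume \<chi>: "\<chi> \<in> atoms" and b: "b \<in> B" "b' \<in> B"
  from \<chi> show "\<chi> a b b' = \<chi> a' b b'"
  proof (cases \<chi> rule: atomsE)
    case (cmp i j i' j')
    then show ?thesis using assms(2)[OF cmp(2-5) b(1)] by (simp add: cmp_atom_def)
  next
    case (coset i j l)
    obtain j1 b1 where 1: "j1 \<in> J" "b1 \<in> B" "nearest B i a j1 b1" "same_loc B i j1 b1 a a'"
      using loc[OF coset(2)] by blast
    have cs: "cosim m n (ev d i a - ev e j b) (ev d i a' - ev e j b)"
      using same_locD(3)[OF 1(4,3,1,2) coset(3) b(1)] .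
    show ?thesis
      unfolding coset(1) coset_atom_def
      using cosim_trans[OF cs _ n] cosim_trans[OF cosim_sym[OF cs n] _ n] by metis
  next
    case (loc i j j' k)
    obtain j1 b1 where 1: "j1 \<in> J" "b1 \<in> B" "nearest B i a j1 b1" "same_loc B i j1 b1 a a'"
      using assms(1)[OF loc(2)] by blast
    show ?thesis
      unfolding loc(1) loc_atom_def
      using same_locD(4)[OF 1(4,3,1,2) loc(3) b(1) loc(4) b(2) loc(5)] .
  qed
qed

lemma cosim_if_coset_atoms:
  assumes "i \<in> I" "j \<in> J" "\<And>l. l \<in> \<Lambda> \<Longrightarrow> coset_atom i j l a b b = coset_atom i j l a' b b"
  shows "cosim m n (ev d i a - ev e j b) (ev d i a' - ev e j b)"
proof -
  obtain l where l: "l \<in> \<Lambda>" "cosim m n (ev d i a - ev e j b) l" using reps by blast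
  then have "cosim m n (ev d i a' - ev e j b) l" using assms(3)[OF l(1)] by (simp add: coset_atom_def)
  from cosim_trans[OF l(2) cosim_sym[OF this n] n] show ?thesis .
qed

text \<open>This is what exclusion formulas can certify: each hypothesis on atoms involves one
  \<open>b\<close> from \<open>B\<close> besides the parameters \<open>P\<close> of a cell. Having
  nearest centers over \<open>P\<close> bridges the gap to atoms with two arbitrary
  parameters.\<close>

lemma same_type_if_uncrossed:
  assumes P: "P \<subseteq> B" and near: "\<And>i. i \<in> I \<Longrightarrow> \<exists>j\<in>J. \<exists>p\<in>P. nearest B i a j p"
    and agree: "\<And>\<chi> p b. \<chi> \<in> atoms \<Longrightarrow> p \<in> P \<Longrightarrow> b \<in> B \<Longrightarrow> \<chi> a p b = \<chi> a' p b"
    and agree': "\<And>\<chi> b. \<chi> \<in> atoms \<Longrightarrow> b \<in> B \<Longrightarrow> \<chi> a b b = \<chi> a' b b"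
  shows "same_type B a a'"
proof (rule same_typeI)
  fix i assume i: "i \<in> I"
  obtain j p where jp: "j \<in> J" "p \<in> P" "nearest B i a j p" using near[OF i] by blast
  have p: "p \<in> B" using P jp(2) by blast
  have "same_loc B i j p a a'"
    unfolding same_loc_def
  proof (intro conjI ballI allI impI)
    show "cosim m n (ev d i a - ev e j p) (ev d i a' - ev e j p)"
      using agree[OF atomsI(2)[OF i jp(1)] jp(2) p] by (intro cosim_if_coset_atoms i jp(1))
    fix j' b' k assume "j' \<in> J" "b' \<in> B" "\<bar>k\<bar> \<le> int n"
    then show "loc k (ev e j p) (ev e j' b') (ev d i a) = loc k (ev e j p) (ev e j' b') (ev d i a')"
      using agree[OF atomsI(3)[OF i jp(1)] jp(2), of j' k b'] by (simp add: loc_atom_def)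
  qed
  then show "\<exists>j\<in>J. \<exists>b\<in>B. nearest B i a j b \<and> same_loc B i j b a a'" using jp p by blast
next
  fix i j i' j' b assume "i \<in> I" "j \<in> J" "i' \<in> I" "j' \<in> J" "b \<in> B"
  then show "cmp_atom i j i' j' a b b = cmp_atom i j i' j' a' b b" by (intro agree' atomsI)
qed

section \<open>Finite bases of types\<close>

definition agree_on where
  "agree_on S a a' \<longleftrightarrow> (\<forall>(\<chi>, b, b')\<in>S. \<chi> a b b' = \<chi> a' (b :: nat \<Rightarrow> 'p padic) (b' :: nat \<Rightarrow> 'p padic))"

lemma agree_onD: "agree_on S a a' \<Longrightarrow> (\<chi>, b, b') \<in> S \<Longrightarrow> \<chi> a b b' = \<chi> a' b b'"
  unfolding agree_on_def by auto

lemma agree_on_subset: "agree_on S a a' \<Longrightarrow> S' \<subseteq> S \<Longrightarrow> agree_on S' a a'"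
  unfolding agree_on_def by (rule ballI) (erule bspec, erule subsetD)

text \<open>\<open>card \<Lambda>\<close> atoms fix the coset. All centers and scales together give
  a single cut for the number \<open>gap i a j b\<close>, so 2 further atoms fix the location. The
  entry \<open>(\<chi>, b, b)\<close> keeps the parameter of the center visible in the
  basis.\<close>

lemma loc_basis:
  assumes B: "finite B" and i: "i \<in> I" and j: "j \<in> J" and b: "b \<in> B"
  shows "\<exists>S\<subseteq>atoms \<times> B \<times> B. card S \<le> card \<Lambda> + 2 \<and> (\<exists>\<chi>. (\<chi>, b, b) \<in> S) \<and>
    (\<forall>a'. agree_on S a a' \<longrightarrow> same_loc B i j b a a')"
proof -
  let ?X = "J \<times> B \<times> {- int n..int n}"
  let ?\<beta> = "\<lambda>(j', b', k). 2 powi k * pabs (ev e j b - ev e j' b')"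
  have "finite ?X" using finite_J B by simp
  from thresholds_le[OF this, of ?\<beta> "gap i a j b"]
  obtain U where U: "U \<subseteq> ?X \<and> card U \<le> 2 \<and> (\<forall>\<gamma>.
     (\<forall>x\<in>U. ?\<beta> x \<le> \<gamma> \<longleftrightarrow> ?\<beta> x \<le> gap i a j b) \<longrightarrow>
     (\<forall>x\<in>?X. ?\<beta> x \<le> \<gamma> \<longleftrightarrow> ?\<beta> x \<le> gap i a j b))"
    by (rule exE)
  define f where "f = (\<lambda>(j', b', k). (loc_atom i j j' k, b, b' :: nat \<Rightarrow> 'p padic))"
  define g where "g = (\<lambda>l. (coset_atom i j l, b, b))"
  have "finite U" using U \<open>finite ?X\<close> finite_subset by blast
  show ?thesis
  proof (intro exI[of _ "g ` \<Lambda> \<union> f ` U"] conjI allI impI)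
    have "g ` \<Lambda> \<subseteq> atoms \<times> B \<times> B" unfolding g_def using atomsI(2)[OF i j] b by auto
    moreover have "f ` U \<subseteq> atoms \<times> B \<times> B"
    proof
      fix y assume "y \<in> f ` U"
      then obtain j' b' k where "(j', b', k) \<in> U" "y = f (j', b', k)" by auto
      moreover from this(1) U have "(j', b', k) \<in> ?X" by blast
      ultimately show "y \<in> atoms \<times> B \<times> B" using atomsI(3)[OF i j] b by (auto simp: f_def abs_le_iff)
    qed
    ultimately show "g ` \<Lambda> \<union> f ` U \<subseteq> atoms \<times> B \<times> B" by simp
    have "card (g ` \<Lambda> \<union> f ` U) \<le> card (g ` \<Lambda>) + card (f ` U)" by (rule card_Un_le)
    also have "\<dots> \<le> card \<Lambda> + card U"
      using finite_\<Lambda> \<open>finite U\<close> by (intro add_mono card_image_le)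
    finally show "card (g ` \<Lambda> \<union> f ` U) \<le> card \<Lambda> + 2" using U by linarith
    obtain l where "l \<in> \<Lambda>" using reps by blast
    then show "\<exists>\<chi>. (\<chi>, b, b) \<in> g ` \<Lambda> \<union> f ` U" unfolding g_def by blast
  next
    fix a' assume ag: "agree_on (g ` \<Lambda> \<union> f ` U) a a'"
    have "coset_atom i j l a b b = coset_atom i j l a' b b" if "l \<in> \<Lambda>" for l
      using agree_onD[OF ag, of "coset_atom i j l" b b] that by (simp add: g_def)
    then have cs: "cosim m n (ev d i a - ev e j b) (ev d i a' - ev e j b)"
      by (rule cosim_if_coset_atoms[OF i j])
    have "?\<beta> x \<le> gap i a' j b \<longleftrightarrow> ?\<beta> x \<le> gap i a j b" if x: "x \<in> U" for x
    proof -
      obtain j' b' k where jbk: "x = (j', b', k)" by (cases x)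
      then have "(loc_atom i j j' k, b, b') \<in> f ` U" using x unfolding f_def by force
      then have "loc_atom i j j' k a b b' = loc_atom i j j' k a' b b'" using agree_onD[OF ag] by simp
      then show ?thesis by (simp add: jbk loc_atom_def loc_def)
    qed
    then have all: "\<forall>x\<in>?X. ?\<beta> x \<le> gap i a' j b \<longleftrightarrow> ?\<beta> x \<le> gap i a j b"
      using U by meson
    show "same_loc B i j b a a'"
      unfolding same_loc_def
    proof (intro conjI ballI allI impI cs)
      fix j' b' k assume "j' \<in> J" "b' \<in> B" "\<bar>k\<bar> \<le> int n"
      then have "(j', b', k) \<in> ?X" by auto
      from all[rule_format, OF this]
      show "loc k (ev e j b) (ev e j' b') (ev d i a) = loc k (ev e j b) (ev e j' b') (ev d i a')"
        by (simp add: loc_def)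
    qed
  qed
qed

text \<open>By \<open>same_locD\<close> each gap is the maximum of the distance to a nearest center
  and a distance between centers, which is the setting of \<open>thresholds_max\<close>.\<close>

lemma cmp_basis:
  assumes B: "finite B" and i: "i \<in> I" "i' \<in> I" and j: "j \<in> J" "j' \<in> J"
    and 1: "j1 \<in> J" "b1 \<in> B" "nearest B i a j1 b1" and 2: "j2 \<in> J" "b2 \<in> B" "nearest B i' a j2 b2"
  shows "\<exists>S\<subseteq>atoms \<times> B \<times> B. card S \<le> 5 \<and>
    (\<forall>a'. same_loc B i j1 b1 a a' \<longrightarrow> same_loc B i' j2 b2 a a' \<longrightarrow> agree_on S a a' \<longrightarrow>
      (\<forall>b\<in>B. cmp_atom i j i' j' a b b = cmp_atom i j i' j' a' b b))"
proof -
  let ?\<alpha> = "\<lambda>b. pabs (ev e j1 b1 - ev e j b)" and ?\<beta> = "\<lambda>b. pabs (ev e j2 b2 - ev e j' b)"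
  let ?u = "\<lambda>a. gap i a j1 b1" and ?v = "\<lambda>a. gap i' a j2 b2"
  let ?P = "\<lambda>b \<gamma> \<gamma>'. max \<gamma> (?\<alpha> b) \<le> max \<gamma>' (?\<beta> b)"
  from thresholds_max[OF B, of ?\<alpha> "?u a" ?\<beta> "?v a"]
  obtain S where S: "S \<subseteq> B \<and> card S \<le> 5 \<and>
    (\<forall>\<gamma> \<gamma>'. (\<forall>b\<in>B. ?\<alpha> b \<le> \<gamma> \<longleftrightarrow> ?\<alpha> b \<le> ?u a) \<longrightarrow> (\<forall>b\<in>B. ?\<beta> b \<le> \<gamma>' \<longleftrightarrow> ?\<beta> b \<le> ?v a) \<longrightarrow>
      (\<forall>b\<in>S. ?P b \<gamma> \<gamma>' \<longleftrightarrow> ?P b (?u a) (?v a)) \<longrightarrow> (\<forall>b\<in>B. ?P b \<gamma> \<gamma>' \<longleftrightarrow> ?P b (?u a) (?v a)))"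
    by (rule exE)
  have "finite S" using S B finite_subset by blast
  define f where "f = (\<lambda>b :: nat \<Rightarrow> 'p padic. (cmp_atom i j i' j', b, b))"
  show ?thesis
  proof (intro exI[of _ "f ` S"] conjI allI impI)
    show "f ` S \<subseteq> atoms \<times> B \<times> B" unfolding f_def using S atomsI(1)[OF i(1) j(1) i(2) j(2)] by auto
    show "card (f ` S) \<le> 5" using card_image_le[OF \<open>finite S\<close>, of f] S by linarith
  next
    fix a' assume sl: "same_loc B i j1 b1 a a'" "same_loc B i' j2 b2 a a'" and ag: "agree_on (f ` S) a a'"
    have P: "cmp_atom i j i' j' a b b \<longleftrightarrow> ?P b (?u a) (?v a)" "cmp_atom i j i' j' a' b b \<longleftrightarrow> ?P b (?u a') (?v a')"
      if b: "b \<in> B" for b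
      unfolding cmp_atom_def
      using same_locD(1,2)[OF sl(1) 1(3,1,2) j(1) b] same_locD(1,2)[OF sl(2) 2(3,1,2) j(2) b] by simp_all
    have 3: "\<forall>b\<in>B. ?\<alpha> b \<le> ?u a' \<longleftrightarrow> ?\<alpha> b \<le> ?u a"
    proof
      fix b assume "b \<in> B"
      then have "loc 0 (ev e j1 b1) (ev e j b) (ev d i a) = loc 0 (ev e j1 b1) (ev e j b) (ev d i a')"
        using sl(1) j(1) unfolding same_loc_def by simp
      then show "?\<alpha> b \<le> ?u a' \<longleftrightarrow> ?\<alpha> b \<le> ?u a" by (simp add: loc_def)
    qed
    have 4: "\<forall>b\<in>B. ?\<beta> b \<le> ?v a' \<longleftrightarrow> ?\<beta> b \<le> ?v a"
    proof
      fix b assume "b \<in> B"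
      then have "loc 0 (ev e j2 b2) (ev e j' b) (ev d i' a) = loc 0 (ev e j2 b2) (ev e j' b) (ev d i' a')"
        using sl(2) j(2) unfolding same_loc_def by simp
      then show "?\<beta> b \<le> ?v a' \<longleftrightarrow> ?\<beta> b \<le> ?v a" by (simp add: loc_def)
    qed
    have 5: "\<forall>b\<in>S. ?P b (?u a') (?v a') \<longleftrightarrow> ?P b (?u a) (?v a)"
    proof
      fix b assume b: "b \<in> S"
      then have bB: "b \<in> B" using S by blast
      have "cmp_atom i j i' j' a b b = cmp_atom i j i' j' a' b b"
        using agree_onD[OF ag, of "cmp_atom i j i' j'" b b] b by (simp add: f_def)
      then show "?P b (?u a') (?v a') \<longleftrightarrow> ?P b (?u a) (?v a)" using P[OF bB] by simp
    qed
    have "\<forall>b\<in>B. ?P b (?u a') (?v a') \<longleftrightarrow> ?P b (?u a) (?v a)"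
      using S[THEN conjunct2, THEN conjunct2, THEN spec, THEN spec, THEN mp, THEN mp, THEN mp, OF 3 4 5] .
    then show "\<forall>b\<in>B. cmp_atom i j i' j' a b b = cmp_atom i j i' j' a' b b" using P by simp
  qed
qed

definition basis_bound :: nat where
  "basis_bound = card I * (card \<Lambda> + 2) + card (I \<times> J \<times> I \<times> J) * 5"

lemma card_UN_le_bound:
  assumes "finite A" "\<And>x. x \<in> A \<Longrightarrow> card (f x) \<le> k"
  shows "card (\<Union>x\<in>A. f x) \<le> card A * k"
proof -
  have "card (\<Union>x\<in>A. f x) \<le> (\<Sum>x\<in>A. card (f x))" by (rule card_UN_le[OF assms(1)])
  also have "\<dots> \<le> card A * k" using sum_bounded_above[of A "\<lambda>x. card (f x)" k] assms(2) by simp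
  finally show ?thesis .
qed

text \<open>Besides fixing the type, the basis has to contain parameters of nearest centers, or the
  cell built from it could be excluded.\<close>

lemma type_basis:
  assumes B: "finite B" "B \<noteq> {}"
  shows "\<exists>S\<subseteq>atoms \<times> B \<times> B. card S \<le> basis_bound \<and>
    (\<forall>i\<in>I. \<exists>j\<in>J. \<exists>\<chi> p. (\<chi>, p, p) \<in> S \<and> nearest B i a j p) \<and>
    (\<forall>a'. agree_on S a a' \<longrightarrow> same_type B a a')"
proof -
  define Q0 where "Q0 i y \<longleftrightarrow> fst y \<in> J \<and> snd y \<in> B \<and> nearest B i a (fst y) (snd y)" for i y
  have "\<exists>y. Q0 i y" for i
  proof -
    obtain j b where "j \<in> J" "b \<in> B" "nearest B i a j b" using ex_nearest[OF B] by blast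
    then have "Q0 i (j, b)" by (simp add: Q0_def)
    then show ?thesis by (rule exI)
  qed
  then have "\<forall>i. \<exists>y. Q0 i y" by (rule allI)
  from choice[OF this] obtain y where Q0: "\<forall>i. Q0 i (y i)" by (rule exE)
  have y: "fst (y i) \<in> J" "snd (y i) \<in> B" "nearest B i a (fst (y i)) (snd (y i))" for i
    using Q0[THEN spec, of i] by (simp_all add: Q0_def)
  define Q1 where "Q1 i S \<longleftrightarrow> S \<subseteq> atoms \<times> B \<times> B \<and> card S \<le> card \<Lambda> + 2 \<and> (\<exists>\<chi>. (\<chi>, snd (y i), snd (y i)) \<in> S) \<and>
    (\<forall>a'. agree_on S a a' \<longrightarrow> same_loc B i (fst (y i)) (snd (y i)) a a')" for i S
  have "\<forall>i\<in>I. \<exists>S. Q1 i S" unfolding Q1_def by (rule ballI, rule loc_basis[OF B(1) _ y(1,2)])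
  from bchoice[OF this] obtain S1 where Q1: "\<forall>i\<in>I. Q1 i (S1 i)" by (rule exE)
  have S1: "S1 i \<subseteq> atoms \<times> B \<times> B" "card (S1 i) \<le> card \<Lambda> + 2" "\<exists>\<chi>. (\<chi>, snd (y i), snd (y i)) \<in> S1 i"
    "agree_on (S1 i) a a' \<Longrightarrow> same_loc B i (fst (y i)) (snd (y i)) a a'" if "i \<in> I" for i a'
    using Q1[THEN bspec, OF that] by (simp_all add: Q1_def)
  define Q2 where "Q2 q S \<longleftrightarrow> (case q of (i, j, i', j') \<Rightarrow> S \<subseteq> atoms \<times> B \<times> B \<and> card S \<le> 5 \<and>
    (\<forall>a'. same_loc B i (fst (y i)) (snd (y i)) a a' \<longrightarrow> same_loc B i' (fst (y i')) (snd (y i')) a a' \<longrightarrow>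
      agree_on S a a' \<longrightarrow> (\<forall>b\<in>B. cmp_atom i j i' j' a b b = cmp_atom i j i' j' a' b b)))" for q S
  have "\<forall>q\<in>I \<times> J \<times> I \<times> J. \<exists>S. Q2 q S"
  proof
    fix q assume "q \<in> I \<times> J \<times> I \<times> J"
    then obtain i j i' j' where q: "q = (i, j, i', j')" "i \<in> I" "j \<in> J" "i' \<in> I" "j' \<in> J" by auto
    show "\<exists>S. Q2 q S" unfolding Q2_def q(1) prod.case by (rule cmp_basis[OF B(1) q(2,4,3,5) y y])
  qed
  from bchoice[OF this] obtain S2 where Q2: "\<forall>q\<in>I \<times> J \<times> I \<times> J. Q2 q (S2 q)" by (rule exE)
  have S2': "S2 (i, j, i', j') \<subseteq> atoms \<times> B \<times> B" "card (S2 (i, j, i', j')) \<le> 5"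
    "same_loc B i (fst (y i)) (snd (y i)) a a' \<Longrightarrow> same_loc B i' (fst (y i')) (snd (y i')) a a' \<Longrightarrow>
      agree_on (S2 (i, j, i', j')) a a' \<Longrightarrow> b \<in> B \<Longrightarrow> cmp_atom i j i' j' a b b = cmp_atom i j i' j' a' b b"
    if "i \<in> I" "j \<in> J" "i' \<in> I" "j' \<in> J" for i j i' j' a' b
    using Q2[THEN bspec, of "(i, j, i', j')"] that by (simp_all add: Q2_def)
  let ?S1 = "\<Union>i\<in>I. S1 i" and ?S2 = "\<Union>q\<in>I \<times> J \<times> I \<times> J. S2 q"
  show ?thesis
  proof (intro exI[of _ "?S1 \<union> ?S2"] conjI ballI allI impI)
    show "?S1 \<union> ?S2 \<subseteq> atoms \<times> B \<times> B" using S1(1) S2'(1) by fast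
    have "card (?S1 \<union> ?S2) \<le> card ?S1 + card ?S2" by (rule card_Un_le)
    moreover have "card ?S1 \<le> card I * (card \<Lambda> + 2)"
      using finite_I S1(2) by (rule card_UN_le_bound)
    moreover have "card ?S2 \<le> card (I \<times> J \<times> I \<times> J) * 5"
      using finite_I finite_J S2'(2) by (intro card_UN_le_bound) auto
    ultimately show "card (?S1 \<union> ?S2) \<le> basis_bound" unfolding basis_bound_def by linarith
  next
    fix i assume i: "i \<in> I"
    then obtain \<chi> where "(\<chi>, snd (y i), snd (y i)) \<in> S1 i" using S1(3) by blast
    then have "(\<chi>, snd (y i), snd (y i)) \<in> ?S1 \<union> ?S2" using i by blast
    then show "\<exists>j\<in>J. \<exists>\<chi> p. (\<chi>, p, p) \<in> ?S1 \<union> ?S2 \<and> nearest B i a j p"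
      using y[of i] by (intro bexI[of _ "fst (y i)"] exI[of _ \<chi>] exI[of _ "snd (y i)"] conjI)
  next
    fix a' assume ag: "agree_on (?S1 \<union> ?S2) a a'"
    have ag1: "agree_on (S1 i) a a'" if "i \<in> I" for i
      by (rule agree_on_subset[OF ag]) (use that in blast)
    have ag2: "agree_on (S2 (i, j, i', j')) a a'" if "i \<in> I" "j \<in> J" "i' \<in> I" "j' \<in> J" for i j i' j'
      by (rule agree_on_subset[OF ag]) (use that in blast)
    show "same_type B a a'"
    proof (rule same_typeI)
      show "\<exists>j\<in>J. \<exists>b\<in>B. nearest B i a j b \<and> same_loc B i j b a a'" if "i \<in> I" for i
        using S1(4)[OF that ag1[OF that]] by (intro bexI[of _ "fst (y i)"] bexI[of _ "snd (y i)"] conjI y)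
      show "cmp_atom i j i' j' a b b = cmp_atom i j i' j' a' b b"
        if "i \<in> I" "j \<in> J" "i' \<in> I" "j' \<in> J" "b \<in> B" for i j i' j' b
        using S2'(3)[OF that(1-4) S1(4)[OF that(1) ag1[OF that(1)]] S1(4)[OF that(3) ag1[OF that(3)]]
            ag2[OF that(1-4)] that(5)] .
    qed
  qed
qed

section \<open>Counting types\<close>

lemma affine_fun_ev: "affine_fun d (\<lambda>a. ev d i a - c)"
  unfolding affine_fun_def ev_def by (rule exI[of _ i], rule exI[of _ "- c"]) simp

text \<open>Per element of B there is one comparison for each element of I x J x I x J. For each
  form in \<open>I\<close> there are 2n + 1 scales on at most 2 |J| |B| pairs of centers. The last 1
  absorbs the + 1 of the polynomial method.\<close>

definition comparison_bound :: nat where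
  "comparison_bound = card (I \<times> J \<times> I \<times> J) + 2 * card I * card J * (2 * n + 1) + 1"

lemma index_bound:
  fixes x y z b r q :: nat
  assumes "r \<le> 2 * (z * b)" "1 \<le> b"
  shows "x * b + y * (r * q) + 1 \<le> (x + 2 * y * z * q + 1) * b"
proof -
  have "y * (r * q) \<le> y * (2 * (z * b) * q)" using assms(1) by (intro mult_left_mono mult_right_mono) auto
  also have "\<dots> = 2 * y * z * q * b" by (simp only: ac_simps)
  finally show ?thesis using assms(2) by (simp only: distrib_right mult_1_left add_mono)
qed

theorem card_types:
  assumes B: "finite B" "B \<noteq> {}" and R: "finite R"
    and distinct: "\<And>a a'. a \<in> R \<Longrightarrow> a' \<in> R \<Longrightarrow> a \<noteq> a' \<Longrightarrow> \<not> same_type B a a'"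
  shows "card R \<le> (comparison_bound * card B) ^ d * card \<Lambda> ^ card I"
proof -
  define T where "T = (\<lambda>(j, b). ev e j b) ` (J \<times> B)"
  have T: "ev e j b \<in> T" if "j \<in> J" "b \<in> B" for j b using that unfolding T_def by force
  have finT: "finite T" using B(1) finite_J by (simp add: T_def)
  have "card T \<le> card (J \<times> B)" unfolding T_def using B(1) finite_J by (intro card_image_le) simp
  then have cT: "card T \<le> card J * card B" by (simp add: card_cartesian_product)
  from loc_linear[OF finT, of n] obtain E where E: "E \<subseteq> T \<times> T \<and> card E \<le> 2 * card T \<and>
    (\<forall>x x'. same_position n E x x' \<longrightarrow> same_position n {(t, s) \<in> T \<times> T. t \<noteq> s} x x')"
    by (rule exE)
  have finE: "finite E" using finT by (intro finite_subset[OF E[THEN conjunct1]]) simp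
  \<comment> \<open>Location tests are included only for the pairs in \<open>E\<close>, to keep the
    number linear in |B|. The scale k becomes the scalar p^(-k), whose absolute value is
    2^k.\<close>
  define \<Omega> where "\<Omega> = ((I \<times> J \<times> I \<times> J) \<times> B) <+> (I \<times> E \<times> {- int n..int n})"
  define f where "f \<omega> = (\<lambda>a. case \<omega> of Inl ((i, j, i', j'), b) \<Rightarrow> ev d i a - ev e j b
    | Inr (i, (t, s), k) \<Rightarrow> prime_elt powi (- k) * (t - s))"
    for \<omega> :: "((nat \<Rightarrow> 'p padic) \<times> (nat \<Rightarrow> 'p padic) \<times> (nat \<Rightarrow> 'p padic) \<times> (nat \<Rightarrow> 'p padic)) \<times> (nat \<Rightarrow> 'p padic)
      + (nat \<Rightarrow> 'p padic) \<times> ('p padic \<times> 'p padic) \<times> int"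
  define g where "g \<omega> = (\<lambda>a. case \<omega> of Inl ((i, j, i', j'), b) \<Rightarrow> ev d i' a - ev e j' b
    | Inr (i, (t, s), k) \<Rightarrow> ev d i a - t)"
    for \<omega> :: "((nat \<Rightarrow> 'p padic) \<times> (nat \<Rightarrow> 'p padic) \<times> (nat \<Rightarrow> 'p padic) \<times> (nat \<Rightarrow> 'p padic)) \<times> (nat \<Rightarrow> 'p padic)
      + (nat \<Rightarrow> 'p padic) \<times> ('p padic \<times> 'p padic) \<times> int"
  have fin\<Omega>: "finite \<Omega>" unfolding \<Omega>_def using finite_I finite_J B(1) finE by simp
  have aff: "affine_fun d (f \<omega>) \<and> affine_fun d (g \<omega>)" for \<omega>
  proof (cases \<omega>)
    case (Inl x)
    obtain q b where x: "x = (q, b)" by (cases x)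
    obtain i j i' j' where "q = (i, j, i', j')" by (cases q rule: prod_cases4)
    with x show ?thesis unfolding f_def g_def Inl by (simp add: affine_fun_ev)
  next
    case (Inr x)
    obtain i r k where x: "x = (i, r, k)" by (cases x rule: prod_cases3)
    obtain t s where "r = (t, s)" by (cases r)
    with x show ?thesis unfolding f_def g_def Inr by (simp add: affine_fun_ev affine_fun_const)
  qed
  have "card \<Omega> = card ((I \<times> J \<times> I \<times> J) \<times> B) + card (I \<times> E \<times> {- int n..int n})"
    unfolding \<Omega>_def using finite_I finite_J B(1) finE by (intro card_Plus) simp_all
  also have "card ((I \<times> J \<times> I \<times> J) \<times> B) = card (I \<times> J \<times> I \<times> J) * card B"
    by (rule card_cartesian_product)
  also have "card (I \<times> E \<times> {- int n..int n}) = card I * (card E * (2 * n + 1))"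
    unfolding card_cartesian_product using nat_int[of "2 * n + 1"] by (simp add: nat_add_distrib nat_mult_distrib)
  finally have "card \<Omega> = card (I \<times> J \<times> I \<times> J) * card B + card I * (card E * (2 * n + 1))" .
  moreover have "card E \<le> 2 * (card J * card B)" using E[THEN conjunct2, THEN conjunct1] cT by linarith
  moreover have "1 \<le> card B" using B by (simp add: Suc_leI card_gt_0_iff)
  ultimately have c\<Omega>': "card \<Omega> + 1 \<le> comparison_bound * card B"
    unfolding comparison_bound_def by (simp only: index_bound)
  define pat where "pat a = {\<omega>\<in>\<Omega>. pabs (f \<omega> a) \<le> pabs (g \<omega> a)}" for a
  have pat: "pabs (f \<omega> a) \<le> pabs (g \<omega> a) \<longleftrightarrow> pabs (f \<omega> a') \<le> pabs (g \<omega> a')"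
    if "pat a = pat a'" "\<omega> \<in> \<Omega>" for a a' \<omega>
    using that unfolding pat_def by blast
  \<comment> \<open>The polynomial method needs distinct patterns, so one point per pattern is kept.
    Points with equal patterns will be separated by their coset labels.\<close>
  have "\<exists>R'\<subseteq>R. inj_on pat R' \<and> pat ` R = pat ` R'"
    using subset_image_inj[of "pat ` R" pat R] by auto
  then obtain R' where R': "R' \<subseteq> R" "inj_on pat R'" "pat ` R = pat ` R'" by blast
  have "card R' \<le> (card \<Omega> + 1) ^ d"
  proof (rule card_comparison_patterns[OF _ fin\<Omega>])
    show "finite R'" using R R'(1) finite_subset by blast
    show "affine_fun d (f \<omega>) \<and> affine_fun d (g \<omega>)" for \<omega> by (rule aff)
    fix a a' assume "a \<in> R'" "a' \<in> R'" "a \<noteq> a'"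
    then have "pat a \<noteq> pat a'" using R'(2) by (meson inj_onD)
    then show "\<exists>\<omega>\<in>\<Omega>. (pabs (f \<omega> a) \<le> pabs (g \<omega> a)) \<noteq> (pabs (f \<omega> a') \<le> pabs (g \<omega> a'))"
      unfolding pat_def by blast
  qed
  also have "\<dots> \<le> (comparison_bound * card B) ^ d" using c\<Omega>' by (rule power_mono) simp
  finally have cpat: "card (pat ` R) \<le> (comparison_bound * card B) ^ d"
    unfolding R'(3) card_image[OF R'(2)] .
  have loc_eq: "loc k t s (ev d i a) = loc k t s (ev d i a')"
    if "pat a = pat a'" "i \<in> I" "t \<in> T" "s \<in> T" "\<bar>k\<bar> \<le> int n" for a a' i t s k
  proof (cases "t = s")
    case False
    have "same_position n E (ev d i a) (ev d i a')"
    proof (clarify)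
      fix t s k assume ts: "(t, s) \<in> E" and k: "\<bar>k\<bar> \<le> int n"
      have "Inr (i, (t, s), k) \<in> \<Omega>" unfolding \<Omega>_def using that(2) ts k by auto
      from pat[OF that(1) this]
      show "loc k t s (ev d i a) = loc k t s (ev d i a')" by (simp add: f_def g_def loc_def)
    qed
    from E[THEN conjunct2, THEN conjunct2, THEN spec, THEN spec, THEN mp, OF this, THEN bspec, of "(t, s)"]
    show ?thesis using that(3-5) False by simp
  qed (simp add: loc_def)
  define near where "near i a t \<longleftrightarrow> t \<in> T \<and> (\<forall>s\<in>T. pabs (ev d i a - t) \<le> pabs (ev d i a - s))" for i a t
  \<comment> \<open>The choice depends only on the predicate \<open>near i a\<close>, so points with
    the same nearest centers get the same \<open>ctr\<close> and their labels can be
    compared.\<close>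
  define ctr where "ctr i a = (SOME t. near i a t)" for i a
  define lab where "lab a = (\<lambda>i\<in>I. SOME l. l \<in> \<Lambda> \<and> cosim m n (ev d i a - ctr i a) l)" for a
  have "\<exists>t. near i a t" for i a
  proof -
    obtain j b where jb: "j \<in> J" "b \<in> B" "nearest B i a j b" using ex_nearest[OF B] by blast
    have "gap i a j b \<le> pabs (ev d i a - s)" if "s \<in> T" for s
      using jb(3) that unfolding nearest_def T_def by auto
    then show ?thesis unfolding near_def using T[OF jb(1,2)] by blast
  qed
  then have ctr: "near i a (ctr i a)" for i a unfolding ctr_def by (rule someI_ex)
  have lab: "lab a i \<in> \<Lambda>" "cosim m n (ev d i a - ctr i a) (lab a i)" if "i \<in> I" for a i
  proof -
    have "\<exists>l. l \<in> \<Lambda> \<and> cosim m n (ev d i a - ctr i a) l" using reps by blast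
    from someI_ex[OF this] show "lab a i \<in> \<Lambda>" "cosim m n (ev d i a - ctr i a) (lab a i)"
      using that by (simp_all add: lab_def)
  qed
  have "inj_on (\<lambda>a. (pat a, lab a)) R"
  proof (rule inj_onI, rule ccontr)
    fix a a' assume a: "a \<in> R" "a' \<in> R" "a \<noteq> a'" and eq: "(pat a, lab a) = (pat a', lab a')"
    from eq have pe: "pat a = pat a'" and le: "lab a = lab a'" by simp_all
    have near_imp: "near i a' t" if "i \<in> I" "near i a t" "pat a = pat a'" for i t a a'
    proof -
      have t: "t \<in> T" "\<And>s. s \<in> T \<Longrightarrow> pabs (ev d i a - t) \<le> pabs (ev d i a - s)"
        using that(2) by (simp_all add: near_def)
      have "loc 0 r s (ev d i a) = loc 0 r s (ev d i a')" if "s \<in> T" "r \<in> T" for s r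
        by (rule loc_eq[OF \<open>pat a = pat a'\<close> \<open>i \<in> I\<close> that(2,1)]) simp
      from nearest_transfer[OF t(2,1) _ this]
      have "pabs (ev d i a' - t) \<le> pabs (ev d i a' - s)" if "s \<in> T" for s using that by simp
      then show ?thesis using t(1) by (simp add: near_def)
    qed
    have ctr_eq: "ctr i a = ctr i a'" if "i \<in> I" for i
    proof -
      have "near i a t = near i a' t" for t
        using near_imp[OF that _ pe, of t] near_imp[OF that _ pe[symmetric], of t] by (rule iffI)
      then show ?thesis by (simp add: ctr_def)
    qed
    have "same_type B a a'"
    proof (rule same_typeI)
      fix i assume i: "i \<in> I"
      obtain j b where jb: "j \<in> J" "b \<in> B" "ctr i a = ev e j b"
        using ctr[of i a] unfolding near_def T_def by auto
      have nr: "nearest B i a j b"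
        unfolding nearest_def
      proof (intro ballI)
        fix j' b' assume "j' \<in> J" "b' \<in> B"
        from T[OF this] show "gap i a j b \<le> gap i a j' b'"
          using ctr[of i a] unfolding near_def jb(3) by simp
      qed
      have "cosim m n (ev d i a - ev e j b) (ev d i a' - ev e j b)"
        using cosim_trans[OF lab(2)[OF i, of a] cosim_sym[OF lab(2)[OF i, of a', folded le] n] n] 
        unfolding ctr_eq[OF i, symmetric] jb(3) .
      moreover have "loc k (ev e j b) (ev e j' b') (ev d i a) = loc k (ev e j b) (ev e j' b') (ev d i a')"
        if "j' \<in> J" "b' \<in> B" "\<bar>k\<bar> \<le> int n" for j' b' k
        by (rule loc_eq[OF pe i T[OF jb(1,2)] T[OF that(1,2)] that(3)])
      ultimately have "same_loc B i j b a a'" unfolding same_loc_def by simp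
      then show "\<exists>j\<in>J. \<exists>b\<in>B. nearest B i a j b \<and> same_loc B i j b a a'"
        using jb(1,2) nr by (intro bexI[of _ j] bexI[of _ b] conjI)
    next
      fix i j i' j' b assume h: "i \<in> I" "j \<in> J" "i' \<in> I" "j' \<in> J" "b \<in> B"
      then have "Inl ((i, j, i', j'), b) \<in> \<Omega>" by (auto simp: \<Omega>_def)
      from pat[OF pe this] show "cmp_atom i j i' j' a b b = cmp_atom i j i' j' a' b b"
        by (simp add: f_def g_def cmp_atom_def)
    qed
    then show False using distinct[OF a] by simp
  qed
  then have "card R = card ((\<lambda>a. (pat a, lab a)) ` R)" by (rule card_image[symmetric])
  also have "\<dots> \<le> card (pat ` R \<times> PiE I (\<lambda>_. \<Lambda>))"
  proof (rule card_mono)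
    show "finite (pat ` R \<times> PiE I (\<lambda>_. \<Lambda>))" using R finite_I finite_\<Lambda> by (simp add: finite_PiE)
    have "lab a \<in> PiE I (\<lambda>_. \<Lambda>)" for a using lab(1)[of _ a] by (auto simp: lab_def PiE_iff)
    then show "(\<lambda>a. (pat a, lab a)) ` R \<subseteq> pat ` R \<times> PiE I (\<lambda>_. \<Lambda>)" by auto
  qed
  also have "\<dots> = card (pat ` R) * card \<Lambda> ^ card I"
    using finite_I by (simp add: card_cartesian_product card_PiE)
  also have "\<dots> \<le> (comparison_bound * card B) ^ d * card \<Lambda> ^ card I"
    using cpat by (rule mult_right_mono) simp
  finally show ?thesis .
qed

end

section \<open>Definable relations\<close>

definition term_definable :: "nat set \<Rightarrow> ((nat \<Rightarrow> 'p::prime_card padic) \<Rightarrow> 'p padic) \<Rightarrow> bool" where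
  "term_definable S f \<longleftrightarrow> (\<exists>t. wf_tm aff_language t \<and> vars_tm t \<subseteq> S \<and> (\<forall>\<sigma>. eval_tm padic_struct \<sigma> t = f \<sigma>))"

text \<open>Definability up to semantic equivalence lets closure rules build the formulas instead of
  explicit syntax.\<close>

definition fm_definable :: "nat set \<Rightarrow> ((nat \<Rightarrow> 'p::prime_card padic) \<Rightarrow> bool) \<Rightarrow> bool" where
  "fm_definable S R \<longleftrightarrow> (\<exists>\<phi>. wf_fm aff_language \<phi> \<and> free_vars \<phi> \<subseteq> S \<and> (\<forall>\<sigma>. sat padic_struct \<sigma> \<phi> \<longleftrightarrow> R \<sigma>))"

lemma term_definableE:
  assumes "term_definable S f"
  obtains t where "wf_tm aff_language t" "vars_tm t \<subseteq> S" "\<And>\<sigma>. eval_tm padic_struct \<sigma> t = f \<sigma>"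
  using assms unfolding term_definable_def by (elim exE conjE) simp

lemma term_definable_var: "i \<in> S \<Longrightarrow> term_definable S (\<lambda>\<sigma>. \<sigma> i)"
  unfolding term_definable_def by (rule exI[of _ "Var i"]) simp

lemma term_definable_0: "term_definable S (\<lambda>\<sigma>. 0)"
  unfolding term_definable_def
  by (rule exI[of _ "Fn Zero_sym []"]) (simp add: aff_language_def padic_struct_def)

lemma term_definable_scale:
  assumes "term_definable S f"
  shows "term_definable S (\<lambda>\<sigma>. c * f \<sigma>)"
proof -
  obtain t where "wf_tm aff_language t" "vars_tm t \<subseteq> S" "\<And>\<sigma>. eval_tm padic_struct \<sigma> t = f \<sigma>"
    using assms by (rule term_definableE) simp
  then show ?thesis
    unfolding term_definable_def
    by (intro exI[of _ "Fn (Scalar_sym c) [t]"]) (simp add: aff_language_def padic_struct_def)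
qed

lemma term_definable_add:
  assumes "term_definable S f" "term_definable S g"
  shows "term_definable S (\<lambda>\<sigma>. f \<sigma> + g \<sigma>)"
proof -
  obtain t where "wf_tm aff_language t" "vars_tm t \<subseteq> S" "\<And>\<sigma>. eval_tm padic_struct \<sigma> t = f \<sigma>"
    using assms(1) by (rule term_definableE) simp
  moreover obtain s where "wf_tm aff_language s" "vars_tm s \<subseteq> S" "\<And>\<sigma>. eval_tm padic_struct \<sigma> s = g \<sigma>"
    using assms(2) by (rule term_definableE) simp
  ultimately show ?thesis
    unfolding term_definable_def
    by (intro exI[of _ "Fn Plus_sym [t, s]"]) (simp add: aff_language_def padic_struct_def)
qed

lemma term_definable_diff:
  assumes "term_definable S f" "term_definable S g"
  shows "term_definable S (\<lambda>\<sigma>. f \<sigma> - g \<sigma>)"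
  using term_definable_add[OF assms(1) term_definable_scale[OF assms(2), of "- 1"]] by simp

lemma term_definable_sum:
  assumes "finite A" "\<And>x. x \<in> A \<Longrightarrow> term_definable S (f x)"
  shows "term_definable S (\<lambda>\<sigma>. \<Sum>x\<in>A. f x \<sigma>)"
  using assms
proof (induction A)
  case (insert x A)
  have "term_definable S (\<lambda>\<sigma>. f x \<sigma> + (\<Sum>x\<in>A. f x \<sigma>))"
    using insert by (intro term_definable_add) simp_all
  then show ?case using insert.hyps by simp
qed (simp add: term_definable_0)

lemma fm_definableE:
  assumes "fm_definable S R"
  obtains \<phi> where "wf_fm aff_language \<phi>" "free_vars \<phi> \<subseteq> S" "\<And>\<sigma>. sat padic_struct \<sigma> \<phi> \<longleftrightarrow> R \<sigma>"
  using assms unfolding fm_definable_def by (elim exE conjE) simp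

lemma fm_definable_neg:
  assumes "fm_definable S R"
  shows "fm_definable S (\<lambda>\<sigma>. \<not> R \<sigma>)"
proof -
  obtain \<phi> where "wf_fm aff_language \<phi>" "free_vars \<phi> \<subseteq> S" "\<And>\<sigma>. sat padic_struct \<sigma> \<phi> \<longleftrightarrow> R \<sigma>"
    using assms by (rule fm_definableE) simp
  then show ?thesis unfolding fm_definable_def by (intro exI[of _ "Neg \<phi>"]) simp
qed

lemma fm_definable_conj:
  assumes "fm_definable S R" "fm_definable S Q"
  shows "fm_definable S (\<lambda>\<sigma>. R \<sigma> \<and> Q \<sigma>)"
proof -
  obtain \<phi> where "wf_fm aff_language \<phi>" "free_vars \<phi> \<subseteq> S" "\<And>\<sigma>. sat padic_struct \<sigma> \<phi> \<longleftrightarrow> R \<sigma>"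
    using assms(1) by (rule fm_definableE) simp
  moreover obtain \<psi> where "wf_fm aff_language \<psi>" "free_vars \<psi> \<subseteq> S" "\<And>\<sigma>. sat padic_struct \<sigma> \<psi> \<longleftrightarrow> Q \<sigma>"
    using assms(2) by (rule fm_definableE) simp
  ultimately show ?thesis unfolding fm_definable_def by (intro exI[of _ "Conj \<phi> \<psi>"]) simp
qed

lemma fm_definable_disj:
  assumes "fm_definable S R" "fm_definable S Q"
  shows "fm_definable S (\<lambda>\<sigma>. R \<sigma> \<or> Q \<sigma>)"
  using fm_definable_neg[OF fm_definable_conj[OF fm_definable_neg[OF assms(1)] fm_definable_neg[OF assms(2)]]]
  by simp

lemma fm_definable_eq0:
  assumes "term_definable S f"
  shows "fm_definable S (\<lambda>\<sigma>. f \<sigma> = 0)"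
proof -
  obtain t where "wf_tm aff_language t" "vars_tm t \<subseteq> S" "\<And>\<sigma>. eval_tm padic_struct \<sigma> t = f \<sigma>"
    using assms by (rule term_definableE) simp
  then show ?thesis
    unfolding fm_definable_def
    by (intro exI[of _ "Eq t (Fn Zero_sym [])"]) (simp add: aff_language_def padic_struct_def)
qed

lemma fm_definable_True: "fm_definable S (\<lambda>_ :: nat \<Rightarrow> 'p::prime_card padic. True)"
  using fm_definable_eq0[OF term_definable_0] by simp

lemma fm_definable_iff:
  assumes "fm_definable S R" "fm_definable S Q"
  shows "fm_definable S (\<lambda>\<sigma>. R \<sigma> = Q \<sigma>)"
proof -
  have "fm_definable S (\<lambda>\<sigma>. (R \<sigma> \<and> Q \<sigma>) \<or> (\<not> R \<sigma> \<and> \<not> Q \<sigma>))"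
    using assms by (intro fm_definable_disj fm_definable_conj fm_definable_neg)
  moreover have "(\<lambda>\<sigma>. (R \<sigma> \<and> Q \<sigma>) \<or> (\<not> R \<sigma> \<and> \<not> Q \<sigma>)) = (\<lambda>\<sigma>. R \<sigma> = Q \<sigma>)" by (rule ext) blast
  ultimately show ?thesis by (simp only:)
qed

lemma fm_definable_Ball:
  assumes "finite A" "\<And>x. x \<in> A \<Longrightarrow> fm_definable S (R x)"
  shows "fm_definable S (\<lambda>\<sigma>. \<forall>x\<in>A. R x \<sigma>)"
  using assms
proof (induction A)
  case (insert x A)
  have "fm_definable S (\<lambda>\<sigma>. R x \<sigma> \<and> (\<forall>x\<in>A. R x \<sigma>))"
    using insert by (intro fm_definable_conj) simp_all
  then show ?case by simp
qed (simp add: fm_definable_True)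

lemma fm_definable_Bex:
  assumes "finite A" "\<And>x. x \<in> A \<Longrightarrow> fm_definable S (R x)"
  shows "fm_definable S (\<lambda>\<sigma>. \<exists>x\<in>A. R x \<sigma>)"
  using fm_definable_neg[OF fm_definable_Ball[OF assms(1) fm_definable_neg[OF assms(2)]]] by simp

lemma fm_definable_le:
  assumes "term_definable S f" "term_definable S g"
  shows "fm_definable S (\<lambda>\<sigma>. pabs (f \<sigma>) \<le> pabs (g \<sigma>))"
proof -
  obtain t where "wf_tm aff_language t" "vars_tm t \<subseteq> S" "\<And>\<sigma>. eval_tm padic_struct \<sigma> t = f \<sigma>"
    using assms(1) by (rule term_definableE) simp
  moreover obtain s where "wf_tm aff_language s" "vars_tm s \<subseteq> S" "\<And>\<sigma>. eval_tm padic_struct \<sigma> s = g \<sigma>"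
    using assms(2) by (rule term_definableE) simp
  \<comment> \<open>The arguments are swapped because \<open>Div_sym\<close> compares valuations,
    which reverse the order of the absolute values.\<close>
  ultimately have "wf_fm aff_language (Rel Div_sym [s, t])" "free_vars (Rel Div_sym [s, t]) \<subseteq> S"
    "sat padic_struct \<sigma> (Rel Div_sym [s, t]) \<longleftrightarrow> pabs (f \<sigma>) \<le> pabs (g \<sigma>)" for \<sigma>
    by (simp_all add: aff_language_def padic_struct_def pval_le_iff)
  then show ?thesis unfolding fm_definable_def by (intro exI[of _ "Rel Div_sym [s, t]"]) simp
qed

text \<open>No term names a nonzero \<open>l\<close>, so its coset is reached by scaling with 1 / l
  and testing for the coset of 1, which is \<open>Q_sym\<close>. The case \<open>l = 0\<close> is an
  equation.\<close>

lemma fm_definable_cosim: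
  assumes f: "term_definable S f" and mn: "m \<ge> 1" "n \<ge> 1"
  shows "fm_definable S (\<lambda>\<sigma>. cosim m n (f \<sigma>) l)"
proof (cases "l = 0")
  case True
  have "cosim m n x 0 \<longleftrightarrow> x = 0" for x :: "'a padic" using cosim_0[of m n x 0] mn(2) by auto
  then show ?thesis using fm_definable_eq0[OF f] True by simp
next
  case False
  obtain t where t: "wf_tm aff_language t" "vars_tm t \<subseteq> S" "\<And>\<sigma>. eval_tm padic_struct \<sigma> t = (1 / l) * f \<sigma>"
    using term_definable_scale[OF f, of "1 / l"] by (rule term_definableE) simp
  have "cosim m n ((1 / l) * x) 1 \<longleftrightarrow> cosim m n x l" for x
    using cosim_mult[of m n "(1 / l) * x" 1 l] cosim_mult[of m n x l "1 / l"] False by auto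
  then have "wf_fm aff_language (Rel (Q_sym m n) [t])" "free_vars (Rel (Q_sym m n) [t]) \<subseteq> S"
    "sat padic_struct \<sigma> (Rel (Q_sym m n) [t]) \<longleftrightarrow> cosim m n (f \<sigma>) l" for \<sigma>
    using t mn by (simp_all add: aff_language_def padic_struct_def Qset_iff)
  then show ?thesis unfolding fm_definable_def by (intro exI[of _ "Rel (Q_sym m n) [t]"]) simp
qed

lemma fm_definable_Ex:
  assumes "fm_definable S R"
  shows "fm_definable (S - {i}) (\<lambda>\<sigma>. \<exists>u. R (\<sigma>(i := u)))"
proof -
  obtain \<phi> where "wf_fm aff_language \<phi>" "free_vars \<phi> \<subseteq> S" "\<And>\<sigma>. sat padic_struct \<sigma> \<phi> \<longleftrightarrow> R \<sigma>"
    using assms by (rule fm_definableE) simp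
  then show ?thesis unfolding fm_definable_def by (intro exI[of _ "Ex i \<phi>"]) auto
qed

lemma fm_definable_Ex_block:
  assumes "fm_definable S R"
  shows "fm_definable (S - {q..<q + D}) (\<lambda>\<sigma>. \<exists>w. R (\<lambda>l. if q \<le> l \<and> l < q + D then w l else \<sigma> l))"
proof (induction D)
  case 0
  have "(\<lambda>l. if q \<le> l \<and> l < q + 0 then w l else \<sigma> l) = \<sigma>" for w \<sigma> :: "nat \<Rightarrow> 'a padic" by (rule ext) auto
  then show ?case using assms by simp
next
  case (Suc D)
  have set_eq: "S - {q..<q + D} - {q + D} = S - {q..<q + Suc D}" by auto
  have "(\<exists>u w. R (\<lambda>l. if q \<le> l \<and> l < q + D then w l else (\<sigma>(q + D := u)) l)) \<longleftrightarrow>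
      (\<exists>w. R (\<lambda>l. if q \<le> l \<and> l < q + Suc D then w l else \<sigma> l))" for \<sigma>
  proof
    assume "\<exists>u w. R (\<lambda>l. if q \<le> l \<and> l < q + D then w l else (\<sigma>(q + D := u)) l)"
    then obtain u w where R: "R (\<lambda>l. if q \<le> l \<and> l < q + D then w l else (\<sigma>(q + D := u)) l)" by auto
    have "(\<lambda>l. if q \<le> l \<and> l < q + D then w l else (\<sigma>(q + D := u)) l) =
        (\<lambda>l. if q \<le> l \<and> l < q + Suc D then (w(q + D := u)) l else \<sigma> l)" by (rule ext) auto
    with R show "\<exists>w. R (\<lambda>l. if q \<le> l \<and> l < q + Suc D then w l else \<sigma> l)" by (intro exI[of _ "w(q + D := u)"]) simp
  next
    assume "\<exists>w. R (\<lambda>l. if q \<le> l \<and> l < q + Suc D then w l else \<sigma> l)"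
    then obtain w where R: "R (\<lambda>l. if q \<le> l \<and> l < q + Suc D then w l else \<sigma> l)" by auto
    have "(\<lambda>l. if q \<le> l \<and> l < q + Suc D then w l else \<sigma> l) =
      (\<lambda>l. if q \<le> l \<and> l < q + D then w l else (\<sigma>(q + D := w (q + D))) l)" by (rule ext) auto
    with R show "\<exists>u w. R (\<lambda>l. if q \<le> l \<and> l < q + D then w l else (\<sigma>(q + D := u)) l)"
      by (intro exI[of _ "w (q + D)"] exI[of _ w]) simp
  qed
  then show ?case using fm_definable_Ex[OF Suc.IH, of "q + D"] unfolding set_eq by simp
qed

text \<open>Padding with 0 gives each block of variables a canonical representative, so that tuples
  can be compared as functions.\<close>

definition slice :: "nat \<Rightarrow> nat \<Rightarrow> (nat \<Rightarrow> 'k::zero) \<Rightarrow> nat \<Rightarrow> 'k" where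
  "slice k q \<sigma> = (\<lambda>l. if l < k then \<sigma> (q + l) else 0)"

abbreviation slices :: "nat \<Rightarrow> nat \<Rightarrow> (nat \<Rightarrow> 'k::zero) \<Rightarrow> nat \<Rightarrow> nat \<Rightarrow> 'k" where
  "slices k q \<sigma> \<equiv> \<lambda>r. slice k (q + r * k) \<sigma>"

lemma term_definable_ev_slice:
  assumes "{q..<q + k} \<subseteq> S"
  shows "term_definable S (\<lambda>\<sigma>. ev k f (slice k q \<sigma>))"
proof -
  have "term_definable S (\<lambda>\<sigma>. \<Sum>l<k. f l * \<sigma> (q + l))"
    using assms by (intro term_definable_sum term_definable_scale term_definable_var) auto
  then show ?thesis by (simp add: ev_def slice_def)
qed

context linear_atoms
begin

lemma fm_definable_atom:
  assumes "\<chi> \<in> atoms" "{qa..<qa + d} \<subseteq> S" "{qb..<qb + e} \<subseteq> S" "{qc..<qc + e} \<subseteq> S"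
  shows "fm_definable S (\<lambda>\<sigma>. \<chi> (slice d qa \<sigma>) (slice e qb \<sigma>) (slice e qc \<sigma>))"
  using assms(1)
proof (cases \<chi> rule: atomsE)
  case (cmp i j i' j')
  show ?thesis
    unfolding cmp(1) cmp_atom_def
    by (intro fm_definable_le term_definable_diff term_definable_ev_slice assms)
next
  case (coset i j l)
  show ?thesis
    unfolding coset(1) coset_atom_def
    by (intro fm_definable_cosim term_definable_diff term_definable_ev_slice assms m n)
next
  case (loc i j j' k)
  have "loc k t s x \<longleftrightarrow> pabs (prime_elt powi (- k) * (t - s)) \<le> pabs (x - t)" for t s x :: "'p padic"
    by (simp add: loc_def)
  then show ?thesis
    unfolding loc(1) loc_atom_def
    by (simp only:) (intro fm_definable_le term_definable_diff term_definable_scale term_definable_ev_slice assms)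
qed

end

section \<open>The distal cell decomposition\<close>

lemma has_exponentI:
  assumes "\<And>B. B \<subseteq> tuples e \<Longrightarrow> finite B \<Longrightarrow> B \<noteq> {} \<Longrightarrow> card (cells M d T B) \<le> C * card B ^ k"
  shows "has_exponent M d e T (real k)"
  unfolding has_exponent_def
proof (intro exI[of _ "real C"] allI impI, elim conjE)
  fix B :: "'a list set" assume B: "B \<subseteq> tuples e" "finite B" "B \<noteq> {}"
  then have "card B > 0" by (simp add: card_gt_0_iff)
  then have "real (card B) powr real k = real (card B ^ k)" by (simp add: powr_realpow)
  moreover have "real (card (cells M d T B)) \<le> real (C * card B ^ k)"
    using assms[OF B] by (rule of_nat_mono)
  ultimately show "real (card (cells M d T B)) \<le> real C * real (card B) powr real k" by simp
qed

lemma distal_density_le: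
  assumes "distal_cell_decomposition L M d e \<Phi> T" "has_exponent M d e T r" "r \<ge> 0"
  shows "distal_density L M d e \<Phi> \<le> ereal r"
  unfolding distal_density_def using assms by (intro Inf_lower) blast

text \<open>Repeating one element pads the list to the prescribed length; this is where
  \<open>S\<close> has to be nonempty.\<close>

lemma ex_enumeration:
  assumes "finite S" "S \<noteq> {}" "card S \<le> k"
  shows "\<exists>xs. set xs = S \<and> length xs = k"
proof -
  obtain ys where ys: "set ys = S" "distinct ys" using finite_distinct_list[OF assms(1)] by blast
  then have "length ys = card S" using distinct_card by metis
  moreover obtain y where "y \<in> S" using assms(2) by blast
  ultimately have "set (ys @ replicate (k - card S) y) = S \<and> length (ys @ replicate (k - card S) y) = k"
    using ys(1) assms(3) by (auto simp: set_replicate_conv_if)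
  then show ?thesis by blast
qed

definition tuple_fun :: "nat \<Rightarrow> 'k::zero list \<Rightarrow> nat \<Rightarrow> 'k" where
  "tuple_fun k a = (\<lambda>l. if l < k then a ! l else 0)"

abbreviation tuple_funs :: "nat \<Rightarrow> 'k::zero list list \<Rightarrow> nat \<Rightarrow> nat \<Rightarrow> 'k" where
  "tuple_funs k bs \<equiv> \<lambda>r. tuple_fun k (bs ! r)"

lemma slice_tuple: "length a = k \<Longrightarrow> slice k 0 (\<lambda>i. (a @ b) ! i) = tuple_fun k a"
  by (auto simp: slice_def tuple_fun_def nth_append)

lemma nth_concat_const:
  assumes "\<And>b. b \<in> set bs \<Longrightarrow> length b = e" "r < length bs" "l < e"
  shows "concat bs ! (r * e + l) = bs ! r ! l"
  using assms
proof (induction bs arbitrary: r)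
  case (Cons b bs)
  have b: "length b = e" using Cons.prems(1) by simp
  show ?case
  proof (cases r)
    case 0
    then show ?thesis using Cons.prems b by (simp add: nth_append)
  next
    case (Suc r')
    have "concat bs ! (r' * e + l) = bs ! r' ! l" using Cons.prems Suc by (intro Cons.IH) simp_all
    then show ?thesis using b Suc by (simp add: nth_append add.assoc)
  qed
qed simp

lemma slice_concat:
  assumes "length a = q" "\<And>b. b \<in> set bs \<Longrightarrow> length b = e" "r < length bs"
  shows "slice e (q + r * e) (\<lambda>i. (a @ concat bs) ! i) = tuple_fun e (bs ! r)"
proof
  fix l
  show "slice e (q + r * e) (\<lambda>i. (a @ concat bs) ! i) l = tuple_fun e (bs ! r) l"
  proof (cases "l < e")
    case True
    then show ?thesis using nth_concat_const[OF assms(2,3) True] assms(1)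
      by (simp add: slice_def tuple_fun_def nth_append add.assoc)
  qed (simp add: slice_def tuple_fun_def)
qed

context linear_atoms
begin

lemma same_type_refl: "same_type B a a"
  by (simp add: same_type_def)

lemma same_typeD: "same_type B a a' \<Longrightarrow> \<chi> \<in> atoms \<Longrightarrow> b \<in> B \<Longrightarrow> b' \<in> B \<Longrightarrow> \<chi> a b b' = \<chi> a' b b'"
  unfolding same_type_def by (drule (1) bspec)+

lemma same_type_sym:
  assumes "same_type B a a'"
  shows "same_type B a' a"
  unfolding same_type_def by (intro ballI same_typeD[OF assms, symmetric])

lemma same_type_trans:
  assumes "same_type B a a'" "same_type B a' a''"
  shows "same_type B a a''"
  unfolding same_type_def
proof (intro ballI)
  fix \<chi> b b' assume "\<chi> \<in> atoms" "b \<in> B" "b' \<in> B"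
  note * = same_typeD[OF assms(1) this] same_typeD[OF assms(2) this]
  show "\<chi> a b b' = \<chi> a'' b b'" unfolding * ..
qed

text \<open>The successor makes the number positive, so that every cell has parameters and a nearest
  center among them exists.\<close>

definition num_atoms :: nat where "num_atoms = Suc basis_bound"

text \<open>A cell is given by \<open>num_atoms\<close> atoms together with their truth values, the \<open>r\<close>-th atom having the
  parameters number \<open>2 r\<close> and \<open>2 r + 1\<close>.\<close>

definition cell where
  "cell ss a bs \<longleftrightarrow> (\<forall>r\<in>{..<num_atoms}. fst (ss ! r) a (bs (2 * r)) (bs (2 * r + 1)) = snd (ss ! r))"

definition schemes :: "(((nat \<Rightarrow> 'p padic) \<Rightarrow> (nat \<Rightarrow> 'p padic) \<Rightarrow> (nat \<Rightarrow> 'p padic) \<Rightarrow> bool) \<times> bool) list set" where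
  "schemes = {ss. set ss \<subseteq> atoms \<times> UNIV \<and> length ss = num_atoms}"

text \<open>The failures of a set with parameters \<open>bs\<close> to be the realization of a type over \<open>B \<ni> b\<close>:
  it is crossed by an atom, or the nearest centers are not among the parameters.\<close>

definition defect where
  "defect a a' b bs \<longleftrightarrow>
     (\<exists>\<chi>\<in>atoms. \<not> (\<chi> a b b = \<chi> a' b b)) \<or>
     (\<exists>\<chi>\<in>atoms. \<exists>r\<in>{..<2 * num_atoms}. \<not> (\<chi> a (bs r) b = \<chi> a' (bs r) b)) \<or>
     (\<exists>i\<in>I. \<exists>j\<in>J. \<forall>r\<in>{..<2 * num_atoms}. \<forall>j'\<in>J.
        \<not> gap i a j' (bs r) \<le> gap i a j b)"

abbreviation excluded where
  "excluded ss b bs \<equiv> \<exists>a a'. cell ss (slice d 0 a) bs \<and> cell ss (slice d 0 a') bs \<and>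
     defect (slice d 0 a) (slice d 0 a') b bs"

lemma cell_cong:
  assumes "\<And>r. r < 2 * num_atoms \<Longrightarrow> bs r = bs' r"
  shows "cell ss a bs \<longleftrightarrow> cell ss a bs'"
  unfolding cell_def
proof (intro ball_cong refl)
  fix r assume "r \<in> {..<num_atoms}"
  then have "2 * r < 2 * num_atoms" "2 * r + 1 < 2 * num_atoms" by auto
  then show "(fst (ss ! r) a (bs (2 * r)) (bs (2 * r + 1)) = snd (ss ! r)) =
      (fst (ss ! r) a (bs' (2 * r)) (bs' (2 * r + 1)) = snd (ss ! r))"
    by (simp only: assms)
qed

lemma defect_cong:
  assumes "\<And>r. r < 2 * num_atoms \<Longrightarrow> bs r = bs' r"
  shows "defect a a' b bs \<longleftrightarrow> defect a a' b bs'"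
  unfolding defect_def by (simp add: assms)

lemma finite_schemes: "finite schemes"
  unfolding schemes_def using finite_atoms by (intro finite_lists_length_eq) simp

lemma schemes_nth:
  assumes "ss \<in> schemes" "r < num_atoms"
  shows "fst (ss ! r) \<in> atoms"
proof -
  have sub: "set ss \<subseteq> atoms \<times> UNIV" and "length ss = num_atoms"
    using assms(1) by (simp_all add: schemes_def)
  then have "ss ! r \<in> set ss" using assms(2) by simp
  then have "ss ! r \<in> atoms \<times> UNIV" by (rule subsetD[OF sub])
  then show ?thesis by (simp add: mem_Times_iff)
qed

lemma block_subset:
  assumes "{q..<q + k * e} \<subseteq> S" "r < k"
  shows "{q + r * e..<q + r * e + e} \<subseteq> S"
proof -
  have "Suc r * e \<le> k * e" using assms(2) by (intro mult_right_mono) simp_all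
  then have "{q + r * e..<q + r * e + e} \<subseteq> {q..<q + k * e}" by auto
  then show ?thesis using assms(1) by (rule subset_trans)
qed

lemma fm_definable_cell:
  assumes ss: "ss \<in> schemes" and S: "{qa..<qa + d} \<subseteq> S" "{q..<q + 2 * num_atoms * e} \<subseteq> S"
  shows "fm_definable S (\<lambda>\<sigma>. cell ss (slice d qa \<sigma>) (slices e q \<sigma>))"
  unfolding cell_def
proof (intro fm_definable_Ball)
  fix r assume r: "r \<in> {..<num_atoms}"
  note sub = block_subset[OF S(2)]
  have const: "fm_definable S (\<lambda>_ :: nat \<Rightarrow> 'p padic. snd (ss ! r))"
    using fm_definable_True[of S] fm_definable_neg[OF fm_definable_True[of S]] by (cases "snd (ss ! r)") simp_all
  have "2 * r < 2 * num_atoms" "2 * r + 1 < 2 * num_atoms" using r by auto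
  then show "fm_definable S (\<lambda>\<sigma>. fst (ss ! r) (slice d qa \<sigma>) (slice e (q + 2 * r * e) \<sigma>) (slice e (q + (2 * r + 1) * e) \<sigma>) = snd (ss ! r))"
    using r by (intro fm_definable_iff const fm_definable_atom schemes_nth[OF ss] S(1) sub) simp_all
qed simp

lemma fm_definable_defect:
  assumes S: "{qa..<qa + d} \<subseteq> S" "{qa'..<qa' + d} \<subseteq> S" "{qb..<qb + e} \<subseteq> S" "{q..<q + 2 * num_atoms * e} \<subseteq> S"
  shows "fm_definable S (\<lambda>\<sigma>. defect (slice d qa \<sigma>) (slice d qa' \<sigma>) (slice e qb \<sigma>) (slices e q \<sigma>))"
  unfolding defect_def
  by (intro fm_definable_disj fm_definable_Bex fm_definable_Ball fm_definable_neg fm_definable_iff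
      fm_definable_atom fm_definable_le term_definable_diff term_definable_ev_slice
      finite_atoms finite_I finite_J finite_lessThan S block_subset[OF S(4)])
    (simp_all only: lessThan_iff)

lemma ex_cell_formula:
  assumes "ss \<in> schemes"
  shows "\<exists>\<psi>. formula_in aff_language (d + 2 * num_atoms * e) \<psi> \<and>
    (\<forall>\<sigma>. sat padic_struct \<sigma> \<psi> \<longleftrightarrow> cell ss (slice d 0 \<sigma>) (slices e d \<sigma>))"
proof -
  have "fm_definable {..<d + 2 * num_atoms * e} (\<lambda>\<sigma>. cell ss (slice d 0 \<sigma>) (slices e d \<sigma>))"
    by (intro fm_definable_cell[OF assms]) auto
  then show ?thesis unfolding fm_definable_def formula_in_def by (simp only: conj_assoc)
qed

text \<open>The two points of the cell become a block of 2d bound variables, placed from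
  \<open>q\<close> on, behind the variables of \<open>b\<close> and of the parameters.\<close>

lemma ex_exclusion_formula:
  assumes "ss \<in> schemes"
  shows "\<exists>\<theta>. formula_in aff_language (e + 2 * num_atoms * e) \<theta> \<and>
    (\<forall>\<sigma>. sat padic_struct \<sigma> \<theta> \<longleftrightarrow> excluded ss (slice e 0 \<sigma>) (slices e e \<sigma>))"
proof -
  define q where "q = e + 2 * num_atoms * e"
  define R where "R \<sigma> \<longleftrightarrow> cell ss (slice d q \<sigma>) (slices e e \<sigma>) \<and>
     cell ss (slice d (q + d) \<sigma>) (slices e e \<sigma>) \<and>
     defect (slice d q \<sigma>) (slice d (q + d) \<sigma>) (slice e 0 \<sigma>) (slices e e \<sigma>)" for \<sigma>
  have "fm_definable {..<q + 2 * d} R"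
    unfolding R_def
    by (intro fm_definable_conj fm_definable_cell[OF assms] fm_definable_defect) (auto simp: q_def)
  from fm_definable_Ex_block[OF this, of q "2 * d"]
  have "fm_definable ({..<q + 2 * d} - {q..<q + 2 * d}) (\<lambda>\<sigma>. \<exists>w. R (\<lambda>l. if q \<le> l \<and> l < q + 2 * d then w l else \<sigma> l))" .
  moreover have "{..<q + 2 * d} - {q..<q + 2 * d} = {..<q}" by auto
  moreover have "(\<exists>w. R (\<lambda>l. if q \<le> l \<and> l < q + 2 * d then w l else \<sigma> l)) \<longleftrightarrow>
    excluded ss (slice e 0 \<sigma>) (slices e e \<sigma>)" (is "?l \<longleftrightarrow> ?r") for \<sigma>
  proof -
    define ov where "ov w = (\<lambda>l. if q \<le> l \<and> l < q + 2 * d then w l else \<sigma> l)" for w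
    have 1: "slice d q (ov w) = slice d 0 (\<lambda>l. w (q + l))" for w by (rule ext) (simp add: slice_def ov_def)
    have 2: "slice d (q + d) (ov w) = slice d 0 (\<lambda>l. w (q + d + l))" for w
      by (rule ext) (simp add: slice_def ov_def)
    have 3: "slice e 0 (ov w) = slice e 0 \<sigma>" for w by (rule ext) (simp add: slice_def ov_def q_def)
    have 4: "slice e (e + r * e) (ov w) = slice e (e + r * e) \<sigma>" if "r < 2 * num_atoms" for w r
    proof
      fix l
      have "Suc r * e \<le> 2 * num_atoms * e" using that by (intro mult_right_mono) simp_all
      then show "slice e (e + r * e) (ov w) l = slice e (e + r * e) \<sigma> l"
        by (simp add: slice_def ov_def q_def)
    qed
    have cell4: "cell ss a (slices e e (ov w)) \<longleftrightarrow> cell ss a (slices e e \<sigma>)" for a w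
      by (rule cell_cong) (rule 4)
    have defect4: "defect a a' b (slices e e (ov w)) \<longleftrightarrow> defect a a' b (slices e e \<sigma>)" for a a' b w
      by (rule defect_cong) (rule 4)
    have R: "R (ov w) \<longleftrightarrow> cell ss (slice d 0 (\<lambda>l. w (q + l))) (slices e e \<sigma>) \<and>
       cell ss (slice d 0 (\<lambda>l. w (q + d + l))) (slices e e \<sigma>) \<and>
       defect (slice d 0 (\<lambda>l. w (q + l))) (slice d 0 (\<lambda>l. w (q + d + l))) (slice e 0 \<sigma>) (slices e e \<sigma>)" for w
      unfolding R_def cell4 defect4 1 2 3 ..
    have "?l \<longleftrightarrow> (\<exists>w. R (ov w))" unfolding ov_def ..
    also have "\<dots> \<longleftrightarrow> ?r"
    proof
      assume "\<exists>w. R (ov w)"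
      then obtain w where "R (ov w)" by (rule exE)
      then show ?r unfolding R by (intro exI[of _ "\<lambda>l. w (q + l)"] exI[of _ "\<lambda>l. w (q + d + l)"])
    next
      assume ?r
      then obtain a a' where aa: "cell ss (slice d 0 a) (slices e e \<sigma>) \<and>
       cell ss (slice d 0 a') (slices e e \<sigma>) \<and>
       defect (slice d 0 a) (slice d 0 a') (slice e 0 \<sigma>) (slices e e \<sigma>)" by (elim exE)
      define w where "w l = (if l < q + d then a (l - q) else a' (l - (q + d)))" for l
      have "slice d 0 (\<lambda>l. w (q + l)) = slice d 0 a" "slice d 0 (\<lambda>l. w (q + d + l)) = slice d 0 a'"
        by (auto simp: slice_def w_def)
      then have "R (ov w)" unfolding R using aa by (simp only:)
      then show "\<exists>w. R (ov w)" by (rule exI[of _ w])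
    qed
    finally show ?thesis .
  qed
  ultimately show ?thesis unfolding fm_definable_def formula_in_def q_def by (simp only: conj_assoc)
qed

definition cell_formula where
  "cell_formula ss = (SOME \<psi>. formula_in aff_language (d + 2 * num_atoms * e) \<psi> \<and>
    (\<forall>\<sigma>. sat padic_struct \<sigma> \<psi> \<longleftrightarrow> cell ss (slice d 0 \<sigma>) (slices e d \<sigma>)))"

definition exclusion_formula where
  "exclusion_formula ss = (SOME \<theta>. formula_in aff_language (e + 2 * num_atoms * e) \<theta> \<and>
    (\<forall>\<sigma>. sat padic_struct \<sigma> \<theta> \<longleftrightarrow> excluded ss (slice e 0 \<sigma>) (slices e e \<sigma>)))"

text \<open>Two schemes may have the same cell formula, but then they have the same cells; so it does not
  matter which one the exclusion formula is taken from.\<close>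

definition decomposition :: "('p padic aff_fn, aff_rel) cell_scheme" where
  "decomposition = \<lparr>params = 2 * num_atoms, cell_fms = cell_formula ` schemes,
     excl_fm = (\<lambda>\<psi>. exclusion_formula (inv_into schemes cell_formula \<psi>))\<rparr>"

lemmas cell_formula = someI_ex[OF ex_cell_formula, folded cell_formula_def]

lemmas exclusion_formula = someI_ex[OF ex_exclusion_formula, folded exclusion_formula_def]

lemma holds_cell_formula:
  assumes "ss \<in> schemes" "a \<in> tuples d" "length bs = 2 * num_atoms" "set bs \<subseteq> tuples e"
  shows "holds padic_struct (cell_formula ss) (a @ concat bs) \<longleftrightarrow>
    cell ss (tuple_fun d a) (tuple_funs e bs)"
proof -
  have len: "length a = d" "\<And>b. b \<in> set bs \<Longrightarrow> length b = e" using assms(2,4) by (auto simp: tuples_def)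
  have "cell ss (tuple_fun d a) (slices e d (\<lambda>i. (a @ concat bs) ! i)) \<longleftrightarrow>
    cell ss (tuple_fun d a) (tuple_funs e bs)"
    using assms(3) by (intro cell_cong slice_concat len) simp_all
  then show ?thesis
    unfolding holds_def cell_formula[OF assms(1), THEN conjunct2, rule_format] slice_tuple[OF len(1)] .
qed

lemma holds_exclusion_formula:
  assumes "ss \<in> schemes" "b \<in> tuples e" "length bs = 2 * num_atoms" "set bs \<subseteq> tuples e"
  shows "holds padic_struct (exclusion_formula ss) (b @ concat bs) \<longleftrightarrow>
    excluded ss (tuple_fun e b) (tuple_funs e bs)"
proof -
  have len: "length b = e" "\<And>b. b \<in> set bs \<Longrightarrow> length b = e" using assms(2,4) by (auto simp: tuples_def)
  have 1: "slice e (e + r * e) (\<lambda>i. (b @ concat bs) ! i) = tuple_fun e (bs ! r)" if "r < 2 * num_atoms" for r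
    using assms(3) that by (intro slice_concat len) simp_all
  have 2: "cell ss a (slices e e (\<lambda>i. (b @ concat bs) ! i)) \<longleftrightarrow>
    cell ss a (tuple_funs e bs)" for a
    by (intro cell_cong 1)
  have 3: "defect a a' c (slices e e (\<lambda>i. (b @ concat bs) ! i)) \<longleftrightarrow>
    defect a a' c (tuple_funs e bs)" for a a' c
    by (intro defect_cong 1)
  show ?thesis
    unfolding holds_def exclusion_formula[OF assms(1), THEN conjunct2, rule_format] slice_tuple[OF len(1)] 2 3 ..
qed

lemma cell_eq_if_formula_eq:
  assumes "ss \<in> schemes" "ss' \<in> schemes" "cell_formula ss = cell_formula ss'"
    "length bs = 2 * num_atoms" "set bs \<subseteq> tuples e"
  shows "cell ss (slice d 0 a) (tuple_funs e bs) \<longleftrightarrow> cell ss' (slice d 0 a) (tuple_funs e bs)"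
proof -
  have "slice d 0 a = tuple_fun d (map a [0..<d])" by (auto simp: slice_def tuple_fun_def)
  moreover have "map a [0..<d] \<in> tuples d" by (simp add: tuples_def)
  ultimately show ?thesis
    using holds_cell_formula[OF assms(1) _ assms(4,5)] holds_cell_formula[OF assms(2) _ assms(4,5)] assms(3)
    by simp
qed

definition good where
  "good B ss bs \<longleftrightarrow> ss \<in> schemes \<and> length bs = 2 * num_atoms \<and> set bs \<subseteq> B \<and>
    (\<forall>b\<in>B. \<not> excluded ss (tuple_fun e b) (tuple_funs e bs))"

lemma goodD:
  assumes "good B ss bs"
  shows "ss \<in> schemes" "length bs = 2 * num_atoms" "set bs \<subseteq> B"
    "b \<in> B \<Longrightarrow> \<not> excluded ss (tuple_fun e b) (tuple_funs e bs)"
  using assms unfolding good_def by simp_all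

lemma cells_decomposition:
  assumes B: "B \<subseteq> tuples e"
  shows "cells padic_struct d decomposition B =
    {{a \<in> tuples d. cell ss (tuple_fun d a) (tuple_funs e bs)} | ss bs. good B ss bs}"
proof -
  define pick where "pick \<psi> = inv_into schemes cell_formula \<psi>" for \<psi>
  have pick: "pick (cell_formula ss) \<in> schemes" "cell_formula (pick (cell_formula ss)) = cell_formula ss"
    if "ss \<in> schemes" for ss
    unfolding pick_def by (rule inv_into_into[OF imageI[OF that]], rule f_inv_into_f[OF imageI[OF that]])
  have set_eq: "definable_set padic_struct d (cell_formula ss) (concat bs) =
     {a \<in> tuples d. cell ss (tuple_fun d a) (tuple_funs e bs)}"
    if "ss \<in> schemes" "length bs = 2 * num_atoms" "set bs \<subseteq> B" for ss bs
    unfolding definable_set_def using holds_cell_formula[OF that(1) _ that(2) subset_trans[OF that(3) B]]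
    by (intro Collect_cong conj_cong refl)
  have good_iff: "good B ss bs \<longleftrightarrow> \<not> (\<exists>b\<in>B. holds padic_struct (exclusion_formula (pick (cell_formula ss))) (b @ concat bs))"
    if ss: "ss \<in> schemes" and bs: "length bs = 2 * num_atoms" "set bs \<subseteq> B" for ss bs
  proof -
    have bs': "set bs \<subseteq> tuples e" using bs(2) B by (rule subset_trans)
    have ceq: "cell (pick (cell_formula ss)) (slice d 0 a) (tuple_funs e bs) \<longleftrightarrow>
        cell ss (slice d 0 a) (tuple_funs e bs)" for a
      by (rule cell_eq_if_formula_eq[OF pick(1)[OF ss] ss pick(2)[OF ss] bs(1) bs'])
    have "holds padic_struct (exclusion_formula (pick (cell_formula ss))) (b @ concat bs) \<longleftrightarrow>
       excluded ss (tuple_fun e b) (tuple_funs e bs)" if "b \<in> B" for b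
      unfolding ceq[symmetric]
      by (rule holds_exclusion_formula[OF pick(1)[OF ss] subsetD[OF B that] bs(1) bs'])
    then show ?thesis using ss bs unfolding good_def by simp
  qed
  have "cells padic_struct d decomposition B =
    {definable_set padic_struct d (cell_formula ss) (concat bs) | ss bs. ss \<in> schemes \<and> length bs = 2 * num_atoms \<and> set bs \<subseteq> B \<and>
      \<not> (\<exists>b\<in>B. holds padic_struct (exclusion_formula (pick (cell_formula ss))) (b @ concat bs))}"
    unfolding cells_def decomposition_def pick_def cell_scheme.simps by blast
  also have "\<dots> = {{a \<in> tuples d. cell ss (tuple_fun d a) (tuple_funs e bs)} | ss bs. good B ss bs}"
  proof (intro Collect_cong ex_cong1)
    fix X ss bs
    show "(X = definable_set padic_struct d (cell_formula ss) (concat bs) \<and> ss \<in> schemes \<and> length bs = 2 * num_atoms \<and> set bs \<subseteq> B \<and>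
        \<not> (\<exists>b\<in>B. holds padic_struct (exclusion_formula (pick (cell_formula ss))) (b @ concat bs))) \<longleftrightarrow>
      (X = {a \<in> tuples d. cell ss (tuple_fun d a) (tuple_funs e bs)} \<and> good B ss bs)"
    proof (cases "ss \<in> schemes \<and> length bs = 2 * num_atoms \<and> set bs \<subseteq> B")
      case True
      then show ?thesis using set_eq[of ss bs] good_iff[of ss bs] by simp
    next
      case False
      then have "\<not> good B ss bs" by (auto simp: good_def)
      then show ?thesis using False by blast
    qed
  qed
  finally show ?thesis .
qed

section \<open>Nonempty cells are the realizations of types\<close>

lemma num_atoms_pos: "0 < num_atoms"
  by (simp add: num_atoms_def)

lemma slice_tuple_fun [simp]: "slice k 0 (tuple_fun k a) = tuple_fun k a"
  by (auto simp: slice_def tuple_fun_def)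

lemma good_same_type:
  assumes good: "good B ss bs" and B: "B \<noteq> {}"
    and a: "cell ss (tuple_fun d a) (tuple_funs e bs)"
    and a': "cell ss (tuple_fun d a') (tuple_funs e bs)"
  shows "same_type (tuple_fun e ` B) (tuple_fun d a) (tuple_fun d a')"
proof -
  let ?B = "tuple_fun e ` B" and ?bs = "tuple_funs e bs"
  have no_defect: "\<not> defect (tuple_fun d a) (tuple_fun d a') b ?bs" if b: "b \<in> ?B" for b
  proof -
    obtain b0 where "b0 \<in> B" "b = tuple_fun e b0" using b by auto
    then show ?thesis
      using goodD(4)[OF good, of b0] a a' by (metis slice_tuple_fun)
  qed
  show ?thesis
  proof (rule same_type_if_uncrossed[where P = "?bs ` {..<2 * num_atoms}"])
    have "bs ! r \<in> B" if "r < 2 * num_atoms" for r using goodD(2,3)[OF good] nth_mem[of r bs] that by auto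
    then show "?bs ` {..<2 * num_atoms} \<subseteq> ?B" by auto
  next
    fix i assume i: "i \<in> I"
    have "?bs 0 \<in> ?bs ` {..<2 * num_atoms}" using num_atoms_pos by (intro imageI) simp
    then have "?bs ` {..<2 * num_atoms} \<noteq> {}" by blast
    moreover have "finite (?bs ` {..<2 * num_atoms})" by simp
    ultimately obtain j p where jp: "j \<in> J" "p \<in> ?bs ` {..<2 * num_atoms}"
      "nearest (?bs ` {..<2 * num_atoms}) i (tuple_fun d a) j p"
      using ex_nearest by blast
    \<comment> \<open>A center nearest among the parameters is nearest over all of \<open>B\<close>,
      since otherwise some element of \<open>B\<close> would reveal the third kind of
      defect.\<close>
    have "nearest ?B i (tuple_fun d a) j p"
      unfolding nearest_def
    proof (intro ballI)
      fix j' b' assume j': "j' \<in> J" and b': "b' \<in> ?B"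
      have "\<not> (\<forall>r\<in>{..<2 * num_atoms}. \<forall>j2\<in>J. \<not> gap i (tuple_fun d a) j2 (?bs r) \<le>
        gap i (tuple_fun d a) j' b')"
        using no_defect[OF b'] i j' unfolding defect_def by simp
      then obtain r j2 where r: "r \<in> {..<2 * num_atoms}" "j2 \<in> J"
        "gap i (tuple_fun d a) j2 (?bs r) \<le> gap i (tuple_fun d a) j' b'" by auto
      have "gap i (tuple_fun d a) j p \<le> gap i (tuple_fun d a) j2 (?bs r)"
        using jp(3) r(1,2) unfolding nearest_def by simp
      then show "gap i (tuple_fun d a) j p \<le> gap i (tuple_fun d a) j' b'"
        using r(3) by linarith
    qed
    then show "\<exists>j\<in>J. \<exists>p\<in>?bs ` {..<2 * num_atoms}. nearest ?B i (tuple_fun d a) j p" using jp(1,2) by blast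
  next
    fix \<chi> p b assume \<chi>: "\<chi> \<in> atoms" and p: "p \<in> ?bs ` {..<2 * num_atoms}" and b: "b \<in> ?B"
    obtain r where "r \<in> {..<2 * num_atoms}" "p = ?bs r" using p by auto
    then show "\<chi> (tuple_fun d a) p b = \<chi> (tuple_fun d a') p b"
      using no_defect[OF b] \<chi> unfolding defect_def by simp
  next
    fix \<chi> b assume "\<chi> \<in> atoms" "b \<in> ?B"
    then show "\<chi> (tuple_fun d a) b b = \<chi> (tuple_fun d a') b b"
      using no_defect[of b] unfolding defect_def by simp
  qed
qed

text \<open>A cell prescribes truth values of atoms with parameters in \<open>B\<close>, so it is a
  union of types; \<open>good_same_type\<close> leaves at most one.\<close>

lemma good_invariant:
  assumes good: "good B ss bs" and a: "cell ss (tuple_fun d a) (tuple_funs e bs)"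
    and same: "same_type (tuple_fun e ` B) (tuple_fun d a) (tuple_fun d a')"
  shows "cell ss (tuple_fun d a') (tuple_funs e bs)"
  unfolding cell_def
proof
  fix r assume r: "r \<in> {..<num_atoms}"
  have B: "tuple_fun e (bs ! r') \<in> tuple_fun e ` B" if "r' < 2 * num_atoms" for r'
    using goodD(2)[OF good] that by (intro imageI subsetD[OF goodD(3)[OF good]] nth_mem) simp
  have "fst (ss ! r) \<in> atoms" using schemes_nth[OF goodD(1)[OF good]] r by simp
  from same_typeD[OF same this B B, of "2 * r" "2 * r + 1"] r
  have "fst (ss ! r) (tuple_fun d a) (tuple_fun e (bs ! (2 * r))) (tuple_fun e (bs ! (2 * r + 1))) =
    fst (ss ! r) (tuple_fun d a') (tuple_fun e (bs ! (2 * r))) (tuple_fun e (bs ! (2 * r + 1)))" by simp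
  moreover have "fst (ss ! r) (tuple_fun d a) (tuple_fun e (bs ! (2 * r))) (tuple_fun e (bs ! (2 * r + 1))) = snd (ss ! r)"
    using a r unfolding cell_def by (rule bspec)
  ultimately show "fst (ss ! r) (tuple_fun d a') (tuple_fun e (bs ! (2 * r))) (tuple_fun e (bs ! (2 * r + 1))) = snd (ss ! r)"
    by simp
qed

lemma ex_good:
  assumes B: "finite B" "B \<noteq> {}" and I: "I \<noteq> {}"
  shows "\<exists>ss bs. good B ss bs \<and> cell ss (tuple_fun d a) (tuple_funs e bs)"
proof -
  let ?B = "tuple_fun e ` B" and ?a = "tuple_fun d a"
  have B': "finite ?B" "?B \<noteq> {}" using B by simp_all
  from type_basis[OF B', of ?a] obtain S where S: "S \<subseteq> atoms \<times> ?B \<times> ?B \<and> card S \<le> basis_bound \<and>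
    (\<forall>i\<in>I. \<exists>j\<in>J. \<exists>\<chi> p. (\<chi>, p, p) \<in> S \<and> nearest ?B i ?a j p) \<and>
    (\<forall>a'. agree_on S ?a a' \<longrightarrow> same_type ?B ?a a')"
    by (rule exE)
  note S1 = S[THEN conjunct1] and S2 = S[THEN conjunct2, THEN conjunct1]
    and S3 = S[THEN conjunct2, THEN conjunct2, THEN conjunct1, THEN bspec]
    and S4 = S[THEN conjunct2, THEN conjunct2, THEN conjunct2, THEN spec, THEN mp]
  have finS: "finite S" using finite_atoms B'(1) by (intro finite_subset[OF S1]) simp
  obtain i0 where "i0 \<in> I" using I by blast
  from S3[OF this] have "S \<noteq> {}" by auto
  moreover have "card S \<le> num_atoms" using S2 by (simp add: num_atoms_def)
  ultimately obtain xs where xs: "set xs = S" "length xs = num_atoms" using ex_enumeration[OF finS] by blast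
  define g where "g = inv_into B (tuple_fun e)"
  have g: "g b \<in> B" "tuple_fun e (g b) = b" if "b \<in> ?B" for b
    unfolding g_def by (rule inv_into_into[OF that], rule f_inv_into_f[OF that])
  define ss where "ss = map (\<lambda>(\<chi>, b, b'). (\<chi>, \<chi> ?a b b')) xs"
  \<comment> \<open>Even positions carry first and odd positions second parameters, as
    \<open>cell\<close> expects; \<open>g\<close> returns from functions to tuples in
    \<open>B\<close>.\<close>
  define bs where "bs = map (\<lambda>q. case xs ! (q div 2) of (\<chi>, b, b') \<Rightarrow> if even q then g b else g b') [0..<2 * num_atoms]"
  let ?bs = "tuple_funs e bs"
  have xs_nth: "xs ! r \<in> atoms \<times> ?B \<times> ?B" if "r < num_atoms" for r
    using nth_mem[of r xs] xs that by (intro subsetD[OF S1]) simp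
  have nths: "ss ! r = (\<chi>, \<chi> ?a b b')" "?bs (2 * r) = b" "?bs (2 * r + 1) = b'"
    "bs ! (2 * r) \<in> B" "bs ! (2 * r + 1) \<in> B"
    if r: "r < num_atoms" and x: "xs ! r = (\<chi>, b, b')" for r \<chi> b b'
  proof -
    have b: "b \<in> ?B" "b' \<in> ?B" using xs_nth[OF r] x by simp_all
    show "ss ! r = (\<chi>, \<chi> ?a b b')" using r x xs(2) by (simp add: ss_def)
    have "2 * r < 2 * num_atoms" "2 * r + 1 < 2 * num_atoms" using r by auto
    then have "bs ! (2 * r) = g b" "bs ! (2 * r + 1) = g b'" using x by (simp_all add: bs_def del: upt_Suc)
    then show "?bs (2 * r) = b" "?bs (2 * r + 1) = b'" "bs ! (2 * r) \<in> B" "bs ! (2 * r + 1) \<in> B"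
      using g[OF b(1)] g[OF b(2)] by simp_all
  qed
  have bsB: "bs ! q \<in> B" if q: "q < 2 * num_atoms" for q
  proof -
    have r: "q div 2 < num_atoms" using q by simp
    obtain \<chi> b b' where x: "xs ! (q div 2) = (\<chi>, b, b')" by (cases "xs ! (q div 2)" rule: prod_cases3)
    show ?thesis using nths(4,5)[OF r x] by (cases "even q") auto
  qed
  have cell_iff: "cell ss a' ?bs \<longleftrightarrow> agree_on S ?a a'" for a'
  proof -
    have "fst (ss ! r) a' (?bs (2 * r)) (?bs (2 * r + 1)) = snd (ss ! r) \<longleftrightarrow>
        (case xs ! r of (\<chi>, b, b') \<Rightarrow> \<chi> ?a b b' = \<chi> a' b b')" if r: "r < num_atoms" for r
    proof -
      obtain \<chi> b b' where x: "xs ! r = (\<chi>, b, b')" by (cases "xs ! r" rule: prod_cases3)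
      show ?thesis unfolding nths(1-3)[OF r x] unfolding x by auto
    qed
    then have "cell ss a' ?bs \<longleftrightarrow> (\<forall>r<num_atoms. case xs ! r of (\<chi>, b, b') \<Rightarrow> \<chi> ?a b b' = \<chi> a' b b')"
      unfolding cell_def by (simp add: Ball_def)
    also have "\<dots> \<longleftrightarrow> (\<forall>x\<in>set xs. case x of (\<chi>, b, b') \<Rightarrow> \<chi> ?a b b' = \<chi> a' b b')"
      unfolding xs(2)[symmetric] by (simp only: all_set_conv_all_nth)
    finally show ?thesis unfolding xs(1) agree_on_def .
  qed
  have "good B ss bs"
    unfolding good_def
  proof (intro conjI ballI allI impI)
    have "set ss \<subseteq> atoms \<times> UNIV"
    proof
      fix y assume "y \<in> set ss"
      then obtain r where r: "r < num_atoms" "y = ss ! r" using xs(2) by (auto simp: in_set_conv_nth ss_def)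
      obtain \<chi> b b' where x: "xs ! r = (\<chi>, b, b')" by (cases "xs ! r" rule: prod_cases3)
      show "y \<in> atoms \<times> UNIV" using xs_nth[OF r(1)] unfolding r(2) nths(1)[OF r(1) x] unfolding x by simp
    qed
    then show "ss \<in> schemes" using xs(2) by (simp add: schemes_def ss_def)
    show len: "length bs = 2 * num_atoms" by (simp add: bs_def)
    show "set bs \<subseteq> B"
    proof
      fix y assume "y \<in> set bs"
      then obtain q where "q < 2 * num_atoms" "y = bs ! q" using len by (auto simp: in_set_conv_nth)
      then show "y \<in> B" using bsB by simp
    qed
  next
    fix b assume b: "b \<in> B"
    have "\<not> defect (slice d 0 a1) (slice d 0 a2) (tuple_fun e b) ?bs"
      if cells: "cell ss (slice d 0 a1) ?bs" "cell ss (slice d 0 a2) ?bs" for a1 a2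
    proof -
      have same: "same_type ?B ?a (slice d 0 a1)" "same_type ?B ?a (slice d 0 a2)"
        using cells S4 unfolding cell_iff by simp_all
      let ?a1 = "slice d 0 a1" and ?a2 = "slice d 0 a2" and ?b = "tuple_fun e b"
      have same12: "same_type ?B ?a1 ?a2" by (rule same_type_trans[OF same_type_sym[OF same(1)] same(2)])
      have bB: "?b \<in> ?B" using b by simp
      show "\<not> defect ?a1 ?a2 ?b ?bs"
        unfolding defect_def
      proof (intro notI, elim disjE bexE)
        fix \<chi> assume "\<chi> \<in> atoms" "\<not> (\<chi> ?a1 ?b ?b = \<chi> ?a2 ?b ?b)"
        then show False using same_typeD[OF same12 _ bB bB] by simp
      next
        fix \<chi> r assume "\<chi> \<in> atoms" "r \<in> {..<2 * num_atoms}" and neq: "\<not> (\<chi> ?a1 (?bs r) ?b = \<chi> ?a2 (?bs r) ?b)"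
        then have "?bs r \<in> ?B" using bsB by simp
        then show False using same_typeD[OF same12 \<open>\<chi> \<in> atoms\<close> _ bB] neq by simp
      next
        fix i j assume i: "i \<in> I" and j: "j \<in> J" and far: "\<forall>r\<in>{..<2 * num_atoms}. \<forall>j'\<in>J.
          \<not> gap i ?a1 j' (?bs r) \<le> gap i ?a1 j ?b"
        \<comment> \<open>The basis contains a parameter whose center is nearest for
          \<open>?a\<close>. Location atoms at scale 0 transfer this to every other point of the
          cell, so the third kind of defect cannot occur.\<close>
        from S3[OF i] obtain j' \<chi> p where p: "j' \<in> J" "(\<chi>, p, p) \<in> S" "nearest ?B i ?a j' p" by blast
        obtain r where r: "r < num_atoms" "xs ! r = (\<chi>, p, p)"
          using p(2) xs by (metis in_set_conv_nth)
        have pr: "?bs (2 * r) = p" using nths(2)[OF r] .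
        have pB: "p \<in> ?B" using xs_nth[OF r(1)] r(2) by simp
        let ?T = "(\<lambda>(j, b). ev e j b) ` (J \<times> ?B)"
        have T: "ev e j b \<in> ?T" if "j \<in> J" "b \<in> ?B" for j b using that by force
        have "gap i ?a1 j' p \<le> gap i ?a1 j ?b"
        proof (rule nearest_transfer[OF _ T[OF p(1) pB] T[OF j bB]])
          show "gap i ?a j' p \<le> pabs (ev d i ?a - s)" if "s \<in> ?T" for s
            using p(3) that unfolding nearest_def by auto
          show "loc 0 t s (ev d i ?a) = loc 0 t s (ev d i ?a1)" if st: "s \<in> ?T" "t \<in> ?T" for s t
          proof -
            obtain j1 b1 where 1: "j1 \<in> J" "b1 \<in> ?B" "s = ev e j1 b1" using st(1) by auto
            obtain j2 b2 where 2: "j2 \<in> J" "b2 \<in> ?B" "t = ev e j2 b2" using st(2) by auto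
            have "loc_atom i j2 j1 0 \<in> atoms" using atomsI(3)[OF i 2(1) 1(1)] by simp
            from same_typeD[OF same(1) this 2(2) 1(2)] show ?thesis unfolding loc_atom_def 1(3) 2(3) .
          qed
        qed
        then show False using far[THEN bspec, of "2 * r", THEN bspec, OF _ p(1)] r(1) unfolding pr by simp
      qed
    qed
    then show "\<not> excluded ss (tuple_fun e b) ?bs" by blast
  qed
  moreover have "cell ss ?a ?bs" unfolding cell_iff agree_on_def by auto
  ultimately show ?thesis by blast
qed

lemma cells_cover:
  assumes B: "B \<subseteq> tuples e" "finite B" "B \<noteq> {}" and I: "I \<noteq> {}"
  shows "\<Union>(cells padic_struct d decomposition B) = tuples d"
proof
  show "\<Union>(cells padic_struct d decomposition B) \<subseteq> tuples d" unfolding cells_decomposition[OF B(1)] by auto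
  show "tuples d \<subseteq> \<Union>(cells padic_struct d decomposition B)"
  proof
    fix a :: "'p padic list" assume a: "a \<in> tuples d"
    from ex_good[OF B(2,3) I] obtain ss bs where "good B ss bs" "cell ss (tuple_fun d a) (tuple_funs e bs)" by blast
    then have "{a \<in> tuples d. cell ss (tuple_fun d a) (tuple_funs e bs)} \<in> cells padic_struct d decomposition B"
      "a \<in> {a \<in> tuples d. cell ss (tuple_fun d a) (tuple_funs e bs)}"
      unfolding cells_decomposition[OF B(1)] using a by blast+
    then show "a \<in> \<Union>(cells padic_struct d decomposition B)" by (rule UnionI)
  qed
qed

lemma cells_same_type:
  assumes B: "B \<subseteq> tuples e" "B \<noteq> {}" and \<Delta>: "\<Delta> \<in> cells padic_struct d decomposition B" and a: "a \<in> \<Delta>"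
  shows "a' \<in> \<Delta> \<longleftrightarrow> a' \<in> tuples d \<and> same_type (tuple_fun e ` B) (tuple_fun d a) (tuple_fun d a')"
proof -
  obtain ss bs where ss: "\<Delta> = {a \<in> tuples d. cell ss (tuple_fun d a) (tuple_funs e bs)}" "good B ss bs"
    using \<Delta> unfolding cells_decomposition[OF B(1)] by blast
  have "cell ss (tuple_fun d a) (tuple_funs e bs)" using a ss(1) by simp
  from good_same_type[OF ss(2) B(2) this] good_invariant[OF ss(2) this] show ?thesis
    unfolding ss(1) mem_Collect_eq by metis
qed

text \<open>Distinct nonempty cells are realizations of distinct types, so one point from each gives
  a set for \<open>card_types\<close>. The + 1 is for the empty set: a scheme with contradictory
  atoms has no points, hence nothing excludes it.\<close>

lemma card_cells:
  assumes B: "B \<subseteq> tuples e" "finite B" "B \<noteq> {}"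
  shows "card (cells padic_struct d decomposition B) \<le>
    (comparison_bound ^ d * card \<Lambda> ^ card I + 1) * card B ^ d"
proof -
  let ?B = "tuple_fun e ` B" and ?C = "cells padic_struct d decomposition B - {{}}"
  have fin: "finite (cells padic_struct d decomposition B)"
    using finite_schemes B(2) by (intro finite_cells) (simp_all add: decomposition_def)
  define pt where "pt \<Delta> = (SOME a. a \<in> \<Delta>)" for \<Delta> :: "'p padic list set"
  have pt: "pt \<Delta> \<in> \<Delta>" if "\<Delta> \<in> ?C" for \<Delta> unfolding pt_def using that by (intro someI_ex[of "\<lambda>a. a \<in> \<Delta>"]) blast
  define R where "R = (\<lambda>\<Delta>. tuple_fun d (pt \<Delta>)) ` ?C"
  have eq: "\<Delta> = \<Delta>'" if "\<Delta> \<in> ?C" "\<Delta>' \<in> ?C" "same_type ?B (tuple_fun d (pt \<Delta>)) (tuple_fun d (pt \<Delta>'))" for \<Delta> \<Delta>'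
  proof -
    have "\<Delta> \<in> cells padic_struct d decomposition B" "\<Delta>' \<in> cells padic_struct d decomposition B" using that by simp_all
    note c = cells_same_type[OF B(1,3) this(1) pt[OF that(1)]] cells_same_type[OF B(1,3) this(2) pt[OF that(2)]]
    show ?thesis
    proof (rule Set.set_eqI)
      fix a
      have "same_type ?B (tuple_fun d (pt \<Delta>)) (tuple_fun d a) \<longleftrightarrow> same_type ?B (tuple_fun d (pt \<Delta>')) (tuple_fun d a)"
        using same_type_trans[OF that(3)] same_type_trans[OF same_type_sym[OF that(3)]] by metis
      then show "a \<in> \<Delta> \<longleftrightarrow> a \<in> \<Delta>'" unfolding c[of a] by simp
    qed
  qed
  have "inj_on (\<lambda>\<Delta>. tuple_fun d (pt \<Delta>)) ?C"
  proof (rule inj_onI)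
    fix \<Delta> \<Delta>' assume "\<Delta> \<in> ?C" "\<Delta>' \<in> ?C" "tuple_fun d (pt \<Delta>) = tuple_fun d (pt \<Delta>')"
    then show "\<Delta> = \<Delta>'" using eq[of \<Delta> \<Delta>'] same_type_refl by simp
  qed
  then have "card ?C = card R" unfolding R_def by (rule card_image[symmetric])
  also have "\<dots> \<le> (comparison_bound * card ?B) ^ d * card \<Lambda> ^ card I"
  proof (rule card_types)
    show "finite ?B" "?B \<noteq> {}" using B by simp_all
    show "finite R" unfolding R_def using fin by simp
    fix a a' assume "a \<in> R" "a' \<in> R" and ne: "a \<noteq> a'"
    then obtain \<Delta> \<Delta>' where *: "\<Delta> \<in> ?C" "\<Delta>' \<in> ?C" "a = tuple_fun d (pt \<Delta>)" "a' = tuple_fun d (pt \<Delta>')"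
      unfolding R_def by blast
    show "\<not> same_type ?B a a'"
    proof
      assume "same_type ?B a a'"
      then have "\<Delta> = \<Delta>'" using eq[OF *(1,2)] *(3,4) by simp
      then show False using ne *(3,4) by simp
    qed
  qed
  also have "\<dots> \<le> (comparison_bound * card B) ^ d * card \<Lambda> ^ card I"
    using card_image_le[OF B(2), of "tuple_fun e"] by (intro mult_right_mono power_mono mult_left_mono) simp_all
  finally have "card ?C \<le> comparison_bound ^ d * card \<Lambda> ^ card I * card B ^ d"
    by (simp only: power_mult_distrib ac_simps)
  moreover have "1 \<le> card B ^ d" using B by (simp add: Suc_leI card_gt_0_iff)
  moreover have "card (cells padic_struct d decomposition B) \<le> card ?C + 1"
    using card_Diff_singleton_if[of "cells padic_struct d decomposition B" "{}"] by (simp split: if_splits)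
  ultimately show ?thesis by (simp only: distrib_right mult_1_left)
qed

end

text \<open>The variables from \<open>d + e\<close> on are the bound variables of the given formulas.\<close>

lemma agree_if_same_type:
  fixes F :: "(nat \<Rightarrow> 'p::prime_card padic) set"
  assumes atoms: "linear_atoms m n I J \<Lambda>" and I: "F \<subseteq> I" and J: "(\<lambda>f l. - f (d + l)) ` F \<subseteq> J" and N: "d + e \<le> N"
    and same: "linear_atoms.same_type d e m n I J \<Lambda> B (slice d 0 \<sigma>) (slice d 0 \<tau>)"
    and b: "slice e d \<sigma> \<in> B" "slice e d \<sigma> = slice e d \<tau>"
    and zero: "\<And>l. d + e \<le> l \<Longrightarrow> \<sigma> l = 0 \<and> \<tau> l = 0"
  shows "agree N F m n \<sigma> \<tau>"
proof -
  interpret linear_atoms d e m n I J \<Lambda> by (rule atoms)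
  \<comment> \<open>With all variables from d + e on equal to 0, a form splits into an x-part and a
    y-part; the sign turns the latter into a center.\<close>
  have split: "ev N f \<upsilon> = ev d f (slice d 0 \<upsilon>) - ev e (\<lambda>l. - f (d + l)) (slice e d \<upsilon>)"
    if "\<And>l. d + e \<le> l \<Longrightarrow> \<upsilon> l = 0" for f \<upsilon> :: "nat \<Rightarrow> 'p padic"
  proof -
    have "ev N f \<upsilon> = (\<Sum>l<d + e. f l * \<upsilon> l)"
      unfolding ev_def using N that by (intro sum.mono_neutral_right) auto
    also have "\<dots> = (\<Sum>l<d. f l * \<upsilon> l) + (\<Sum>l<e. f (d + l) * \<upsilon> (d + l))"
      by (induction e) (simp_all add: add.assoc)
    finally show ?thesis by (simp add: ev_def slice_def sum_negf)
  qed
  let ?a = "slice d 0 \<sigma>" and ?a' = "slice d 0 \<tau>" and ?b = "slice e d \<sigma>"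
  have \<sigma>: "ev N f \<sigma> = ev d f ?a - ev e (\<lambda>l. - f (d + l)) ?b"
    and \<tau>: "ev N f \<tau> = ev d f ?a' - ev e (\<lambda>l. - f (d + l)) ?b" for f
    using split[of \<sigma> f] split[of \<tau> f] zero b(2) by simp_all
  have fI: "f \<in> I" and fJ: "(\<lambda>l. - f (d + l)) \<in> J" if "f \<in> F" for f using that I J by auto
  show ?thesis
    unfolding agree_def \<sigma> \<tau>
  proof (intro conjI ballI)
    fix f assume f: "f \<in> F"
    show "cosim m n (ev d f ?a - ev e (\<lambda>l. - f (d + l)) ?b) (ev d f ?a' - ev e (\<lambda>l. - f (d + l)) ?b)"
      by (rule cosim_if_coset_atoms[OF fI[OF f] fJ[OF f]])
        (rule same_typeD[OF same atomsI(2)[OF fI[OF f] fJ[OF f]] b(1) b(1)])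
  next
    fix f g assume f: "f \<in> F" and g: "g \<in> F"
    from same_typeD[OF same atomsI(1)[OF fI[OF f] fJ[OF f] fI[OF g] fJ[OF g]] b(1) b(1)]
    show "pabs (ev d f ?a - ev e (\<lambda>l. - f (d + l)) ?b) \<le> pabs (ev d g ?a - ev e (\<lambda>l. - g (d + l)) ?b) \<longleftrightarrow>
      pabs (ev d f ?a' - ev e (\<lambda>l. - f (d + l)) ?b) \<le> pabs (ev d g ?a' - ev e (\<lambda>l. - g (d + l)) ?b)"
      unfolding cmp_atom_def .
  qed
qed

lemma finitely_many_formulas_determined:
  fixes \<Phi> :: "('p::prime_card padic aff_fn, aff_rel) fm set"
  assumes "finite \<Phi>" "\<forall>\<phi>\<in>\<Phi>. wf_fm aff_language \<phi> \<and> all_vars \<phi> \<subseteq> {..<N}"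
  shows "\<exists>F m n. finite F \<and> m \<ge> 1 \<and> n \<ge> 1 \<and> (\<forall>\<phi>\<in>\<Phi>. \<forall>\<sigma> \<sigma>'. agree N F m n \<sigma> \<sigma>' \<longrightarrow>
    sat padic_struct \<sigma> \<phi> = sat padic_struct \<sigma>' \<phi>)"
  using assms
proof (induction \<Phi>)
  case empty
  show ?case by (intro exI[of _ "{}"] exI[of _ 1]) simp
next
  case (insert \<phi> \<Phi>)
  then obtain F1 m1 n1 where 1: "finite F1 \<and> m1 \<ge> 1 \<and> n1 \<ge> 1 \<and> (\<forall>\<phi>\<in>\<Phi>. \<forall>\<sigma> \<sigma>'. agree N F1 m1 n1 \<sigma> \<sigma>' \<longrightarrow>
    sat padic_struct \<sigma> \<phi> = sat padic_struct \<sigma>' \<phi>)" by auto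
  from insert.prems have "wf_fm aff_language \<phi>" "all_vars \<phi> \<subseteq> {..<N}" by simp_all
  from sat_determined_by_linear_forms[OF this] obtain F2 m2 n2 where 2: "finite F2 \<and> m2 \<ge> 1 \<and> n2 \<ge> 1 \<and>
    (\<forall>\<sigma> \<sigma>'. agree N F2 m2 n2 \<sigma> \<sigma>' \<longrightarrow> sat padic_struct \<sigma> \<phi> = sat padic_struct \<sigma>' \<phi>)" by auto
  have union: "sat padic_struct \<sigma> \<psi> = sat padic_struct \<sigma>' \<psi>"
    if ag: "agree N (F1 \<union> F2) (m1 * m2) (max n1 n2) \<sigma> \<sigma>'" and \<psi>: "\<psi> \<in> insert \<phi> \<Phi>" for \<psi> \<sigma> \<sigma>'
  proof -
    have "agree N F1 m1 n1 \<sigma> \<sigma>'" "agree N F2 m2 n2 \<sigma> \<sigma>'" by (auto intro: agree_mono[OF ag])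
    then show ?thesis using 1 2 \<psi> by auto
  qed
  show ?case
  proof (rule exI[of _ "F1 \<union> F2"], rule exI[of _ "m1 * m2"], rule exI[of _ "max n1 n2"],
      intro conjI ballI allI impI)
    show "finite (F1 \<union> F2)" "m1 * m2 \<ge> 1" "max n1 n2 \<ge> 1"
      using 1 2 by (simp_all add: le_max_iff_disj)
  qed (rule union)
qed

theorem theorem6p1:
  fixes \<Phi> :: "('p::prime_card padic aff_fn, aff_rel) fm set" and d e :: nat
  assumes "finite \<Phi>" and "\<forall>\<phi>\<in>\<Phi>. formula_in aff_language (d + e) \<phi>"
  shows "(\<exists>T. distal_cell_decomposition aff_language padic_struct d e \<Phi> T \<and>
              has_exponent padic_struct d e T (real d)) \<and>
         distal_density aff_language padic_struct d e \<Phi> \<le> ereal (real d)"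
proof -
  obtain N where N: "d + e \<le> N" "\<And>\<phi>. \<phi> \<in> \<Phi> \<Longrightarrow> all_vars \<phi> \<subseteq> {..<N}"
  proof -
    have "finite (\<Union>\<phi>\<in>\<Phi>. all_vars \<phi>)" using assms(1) by (simp add: finite_all_vars)
    then obtain M where M: "(\<Union>\<phi>\<in>\<Phi>. all_vars \<phi>) \<subseteq> {..<M}" by (rule finite_nat_bounded[THEN exE])
    show ?thesis
    proof (rule that[of "max (d + e) M"])
      show "all_vars \<phi> \<subseteq> {..<max (d + e) M}" if "\<phi> \<in> \<Phi>" for \<phi> using M that by fastforce
    qed simp
  qed
  have "\<forall>\<phi>\<in>\<Phi>. wf_fm aff_language \<phi> \<and> all_vars \<phi> \<subseteq> {..<N}"
    using assms(2) N(2) by (simp add: formula_in_def)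
  from finitely_many_formulas_determined[OF assms(1) this] obtain F m n where
    F: "finite F" "m \<ge> 1" "n \<ge> 1" and det: "\<forall>\<phi>\<in>\<Phi>. \<forall>\<sigma> \<sigma>'. agree N F m n \<sigma> \<sigma>' \<longrightarrow>
    sat padic_struct \<sigma> \<phi> = sat padic_struct \<sigma>' \<phi>" by (elim exE conjE)
  obtain \<Lambda> :: "'p padic set" where \<Lambda>: "finite \<Lambda>" "\<And>x. \<exists>l\<in>\<Lambda>. cosim m n x l"
    using coset_representatives[OF F(3,2)] by blast
  \<comment> \<open>The zero forms keep \<open>I\<close> and \<open>J\<close> nonempty in case
    \<open>F\<close> is empty.\<close>
  define I where "I = insert (\<lambda>_. 0) F"
  define J where "J = insert (\<lambda>_. 0) ((\<lambda>f l. - f (d + l)) ` F)"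
  have atoms: "linear_atoms m n I J \<Lambda>"
    by unfold_locales (use F \<Lambda> in \<open>simp_all add: I_def J_def\<close>)
  interpret linear_atoms d e m n I J \<Lambda> by (rule atoms)
  have "distal_cell_decomposition aff_language padic_struct d e \<Phi> decomposition"
    unfolding distal_cell_decomposition_def
  proof (intro conjI ballI allI impI; (elim conjE)?)
    show "finite (cell_fms decomposition)" using finite_schemes by (simp add: decomposition_def)
  next
    fix \<psi> assume "\<psi> \<in> cell_fms decomposition"
    then have \<psi>: "\<psi> \<in> cell_formula ` schemes" by (simp add: decomposition_def)
    then obtain ss where "ss \<in> schemes" "\<psi> = cell_formula ss" by blast
    then show "formula_in aff_language (d + params decomposition * e) \<psi>"
      using cell_formula[of ss] by (simp add: decomposition_def)
    show "formula_in aff_language (e + params decomposition * e) (excl_fm decomposition \<psi>)"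
      using exclusion_formula[OF inv_into_into[OF \<psi>]] by (simp add: decomposition_def)
  next
    fix B :: "'p padic list set" assume B: "B \<subseteq> tuples e" "finite B" "B \<noteq> {}"
    show "\<Union>(cells padic_struct d decomposition B) = tuples d"
      by (rule cells_cover[OF B]) (simp add: I_def)
  next
    fix B \<Delta> assume B: "B \<subseteq> tuples e" "finite B" "B \<noteq> {}" and \<Delta>: "\<Delta> \<in> cells padic_struct d decomposition B"
    show "\<not> crossed padic_struct d \<Phi> B \<Delta>"
    proof
      assume "crossed padic_struct d \<Phi> B \<Delta>"
      then obtain \<phi> b a a' where \<phi>: "\<phi> \<in> \<Phi>" and b: "b \<in> B" and a: "a \<in> \<Delta>" "a \<in> definable_set padic_struct d \<phi> b"
        and a': "a' \<in> \<Delta>" "a' \<notin> definable_set padic_struct d \<phi> b"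
        unfolding crossed_def by blast
      have len: "length a = d" "length a' = d" "length b = e"
        using cells_same_type[OF B(1,3) \<Delta> a(1), of a] cells_same_type[OF B(1,3) \<Delta> a(1), of a'] a(1) a'(1) b B(1)
        by (auto simp: tuples_def)
      \<comment> \<open>\<open>holds\<close> leaves the variables beyond the tuple unspecified. They
        are not free in \<open>\<phi>\<close>, so they may be set to 0, as
        \<open>agree_if_same_type\<close> requires.\<close>
      define env where "env x = (\<lambda>l. if l < d + e then (x @ b) ! l else 0)" for x
      have sat_env: "holds padic_struct \<phi> (x @ b) = sat padic_struct (env x) \<phi>" for x
        unfolding holds_def using assms(2) \<phi> by (intro sat_cong) (auto simp: env_def formula_in_def)
      have env: "slice d 0 (env x) = tuple_fun d x" "slice e d (env x) = tuple_fun e b" if "length x = d" for x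
        using that by (auto simp: slice_def tuple_fun_def env_def nth_append)
      have "agree N F m n (env a) (env a')"
      proof (rule agree_if_same_type[OF atoms _ _ N(1), where B = "tuple_fun e ` B"])
        show "same_type (tuple_fun e ` B) (slice d 0 (env a)) (slice d 0 (env a'))"
          unfolding env[OF len(1)] env[OF len(2)] using cells_same_type[OF B(1,3) \<Delta> a(1)] a'(1) by blast
        show "slice e d (env a) \<in> tuple_fun e ` B" "slice e d (env a) = slice e d (env a')"
          unfolding env[OF len(1)] env[OF len(2)] using b by simp_all
        show "env a l = 0 \<and> env a' l = 0" if "d + e \<le> l" for l using that by (simp add: env_def)
      qed (auto simp: I_def J_def)
      then have "holds padic_struct \<phi> (a @ b) = holds padic_struct \<phi> (a' @ b)"
        unfolding sat_env using det \<phi> by blast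
      then show False using a(2) a'(2) len by (simp add: definable_set_def tuples_def)
    qed
  qed
  moreover have "has_exponent padic_struct d e decomposition (real d)"
    by (rule has_exponentI) (rule card_cells)
  ultimately show ?thesis using distal_density_le[of aff_language padic_struct d e \<Phi> decomposition "real d"] by auto
qed

end
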